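(* Let $\mathcal{H}_{S_\mu}$ be the open string on $w_1,\dots,w_\mu$, i.e. the string with $\mu$ vertices all of which are open except the end vertices. Let $F=\{w_{i_1},\dots,w_{i_k}\}$ with $k>1$ and $1\le i_1<\dots<i_k\le\mu$, and let $\mathcal{H}=\mathcal{H}_{S_\mu}\cup\{F\}$. Let $n_1=i_1-1$, $n_j=i_j-i_{j-1}-1$ for $2\le j\le k$, $n_{k+1}=\mu-i_k$, and write $n_i=3l_i+r_i$ with $l_i\ge 0$ an integer and $0\le r_i\le 2$, for $1\le i\le k+1$. If $r_1+\dots+r_{k+1}=2k$ and $r_i\ne 0$ for all $i$, then $\mathrm{pd}(\mathcal{H})=\mathrm{pd}(\mathcal{H}_{S_\mu})+1$; otherwise $\mathrm{pd}(\mathcal{H})=\mathrm{pd}(\mathcal{H}_{S_\mu})=\mu-\left\lfloor\frac{\mu}{3}\right\rfloor$.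
   Context: A hypergraph $\mathcal{H}$ on a finite vertex set $V$ is a set of nonempty subsets of $V$ (called edges) covering $V$. All hypergraphs are assumed separated: for any two distinct vertices $v,w$ there are edges $F_1,F_2$ with $v\in F_1\setminus F_2$ and $w\in F_2\setminus F_1$. Let $\mathbb{K}$ be a field. To $\mathcal{H}$ one associates the square-free monomial ideal $I(\mathcal{H})$ in the polynomial ring $R=\mathbb{K}[x_E : E\in\mathcal{H}]$ (one variable for each edge), minimally generated by the monomials $m_v=\prod_{E\ni v}x_E$, $v\in V$. Put $\mathrm{pd}(\mathcal{H})=\mathrm{pd}_R(R/I(\mathcal{H}))$, the projective dimension. A vertex $v$ is closed if $\{v\}\in\mathcal{H}$, and open otherwise. Open string on $w_1,\dots,w_\mu$: the hypergraph with edges $\{w_i,w_{i+1}\}$ for $1\le i\le \mu-1$ together with $\{w_1\}$ and $\{w_\mu\}$. *)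

theory Defs
  imports
    "HOL-Algebra.QuotRing"
    "HOL-Algebra.Module"
    "HOL-Library.Extended_Nat"
    "HOL-Library.Poly_Mapping"
begin

section \<open>Modules, projective resolutions, projective dimension\<close>

definition mod_hom ::
  "('a, 'c) ring_scheme \<Rightarrow> ('a, 'm, 'd) module_scheme \<Rightarrow> ('a, 'n, 'e) module_scheme \<Rightarrow> ('m \<Rightarrow> 'n) set"
  where "mod_hom R M N =
    {f \<in> carrier M \<rightarrow> carrier N.
      (\<forall>x\<in>carrier M. \<forall>y\<in>carrier M. f (x \<oplus>\<^bsub>M\<^esub> y) = f x \<oplus>\<^bsub>N\<^esub> f y) \<and>
      (\<forall>a\<in>carrier R. \<forall>x\<in>carrier M. f (a \<odot>\<^bsub>M\<^esub> x) = a \<odot>\<^bsub>N\<^esub> f x)}"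

text \<open>The module record extends the ring record, so \<open>mult\<close> and \<open>one\<close> must be given a value;
  the locale \<^locale>\<open>Module.module\<close> does not refer to them.\<close>

definition free_module :: "('a, 'c) ring_scheme \<Rightarrow> 'i set \<Rightarrow> ('a, 'i \<Rightarrow> 'a) module"
  where "free_module R B =
    \<lparr>carrier = {f. (\<forall>i\<in>B. f i \<in> carrier R) \<and> (\<forall>i. i \<notin> B \<longrightarrow> f i = \<zero>\<^bsub>R\<^esub>) \<and> finite {i. f i \<noteq> \<zero>\<^bsub>R\<^esub>}},
     mult = undefined, one = undefined,
     zero = (\<lambda>i. \<zero>\<^bsub>R\<^esub>), add = (\<lambda>f g i. f i \<oplus>\<^bsub>R\<^esub> g i),
     smult = (\<lambda>a f i. a \<otimes>\<^bsub>R\<^esub> f i)\<rparr>"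

text \<open>A module is projective if it is, up to isomorphism, a direct summand of a free module, where
  the summand is given by its inclusion \<open>s\<close> and projection \<open>p\<close>. Taking the basis inside the type of
  \<open>P\<close> loses nothing: a direct summand of any free module is already one of the free module on
  \<open>carrier P\<close>.\<close>

definition projective_module :: "('a, 'c) ring_scheme \<Rightarrow> ('a, 'm, 'd) module_scheme \<Rightarrow> bool"
  where "projective_module R P \<longleftrightarrow> Module.module R P \<and>
    (\<exists>(B :: 'm set) s p. s \<in> mod_hom R P (free_module R B) \<and>
       p \<in> mod_hom R (free_module R B) P \<and> (\<forall>x\<in>carrier P. p (s x) = x))"

text \<open>The sequence \<open>\<cdots> \<rightarrow> P 2 \<rightarrow> P 1 \<rightarrow> P 0 \<rightarrow> M \<rightarrow> 0\<close> is exact, with augmentation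
  \<open>e : P 0 \<rightarrow> M\<close> and differentials \<open>d i : P (Suc i) \<rightarrow> P i\<close>.\<close>

definition projective_resolution ::
  "('a, 'c) ring_scheme \<Rightarrow> ('a, 'm, 'd) module_scheme \<Rightarrow>
   (nat \<Rightarrow> ('a, 'p, 'e) module_scheme) \<Rightarrow> ('p \<Rightarrow> 'm) \<Rightarrow> (nat \<Rightarrow> 'p \<Rightarrow> 'p) \<Rightarrow> bool"
  where "projective_resolution R M P e d \<longleftrightarrow>
    (\<forall>i. projective_module R (P i)) \<and>
    e \<in> mod_hom R (P 0) M \<and>
    (\<forall>i. d i \<in> mod_hom R (P (Suc i)) (P i)) \<and>
    e ` carrier (P 0) = carrier M \<and>
    d 0 ` carrier (P 1) = {x \<in> carrier (P 0). e x = \<zero>\<^bsub>M\<^esub>} \<and>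
    (\<forall>i. d (Suc i) ` carrier (P (Suc (Suc i))) = {x \<in> carrier (P (Suc i)). d i x = \<zero>\<^bsub>P i\<^esub>})"

text \<open>The least length of a projective resolution, \<open>\<infinity>\<close> if there is no finite one. HOL cannot
  quantify over all types, so the members of the resolution have to live in one type, here
  \<open>nat \<Rightarrow> 'a\<close>, which contains the free modules of finite and of countable rank together with all
  their submodules. For finitely generated \<open>M\<close> over a noetherian ring \<open>R\<close> this is no restriction: if
  \<open>M\<close> has any projective resolution of length \<open>n\<close>, then it has one by finitely generated free
  modules and a projective \<open>n\<close>-th syzygy, which is a submodule of such a free module.\<close>

definition proj_dim :: "('a, 'c) ring_scheme \<Rightarrow> ('a, 'm, 'd) module_scheme \<Rightarrow> enat"
  where "proj_dim R M =
    Inf {enat n | n. \<exists>(P :: nat \<Rightarrow> ('a, nat \<Rightarrow> 'a) module) e d.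
      projective_resolution R M P e d \<and> (\<forall>i>n. carrier (P i) = {\<zero>\<^bsub>P i\<^esub>})}"

text \<open>The ring \<open>R Quot I\<close> viewed as an \<open>R\<close>-module.\<close>

definition quot_module :: "('a, 'c) ring_scheme \<Rightarrow> 'a set \<Rightarrow> ('a, 'a set) module"
  where "quot_module R I =
    ring.extend (R Quot I) (module.fields (\<lambda>a X. (I +>\<^bsub>R\<^esub> a) \<otimes>\<^bsub>R Quot I\<^esub> X))"


section \<open>Polynomial rings\<close>

text \<open>The polynomial ring over the field \<open>'k\<close> whose variables are the elements of \<open>X\<close>.
  Monomials are exponent vectors \<open>'x \<Rightarrow>\<^sub>0 nat\<close>.\<close>

definition poly_ring :: "'x set \<Rightarrow> (('x \<Rightarrow>\<^sub>0 nat) \<Rightarrow>\<^sub>0 'k::field) ring"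
  where "poly_ring X =
    \<lparr>carrier = {p. \<forall>m\<in>Poly_Mapping.keys p. Poly_Mapping.keys m \<subseteq> X}, mult = (*), one = 1, zero = 0, add = (+)\<rparr>"

definition var :: "'x \<Rightarrow> ('x \<Rightarrow>\<^sub>0 nat) \<Rightarrow>\<^sub>0 'k::field"
  where "var x = Poly_Mapping.single (Poly_Mapping.single x 1) 1"


section \<open>Hypergraphs\<close>

definition hypergraph :: "'v set \<Rightarrow> 'v set set \<Rightarrow> bool"
  where "hypergraph V H \<longleftrightarrow> finite V \<and> {} \<notin> H \<and> \<Union>H = V"

definition separated :: "'v set \<Rightarrow> 'v set set \<Rightarrow> bool"
  where "separated V H \<longleftrightarrow>
    (\<forall>v\<in>V. \<forall>w\<in>V. v \<noteq> w \<longrightarrow> (\<exists>F1\<in>H. \<exists>F2\<in>H. v \<in> F1 - F2 \<and> w \<in> F2 - F1))"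

definition vertex_monomial :: "'v set set \<Rightarrow> 'v \<Rightarrow> ('v set \<Rightarrow>\<^sub>0 nat) \<Rightarrow>\<^sub>0 'k::field"
  where "vertex_monomial H v = (\<Prod>E\<in>{E \<in> H. v \<in> E}. var E)"

text \<open>The vertex set is \<open>\<Union>H\<close>, since the edges cover the vertices.\<close>

definition hypergraph_ideal :: "'v set set \<Rightarrow> (('v set \<Rightarrow>\<^sub>0 nat) \<Rightarrow>\<^sub>0 'k::field) set"
  where "hypergraph_ideal H = genideal (poly_ring H) (vertex_monomial H ` \<Union>H)"

definition pd :: "'k::field itself \<Rightarrow> 'v set set \<Rightarrow> enat"
  where "pd _ H =
    (let R = (poly_ring H :: (('v set \<Rightarrow>\<^sub>0 nat) \<Rightarrow>\<^sub>0 'k) ring)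
     in proj_dim R (quot_module R (hypergraph_ideal H)))"

definition open_string :: "(nat \<Rightarrow> 'v) \<Rightarrow> nat \<Rightarrow> 'v set set"
  where "open_string w \<mu> = {{w i, w (Suc i)} | i. 1 \<le> i \<and> i < \<mu>} \<union> {{w 1}, {w \<mu>}}"


section \<open>Well-formedness\<close>

lemma cring_poly_ring: "cring (poly_ring X :: (('x \<Rightarrow>\<^sub>0 nat) \<Rightarrow>\<^sub>0 'k::field) ring)"
proof (rule cringI)
  let ?R = "poly_ring X :: (('x \<Rightarrow>\<^sub>0 nat) \<Rightarrow>\<^sub>0 'k) ring"
  have add: "p + q \<in> carrier ?R" if "p \<in> carrier ?R" "q \<in> carrier ?R" for p q
    using that Poly_Mapping.keys_add[of p q] by (auto simp: poly_ring_def)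
  have neg: "- p \<in> carrier ?R" if "p \<in> carrier ?R" for p
    using that by (auto simp: poly_ring_def)
  have mult: "p * q \<in> carrier ?R" if "p \<in> carrier ?R" "q \<in> carrier ?R" for p q
  proof -
    have "Poly_Mapping.keys m \<subseteq> X" if m: "m \<in> Poly_Mapping.keys (p * q)" for m
    proof -
      obtain a b where "m = a + b" "a \<in> Poly_Mapping.keys p" "b \<in> Poly_Mapping.keys q"
        using m keys_mult[of p q] by blast
      then show ?thesis
        using \<open>p \<in> carrier ?R\<close> \<open>q \<in> carrier ?R\<close> Poly_Mapping.keys_add[of a b]
        unfolding poly_ring_def by simp blast
    qed
    then show ?thesis by (simp add: poly_ring_def)
  qed
  have one: "1 \<in> carrier ?R" by (simp add: poly_ring_def)
  have sel: "add ?R = (+)" "mult ?R = (*)" "zero ?R = 0" "one ?R = 1"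
    by (simp_all add: poly_ring_def)
  show "abelian_group ?R"
  proof (rule abelian_groupI, unfold sel)
    show "0 \<in> carrier ?R" by (simp add: poly_ring_def)
    fix p assume "p \<in> carrier ?R"
    then show "\<exists>y\<in>carrier ?R. y + p = 0"
      using neg[of p] by (intro bexI[of _ "- p"]) simp_all
  qed (simp_all add: add ac_simps)
  show "Group.comm_monoid ?R"
    by (rule comm_monoidI, unfold sel) (simp_all add: mult one ac_simps)
  fix p q s
  show "(p \<oplus>\<^bsub>?R\<^esub> q) \<otimes>\<^bsub>?R\<^esub> s = p \<otimes>\<^bsub>?R\<^esub> s \<oplus>\<^bsub>?R\<^esub> q \<otimes>\<^bsub>?R\<^esub> s"
    unfolding sel by (rule distrib_right)
qed

lemma vertex_monomial_in_carrier:
  "vertex_monomial H v \<in> carrier (poly_ring H :: (('v set \<Rightarrow>\<^sub>0 nat) \<Rightarrow>\<^sub>0 'k::field) ring)"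
proof -
  let ?R = "poly_ring H :: (('v set \<Rightarrow>\<^sub>0 nat) \<Rightarrow>\<^sub>0 'k) ring"
  interpret cring ?R by (rule cring_poly_ring)
  have "prod var A \<in> carrier ?R" if "A \<subseteq> H" for A
    using that
  proof (induction A rule: infinite_finite_induct)
    case (infinite A)
    then show ?case using one_closed by (simp add: poly_ring_def)
  next
    case empty
    then show ?case using one_closed by (simp add: poly_ring_def)
  next
    case (insert x A)
    have "var x \<in> carrier ?R" using insert.prems by (auto simp: poly_ring_def var_def)
    then show ?case using insert m_closed[of "var x" "prod var A"] by (simp add: poly_ring_def)
  qed
  then show ?thesis by (simp add: vertex_monomial_def)
qed

lemma ideal_hypergraph_ideal:
  "ideal (hypergraph_ideal H) (poly_ring H :: (('v set \<Rightarrow>\<^sub>0 nat) \<Rightarrow>\<^sub>0 'k::field) ring)"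
  unfolding hypergraph_ideal_def
  by (intro ring.genideal_ideal cring.axioms(1)[OF cring_poly_ring])
    (auto intro: vertex_monomial_in_carrier)

lemma module_quot_module:
  assumes "cring R" "ideal I R"
  shows "Module.module R (quot_module R I)"
proof -
  interpret R: cring R by fact
  interpret ideal I R by fact
  interpret Q: cring "R Quot I" by (rule quotient_is_cring) fact
  interpret h: ring_hom_ring R "R Quot I" "(+>\<^bsub>R\<^esub>) I" by (rule rcos_ring_hom_ring)
  have sel: "carrier (quot_module R I) = carrier (R Quot I)"
    "add (quot_module R I) = add (R Quot I)" "zero (quot_module R I) = zero (R Quot I)"
    "smult (quot_module R I) = (\<lambda>a X. (I +>\<^bsub>R\<^esub> a) \<otimes>\<^bsub>R Quot I\<^esub> X)"
    by (simp_all add: quot_module_def ring.defs module.defs)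
  show ?thesis
  proof (rule Module.moduleI)
    show "abelian_group (quot_module R I)"
    proof (rule abelian_groupI, unfold sel)
      fix x assume "x \<in> carrier (R Quot I)"
      then show "\<exists>y\<in>carrier (R Quot I). y \<oplus>\<^bsub>R Quot I\<^esub> x = \<zero>\<^bsub>R Quot I\<^esub>"
        using Q.l_neg Q.a_inv_closed by blast
    qed (simp_all add: Q.a_ac)
  qed (auto simp: sel Q.l_distr Q.r_distr Q.m_assoc assms)
qed

text \<open>Adding an edge to an open string keeps it a separated hypergraph, so the standing assumption
  of separatedness is automatic for the hypergraphs considered here.\<close>

lemma open_string_hypergraph:
  assumes "inj_on w {1..\<mu>}" "\<mu> \<ge> 1" "F \<noteq> {}" "F \<subseteq> w ` {1..\<mu>}"
  shows "hypergraph (w ` {1..\<mu>}) (open_string w \<mu>)"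
    and "separated (w ` {1..\<mu>}) (open_string w \<mu>)"
    and "hypergraph (w ` {1..\<mu>}) (open_string w \<mu> \<union> {F})"
    and "separated (w ` {1..\<mu>}) (open_string w \<mu> \<union> {F})"
proof -
  have "w ` {1..\<mu>} \<subseteq> \<Union>(open_string w \<mu>)"
  proof
    fix v assume "v \<in> w ` {1..\<mu>}"
    then obtain j where j: "v = w j" "1 \<le> j" "j \<le> \<mu>" by auto
    show "v \<in> \<Union>(open_string w \<mu>)"
    proof (cases "j = \<mu>")
      case True
      then show ?thesis using j by (auto simp: open_string_def)
    next
      case False
      then have "{w j, w (Suc j)} \<in> open_string w \<mu>"
        using j by (auto simp: open_string_def)
      then show ?thesis using j by blast
    qed
  qed
  moreover have "\<Union>(open_string w \<mu>) \<subseteq> w ` {1..\<mu>}"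
    using assms(2) by (fastforce simp: open_string_def)
  ultimately have U: "\<Union>(open_string w \<mu>) = w ` {1..\<mu>}" by blast
  then show "hypergraph (w ` {1..\<mu>}) (open_string w \<mu>)"
    by (auto simp: hypergraph_def open_string_def)
  with U show "hypergraph (w ` {1..\<mu>}) (open_string w \<mu> \<union> {F})"
    using assms(3,4) by (auto simp: hypergraph_def)
  have neq: "w b \<noteq> w a" if "1 \<le> a" "a < b" "b \<le> \<mu>" for a b
    using that inj_onD[OF assms(1), of b a] by auto
  have lower: "\<exists>E\<in>open_string w \<mu>. w i \<in> E \<and> w j \<notin> E" if "1 \<le> i" "i < j" "j \<le> \<mu>" for i j
  proof (cases "i = 1")
    case True
    then have "{w 1} \<in> open_string w \<mu>" "w j \<noteq> w 1"
      using that True neq[of 1 j] by (auto simp: open_string_def)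
    then show ?thesis using True by blast
  next
    case False
    then have "{w (i - 1), w i} \<in> open_string w \<mu>"
      unfolding open_string_def using that by (intro UnI1 CollectI exI[of _ "i - 1"]) (simp, arith)
    moreover have "w j \<noteq> w (i - 1)" "w j \<noteq> w i"
      by (rule neq; use that False in linarith)+
    ultimately show ?thesis by blast
  qed
  have upper: "\<exists>E\<in>open_string w \<mu>. w j \<in> E \<and> w i \<notin> E" if "1 \<le> i" "i < j" "j \<le> \<mu>" for i j
  proof (cases "j = \<mu>")
    case True
    then have "{w \<mu>} \<in> open_string w \<mu>" "w i \<noteq> w \<mu>"
      using that True neq[of i \<mu>] by (auto simp: open_string_def)
    then show ?thesis using True by blast
  next
    case False
    then have "{w j, w (Suc j)} \<in> open_string w \<mu>"
      using that by (auto simp: open_string_def)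
    moreover have "w j \<noteq> w i" "w (Suc j) \<noteq> w i"
      by (rule neq; use that False in linarith)+
    ultimately show ?thesis by auto
  qed
  show sep: "separated (w ` {1..\<mu>}) (open_string w \<mu>)"
    unfolding separated_def
  proof (intro ballI impI)
    fix v v' assume "v \<in> w ` {1..\<mu>}" "v' \<in> w ` {1..\<mu>}" "v \<noteq> v'"
    then obtain i j where ij: "v = w i" "v' = w j" "i \<in> {1..\<mu>}" "j \<in> {1..\<mu>}" "i \<noteq> j" by blast
    show "\<exists>F1\<in>open_string w \<mu>. \<exists>F2\<in>open_string w \<mu>. v \<in> F1 - F2 \<and> v' \<in> F2 - F1"
    proof (cases "i < j")
      case True
      then show ?thesis using ij lower[of i j] upper[of i j] by (metis DiffI atLeastAtMost_iff)
    next
      case False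
      then have "j < i" using ij by auto
      then show ?thesis using ij lower[of j i] upper[of j i] by (metis DiffI atLeastAtMost_iff)
    qed
  qed
  then show "separated (w ` {1..\<mu>}) (open_string w \<mu> \<union> {F})"
    unfolding separated_def by (meson UnI1)
qed

end

theory Submission
  imports Defs "HOL-Library.Function_Algebras"
begin

text \<open>The edges of the string are the variables \<open>v\<^sub>0, \<dots>, v\<^sub>\<mu>\<close> of a path ideal generated by the
  \<open>v\<^sub>j v\<^sub>j\<^sub>+\<^sub>1\<close>; adding \<open>F\<close> multiplies the generators at the vertices of \<open>F\<close>, the marked ones, by a
  new variable \<open>y\<close>.

  Upper bounds come from Betti splittings \<open>I = D + v C\<close>, with \<open>C = I : v\<close> and \<open>D\<close> generated by
  the generators without \<open>v\<close>, which give \<open>pd (R/I) \<le> max (pd (R/C)) (pd (R/D) + 1)\<close>. Splitting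
  along \<open>y\<close> settles the case of a small residue sum. In the remaining regular cases all residues are
  2 except for at most one, and one splits along the first vertices of the path.

  Lower bounds come from the vanishing of Koszul cohomology forced by a short resolution. Most of
  the time a socle element is enough. When exactly two residues are 1 and the others 2, in general no socle
  element detects the last syzygy. There, three consecutive vertices around a vertex \<open>u\<close> are
  removed by the Mayer-Vietoris sequence of \<open>I = (I : u) \<inter> (I, u, f)\<close>, until a socle element
  works.\<close>

text \<open>The number \<open>2 k\<close> is the threshold of the splitting along \<open>y\<close>.
  There \<open>C\<close> belongs to the whole path and has value \<open>\<mu> - \<mu> div 3\<close>,
  while \<open>D\<close> belongs to the \<open>k + 1\<close> unmarked runs and has as value the sum
  of the \<open>n j - n j div 3\<close>. If \<open>s\<close> is the sum of the residues, the value
  of \<open>D\<close> is strictly smaller exactly when \<open>(s + k) div 3 < k\<close>, that is,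
  when \<open>s < 2 * k\<close>. For \<open>s \<ge> 2 * k\<close> both values agree, and the
  splitting overshoots by at most one. Since \<open>s \<le> 2 * k + 2\<close>, few residue patterns
  remain there, and only the one with two residues 1 attains the extra one.

  A lower bound needs a single nonzero class: Koszul cohomology of a free module with respect to
  \<open>N\<close> distinct variables vanishes below degree \<open>N\<close>, and shifting along a
  resolution of length \<open>m\<close> makes \<open>H^i\<close> of the quotient vanish for
  \<open>i + m < N\<close>. A socle element is a class in degree 0. The Mayer-Vietoris step carries
  a class for a sum of two ideals to one degree higher for their intersection, so that classes in
  higher degrees arise without being written down.\<close>

abbreviation "keys \<equiv> Poly_Mapping.keys"
abbreviation "single \<equiv> Poly_Mapping.single"

type_synonym ('x, 'k) mpoly = "('x \<Rightarrow>\<^sub>0 nat) \<Rightarrow>\<^sub>0 'k"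

section \<open>Finite free resolutions\<close>

text \<open>Vectors stay opaque to the simplifier; \<open>fun_ops\<close> opens them coordinatewise
  on demand.\<close>

declare plus_fun_apply [simp del] zero_fun_apply [simp del] fun_Compl_def [simp del]

lemmas fun_ops = plus_fun_apply zero_fun_apply fun_Compl_def

text \<open>The polynomial ring on \<open>X\<close> is a subset of a type that is itself a
  commutative ring. Keeping the type class operations and carrying only the subset \<open>A\<close>
  along leaves ring algebra to the simplifier.\<close>

locale subring_of_type =
  fixes A :: "'a::comm_ring_1 set"
  assumes zero_mem: "0 \<in> A" and one_mem: "1 \<in> A"
    and add_mem: "a \<in> A \<Longrightarrow> b \<in> A \<Longrightarrow> a + b \<in> A"
    and mult_mem: "a \<in> A \<Longrightarrow> b \<in> A \<Longrightarrow> a * b \<in> A"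
    and uminus_mem: "a \<in> A \<Longrightarrow> - a \<in> A"
begin

definition Fr :: "nat \<Rightarrow> (nat \<Rightarrow> 'a) set"
  where "Fr m = {f. (\<forall>i. f i \<in> A) \<and> (\<forall>i\<ge>m. f i = 0)}"

text \<open>The linear map on \<open>Fr m\<close> with matrix \<open>c\<close>: the
  \<open>i\<close>-th unit vector goes to the row \<open>c i\<close>.\<close>

definition lincomb :: "nat \<Rightarrow> (nat \<Rightarrow> nat \<Rightarrow> 'a) \<Rightarrow> (nat \<Rightarrow> 'a) \<Rightarrow> nat \<Rightarrow> 'a"
  where "lincomb m c f = (\<lambda>j. \<Sum>i<m. f i * c i j)"

definition submod :: "(nat \<Rightarrow> 'a) set \<Rightarrow> bool"
  where "submod K \<longleftrightarrow> 0 \<in> K \<and> (\<forall>x\<in>K. \<forall>y\<in>K. x + y \<in> K) \<and> (\<forall>a\<in>A. \<forall>x\<in>K. (\<lambda>j. a * x j) \<in> K)"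

definition linear_map :: "(nat \<Rightarrow> 'a) set \<Rightarrow> ((nat \<Rightarrow> 'a) \<Rightarrow> nat \<Rightarrow> 'a) \<Rightarrow> bool"
  where "linear_map K h \<longleftrightarrow> (\<forall>x\<in>K. \<forall>y\<in>K. h (x + y) = h x + h y) \<and>
    (\<forall>a\<in>A. \<forall>x\<in>K. h (\<lambda>j. a * x j) = (\<lambda>j. a * h x j))"

text \<open>\<open>free_res n K\<close> says that \<open>K\<close> has a resolution by at most \<open>n\<close> free modules of finite rank, so that
  \<open>R / I\<close> has projective dimension at most \<open>n\<close> as soon as \<open>free_res n\<close> holds for the ideal \<open>I\<close>.\<close>

primrec free_res :: "nat \<Rightarrow> (nat \<Rightarrow> 'a) set \<Rightarrow> bool" where
  "free_res 0 K \<longleftrightarrow> K = {0}"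
| "free_res (Suc n) K \<longleftrightarrow>
    (\<exists>m c. K = lincomb m c ` Fr m \<and> free_res n {f \<in> Fr m. lincomb m c f = 0})"

lemma submod_Fr: "submod (Fr m)"
  by (auto simp: submod_def Fr_def fun_ops zero_mem add_mem mult_mem)

lemma lincomb_add: "lincomb m c (f + g) = lincomb m c f + lincomb m c g"
  by (auto simp: lincomb_def fun_eq_iff fun_ops algebra_simps sum.distrib)

lemma lincomb_smult: "lincomb m c (\<lambda>j. a * f j) = (\<lambda>j. a * lincomb m c f j)"
  by (auto simp: lincomb_def fun_eq_iff fun_ops algebra_simps sum_distrib_left)

lemma lincomb_zero: "lincomb m c 0 = 0"
  by (auto simp: lincomb_def fun_eq_iff fun_ops)

lemma linear_map_lincomb: "linear_map K (lincomb m c)"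
  by (simp add: linear_map_def lincomb_add lincomb_smult)

lemma linear_map_0:
  assumes "linear_map K h" "submod K"
  shows "h 0 = 0"
proof -
  have "h (0 + 0) = h 0 + h 0" using assms by (simp only: linear_map_def submod_def)
  then show ?thesis by simp
qed

lemma lincomb_mem:
  assumes "submod K" "\<forall>i<m. c i \<in> K" "\<forall>i. f i \<in> A"
  shows "lincomb m c f \<in> K"
  using assms(2)
proof (induction m)
  case 0
  then show ?case using assms by (simp add: lincomb_def submod_def zero_fun_def)
next
  case (Suc m)
  have "lincomb (Suc m) c f = lincomb m c f + (\<lambda>j. f m * c m j)"
    by (auto simp: lincomb_def fun_eq_iff fun_ops)
  then show ?case using Suc assms by (auto simp: submod_def)
qed

lemma linear_map_lincomb_apply:
  assumes "linear_map K h" "submod K" "\<forall>i<m. c i \<in> K" "\<forall>i. f i \<in> A"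
  shows "h (lincomb m c f) = lincomb m (\<lambda>i. h (c i)) f"
  using assms(3)
proof (induction m)
  case 0
  then show ?case using linear_map_0[OF assms(1,2)] by (simp add: lincomb_def zero_fun_def)
next
  case (Suc m)
  have 1: "lincomb (Suc m) c f = lincomb m c f + (\<lambda>j. f m * c m j)" for c
    by (auto simp: lincomb_def fun_eq_iff fun_ops)
  have "h (lincomb (Suc m) c f) = h (lincomb m c f) + h (\<lambda>j. f m * c m j)"
    unfolding 1 using assms Suc.prems lincomb_mem[of K m c f]
    by (auto simp: linear_map_def submod_def)
  also have "h (\<lambda>j. f m * c m j) = (\<lambda>j. f m * h (c m) j)"
    using assms Suc.prems by (auto simp: linear_map_def)
  finally show ?case using Suc unfolding 1 by simp
qed

lemma lincomb_unit: "i < m \<Longrightarrow> lincomb m c (\<lambda>j. if j = i then 1 else 0) = c i"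
  by (auto simp: lincomb_def fun_eq_iff fun_ops if_distrib[of "\<lambda>x. x * _"] cong: if_cong)

lemma unit_Fr: "i < m \<Longrightarrow> (\<lambda>j. if j = i then 1 else 0) \<in> Fr m"
  by (auto simp: Fr_def zero_mem one_mem)

lemma generator_mem: "K = lincomb m c ` Fr m \<Longrightarrow> i < m \<Longrightarrow> c i \<in> K"
  using imageI[OF unit_Fr, of i m "lincomb m c"] by (simp add: lincomb_unit)

lemma submod_image:
  assumes "linear_map K h" "submod K"
  shows "submod (h ` K)"
  unfolding submod_def
proof (intro conjI ballI)
  show "0 \<in> h ` K" using linear_map_0[OF assms] assms(2) by (force simp: submod_def)
next
  fix x y assume "x \<in> h ` K" "y \<in> h ` K"
  then obtain a b where "a \<in> K" "b \<in> K" "x = h a" "y = h b" by blast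
  then have "x + y = h (a + b)" "a + b \<in> K" using assms by (auto simp: linear_map_def submod_def)
  then show "x + y \<in> h ` K" by blast
next
  fix a x assume "a \<in> A" "x \<in> h ` K"
  then obtain b where "b \<in> K" "x = h b" by blast
  then have "(\<lambda>j. a * x j) = h (\<lambda>j. a * b j)" "(\<lambda>j. a * b j) \<in> K"
    using assms \<open>a \<in> A\<close> by (auto simp: linear_map_def submod_def)
  then show "(\<lambda>j. a * x j) \<in> h ` K" by blast
qed

lemma submod_kernel: "submod {f \<in> Fr m. lincomb m c f = 0}"
  using submod_Fr[of m]
  by (auto simp: submod_def lincomb_add lincomb_smult lincomb_zero) (simp add: fun_eq_iff fun_ops)

lemma free_res_submod: "free_res n K \<Longrightarrow> submod K"
proof (cases n)
  case 0
  moreover assume "free_res n K"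
  ultimately show ?thesis by (auto simp: submod_def fun_eq_iff fun_ops)
next
  case (Suc k)
  moreover assume "free_res n K"
  ultimately show ?thesis using submod_image[OF linear_map_lincomb submod_Fr] by auto
qed

lemma free_res_Suc: "free_res n K \<Longrightarrow> free_res (Suc n) K"
proof (induction n arbitrary: K)
  case 0
  have "Fr 0 = {0}" by (auto simp: Fr_def fun_eq_iff fun_ops zero_mem)
  then have "K = lincomb 0 (\<lambda>_. 0) ` Fr 0" "free_res 0 {f \<in> Fr 0. lincomb 0 (\<lambda>_. 0) f = 0}"
    using 0 lincomb_zero[of 0 "\<lambda>_. 0"] by auto
  then show ?case unfolding free_res.simps by (intro exI conjI)
next
  case (Suc n)
  then obtain m c where "K = lincomb m c ` Fr m" "free_res n {f \<in> Fr m. lincomb m c f = 0}"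
    by auto
  then show ?case using Suc.IH free_res.simps(2) by blast
qed

lemma free_res_mono:
  assumes "n \<le> m" "free_res n K"
  shows "free_res m K"
  using assms by (induction rule: dec_induct) (auto intro: free_res_Suc simp del: free_res.simps)

text \<open>The horseshoe lemma. Lifts of the generators of \<open>KC\<close> are appended to the
  images of the generators of \<open>KA\<close>; the syzygies of the joint list are again an
  extension, to which the induction hypothesis applies.\<close>

lemma free_res_extension:
  assumes "free_res n KA" "free_res n KC" "submod KB"
    "linear_map KA \<alpha>" "linear_map KB \<beta>" "inj_on \<alpha> KA"
    "\<alpha> ` KA = {b \<in> KB. \<beta> b = 0}" "\<beta> ` KB = KC"
  shows "free_res n KB"
  using assms
proof (induction n arbitrary: KA KB KC \<alpha> \<beta>)
  case 0
  have KA: "KA = {0}" and KC: "KC = {0}" using "0.prems"(1,2) by auto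
  have "\<beta> b = 0" if "b \<in> KB" for b using "0.prems"(8) KC that by blast
  then have "KB = \<alpha> ` {0}" using "0.prems"(7) unfolding KA by blast
  then show ?case using linear_map_0[OF "0.prems"(4)] free_res_submod[OF "0.prems"(1)] by simp
next
  case (Suc n)
  from Suc.prems(1) obtain m c where c: "KA = lincomb m c ` Fr m"
    "free_res n {f \<in> Fr m. lincomb m c f = 0}" by auto
  from Suc.prems(2) obtain q d where d: "KC = lincomb q d ` Fr q"
    "free_res n {f \<in> Fr q. lincomb q d f = 0}" by auto
  have sA: "submod KA" using Suc.prems(1) free_res_submod by blast
  have cK: "\<forall>i<m. c i \<in> KA"
    by (simp add: generator_mem[OF c(1)])
  have "\<forall>i<q. d i \<in> KC"
    by (simp add: generator_mem[OF d(1)])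
  then have d': "d i \<in> \<beta> ` KB" if "i < q" for i using that Suc.prems(8) by simp
  define e where "e i = inv_into KB \<beta> (d i)" for i
  have e: "e i \<in> KB" "\<beta> (e i) = d i" if "i < q" for i
    unfolding e_def using d'[OF that] by (rule inv_into_into, rule f_inv_into_f)
  define sh where "sh f = (\<lambda>i. f (i + m))" for f :: "nat \<Rightarrow> 'a"
  define tr where "tr f = (\<lambda>i. if i < m then f i else 0)" for f :: "nat \<Rightarrow> 'a"
  define h where "h i = (if i < m then \<alpha> (c i) else e (i - m))" for i
  let ?\<psi> = "lincomb q e"
  have \<beta>\<psi>: "\<beta> (?\<psi> g) = lincomb q d g" if "g \<in> Fr q" for g
  proof -
    have "\<beta> (?\<psi> g) = lincomb q (\<lambda>i. \<beta> (e i)) g"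
      using that e by (intro linear_map_lincomb_apply[OF Suc.prems(5,3)]) (auto simp: Fr_def)
    also have "\<dots> = lincomb q d g" using e by (simp add: lincomb_def)
    finally show ?thesis .
  qed
  have \<psi>K: "?\<psi> g \<in> KB" if "g \<in> Fr q" for g
    using that e by (intro lincomb_mem[OF Suc.prems(3)]) (auto simp: Fr_def)
  have \<alpha>K: "\<alpha> a \<in> KB" "\<beta> (\<alpha> a) = 0" if "a \<in> KA" for a using that Suc.prems(7) by blast+
  have split: "lincomb (m + q) h f = \<alpha> (lincomb m c (tr f)) + ?\<psi> (sh f)" if "f \<in> Fr (m + q)" for f
  proof -
    have "\<alpha> (lincomb m c (tr f)) = lincomb m (\<lambda>i. \<alpha> (c i)) (tr f)"
      using that cK by (intro linear_map_lincomb_apply[OF Suc.prems(4) sA]) (auto simp: Fr_def tr_def zero_mem)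
    moreover have "(\<Sum>i<m + q. f i * h i j) = (\<Sum>i<m. f i * h i j) + (\<Sum>i<q. f (i + m) * h (i + m) j)" for j
    proof (induction q)
      case (Suc q)
      then show ?case by (simp add: algebra_simps)
    qed simp
    ultimately show ?thesis
      by (simp add: lincomb_def fun_eq_iff fun_ops tr_def sh_def h_def)
  qed
  have trF: "tr f \<in> Fr m" and shF: "sh f \<in> Fr q" if "f \<in> Fr (m + q)" for f
    using that by (auto simp: Fr_def tr_def sh_def zero_mem)
  have join: "\<exists>f\<in>Fr (m + q). tr f = g \<and> sh f = g'" if "g \<in> Fr m" "g' \<in> Fr q" for g g'
    using that by (intro bexI[of _ "\<lambda>i. if i < m then g i else g' (i - m)"])
      (auto simp: Fr_def tr_def sh_def fun_eq_iff fun_ops)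
  have \<beta>add: "\<beta> (x + y) = \<beta> x + \<beta> y" if "x \<in> KB" "y \<in> KB" for x y
    using Suc.prems(5) that by (auto simp: linear_map_def)
  have \<alpha>0: "\<alpha> 0 = 0" using linear_map_0[OF Suc.prems(4) sA] .
  have neg: "- x \<in> KB" "\<beta> (- x) = - \<beta> x" if "x \<in> KB" for x
  proof -
    have 1: "- x = (\<lambda>j. (-1) * x j)" for x :: "nat \<Rightarrow> 'a" by (simp add: fun_eq_iff fun_ops)
    have m1: "-1 \<in> A" using uminus_mem[OF one_mem] .
    show "- x \<in> KB" unfolding 1 using Suc.prems(3) that m1 unfolding submod_def by blast
    have "\<beta> (\<lambda>j. (-1) * x j) = (\<lambda>j. (-1) * \<beta> x j)"
      using Suc.prems(5) that m1 unfolding linear_map_def by blast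
    then show "\<beta> (- x) = - \<beta> x" unfolding 1 by (simp add: fun_eq_iff fun_ops)
  qed
  have im: "KB = lincomb (m + q) h ` Fr (m + q)"
  proof (intro equalityI subsetI)
    fix b assume b: "b \<in> KB"
    then have "\<beta> b \<in> KC" using Suc.prems(8) by blast
    then obtain g' where g': "g' \<in> Fr q" "\<beta> b = lincomb q d g'" using d(1) by blast
    have "b + - ?\<psi> g' \<in> KB" "\<beta> (b + - ?\<psi> g') = 0"
      using Suc.prems(3) b \<psi>K[OF g'(1)] neg \<beta>\<psi>[OF g'(1)] g'(2) \<beta>add
      by (auto simp: submod_def simp del: add_uminus_conv_diff)
    then have "b + - ?\<psi> g' \<in> \<alpha> ` KA" using Suc.prems(7) by blast
    then obtain g where g: "g \<in> Fr m" "b + - ?\<psi> g' = \<alpha> (lincomb m c g)" using c(1) by blast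
    from join[OF g(1) g'(1)] obtain f where "f \<in> Fr (m + q)" "tr f = g" "sh f = g'" by blast
    moreover from this have "lincomb (m + q) h f = b"
      using split g(2) by (metis add.commute add.assoc ab_left_minus add_0_right)
    ultimately show "b \<in> lincomb (m + q) h ` Fr (m + q)" by blast
  next
    fix b assume "b \<in> lincomb (m + q) h ` Fr (m + q)"
    then obtain f where "f \<in> Fr (m + q)" "b = \<alpha> (lincomb m c (tr f)) + ?\<psi> (sh f)"
      using split by blast
    then show "b \<in> KB" using Suc.prems(3) \<psi>K \<alpha>K(1) trF shF c(1) by (auto simp: submod_def)
  qed
  \<comment> \<open>The kernels form a short exact sequence with the inclusion and the shift
    \<open>sh\<close>. For surjectivity of \<open>sh\<close>, the lift of a syzygy of
    \<open>KC\<close> is corrected by an element of \<open>KA\<close>.\<close>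
  have "free_res n {f \<in> Fr (m + q). lincomb (m + q) h f = 0}"
  proof (rule Suc.IH[OF c(2) d(2) submod_kernel, where \<alpha> = "\<lambda>f. f" and \<beta> = sh])
    show "linear_map {f \<in> Fr m. lincomb m c f = 0} (\<lambda>f. f)" by (simp add: linear_map_def)
    show "linear_map {f \<in> Fr (m + q). lincomb (m + q) h f = 0} sh"
      by (simp add: linear_map_def sh_def fun_eq_iff fun_ops)
    show "inj_on (\<lambda>f. f) {f \<in> Fr m. lincomb m c f = 0}" by simp
    have "f \<in> Fr m \<and> lincomb m c f = 0 \<longleftrightarrow> f \<in> Fr (m + q) \<and> lincomb (m + q) h f = 0 \<and> sh f = 0" for f
    proof
      assume f: "f \<in> Fr m \<and> lincomb m c f = 0"
      then have F: "f \<in> Fr (m + q)" by (auto simp: Fr_def)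
      have "tr f = f" "sh f = 0" using f by (auto simp: tr_def sh_def Fr_def fun_eq_iff fun_ops)
      then show "f \<in> Fr (m + q) \<and> lincomb (m + q) h f = 0 \<and> sh f = 0"
        using F f split[OF F] by (simp add: \<alpha>0 lincomb_zero)
    next
      assume f: "f \<in> Fr (m + q) \<and> lincomb (m + q) h f = 0 \<and> sh f = 0"
      then have "sh f j = 0" for j by (simp add: fun_ops)
      then have "f i = 0" if "i \<ge> m" for i
        using that by (simp add: sh_def) (metis le_add_diff_inverse2)
      then have t: "tr f = f" by (auto simp: tr_def fun_eq_iff fun_ops)
      then have F: "f \<in> Fr m" using f trF by metis
      have "\<alpha> (lincomb m c f) = \<alpha> 0"
        using split[of f] f t by (simp add: \<alpha>0 lincomb_zero)
      then have "lincomb m c f = 0"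
        using Suc.prems(6) c(1) F sA by (auto simp: submod_def dest!: inj_onD)
      then show "f \<in> Fr m \<and> lincomb m c f = 0" using F by simp
    qed
    then show "(\<lambda>f. f) ` {f \<in> Fr m. lincomb m c f = 0} =
      {b \<in> {f \<in> Fr (m + q). lincomb (m + q) h f = 0}. sh b = 0}"
      unfolding image_ident by blast
    show "sh ` {f \<in> Fr (m + q). lincomb (m + q) h f = 0} = {f \<in> Fr q. lincomb q d f = 0}"
    proof (intro equalityI subsetI)
      fix g assume "g \<in> sh ` {f \<in> Fr (m + q). lincomb (m + q) h f = 0}"
      then obtain f where f: "f \<in> Fr (m + q)" "lincomb (m + q) h f = 0" "g = sh f" by blast
      have "\<beta> 0 = \<beta> (\<alpha> (lincomb m c (tr f))) + \<beta> (?\<psi> (sh f))"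
        using f split[OF f(1)] \<beta>add \<alpha>K(1) \<psi>K[OF shF[OF f(1)]] c(1) trF[OF f(1)] by (metis imageI)
      then have "lincomb q d g = 0"
        using \<beta>\<psi>[OF shF[OF f(1)]] \<alpha>K(2) c(1) trF[OF f(1)] f(3)
          linear_map_0[OF Suc.prems(5,3)] by auto
      then show "g \<in> {f \<in> Fr q. lincomb q d f = 0}" using f shF by blast
    next
      fix g assume g: "g \<in> {f \<in> Fr q. lincomb q d f = 0}"
      then have "- ?\<psi> g \<in> KB" "\<beta> (- ?\<psi> g) = 0" using \<psi>K neg \<beta>\<psi> by auto
      then have "- ?\<psi> g \<in> \<alpha> ` KA" using Suc.prems(7) by blast
      then obtain g' where g': "g' \<in> Fr m" "- ?\<psi> g = \<alpha> (lincomb m c g')" using c(1) by blast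
      from g join[OF g'(1), of g] obtain f where f: "f \<in> Fr (m + q)" "tr f = g'" "sh f = g" by blast
      then have "lincomb (m + q) h f = 0" using split[of f] by (simp flip: g'(2))
      then show "g \<in> sh ` {f \<in> Fr (m + q). lincomb (m + q) h f = 0}" using f by blast
    qed
  qed
  then show ?case using im unfolding free_res.simps by (intro exI conjI)
qed

text \<open>The mapping cone in terms of syzygies: generators of \<open>KB\<close> generate
  \<open>KC\<close> as well, and the enlarged syzygy module \<open>?L\<close> is an extension of
  \<open>KA\<close> by the syzygies of \<open>KB\<close>, via
  \<open>f \<mapsto> \<alpha>^{-1} (lincomb m c f)\<close>. This is why \<open>KA\<close> must have
  the shorter resolution.\<close>

lemma free_res_cokernel:
  assumes "free_res n KA" "free_res (Suc n) KB"
    "linear_map KA \<alpha>" "linear_map KB \<beta>" "inj_on \<alpha> KA"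
    "\<alpha> ` KA = {b \<in> KB. \<beta> b = 0}" "\<beta> ` KB = KC"
  shows "free_res (Suc n) KC"
proof -
  from assms(2) obtain m c where c: "KB = lincomb m c ` Fr m"
    "free_res n {f \<in> Fr m. lincomb m c f = 0}" by auto
  have sA: "submod KA" and sB: "submod KB" using assms(1,2) free_res_submod by blast+
  have cK: "\<forall>i<m. c i \<in> KB"
    by (simp add: generator_mem[OF c(1)])
  have \<beta>c: "lincomb m (\<lambda>i. \<beta> (c i)) f = \<beta> (lincomb m c f)" if "f \<in> Fr m" for f
    using linear_map_lincomb_apply[OF assms(4) sB cK] that by (simp add: Fr_def)
  let ?L = "{f \<in> Fr m. lincomb m (\<lambda>i. \<beta> (c i)) f = 0}"
  let ?inv = "inv_into KA \<alpha>"
  let ?p = "\<lambda>f. ?inv (lincomb m c f)"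
  have L: "lincomb m c f \<in> \<alpha> ` KA" if "f \<in> ?L" for f
    using that \<beta>c assms(6) c(1) by auto
  have inv: "?inv (\<alpha> a) = a" if "a \<in> KA" for a using assms(5) that by simp
  have "free_res n ?L"
  proof (rule free_res_extension[OF c(2) assms(1) submod_kernel, where \<alpha> = "\<lambda>f. f" and \<beta> = ?p])
    show "linear_map {f \<in> Fr m. lincomb m c f = 0} (\<lambda>f. f)" by (simp add: linear_map_def)
    show "linear_map ?L ?p" unfolding linear_map_def
    proof (intro conjI ballI)
      fix f g assume "f \<in> ?L" "g \<in> ?L"
      then obtain a b where ab: "a \<in> KA" "lincomb m c f = \<alpha> a" "b \<in> KA" "lincomb m c g = \<alpha> b" using L by blast
      then have "lincomb m c (f + g) = \<alpha> (a + b)" "a + b \<in> KA"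
        using assms(3) sA by (auto simp: lincomb_add linear_map_def submod_def)
      then show "?p (f + g) = ?p f + ?p g" using inv ab by simp
    next
      fix r f assume r: "r \<in> A" and "f \<in> ?L"
      then obtain a where ab: "a \<in> KA" "lincomb m c f = \<alpha> a" using L by blast
      then have "lincomb m c (\<lambda>j. r * f j) = \<alpha> (\<lambda>j. r * a j)" "(\<lambda>j. r * a j) \<in> KA"
        using assms(3) sA r by (auto simp: lincomb_smult linear_map_def submod_def)
      then show "?p (\<lambda>j. r * f j) = (\<lambda>j. r * ?p f j)" using inv ab by simp
    qed
    have "f \<in> Fr m \<and> lincomb m c f = 0 \<longleftrightarrow> f \<in> ?L \<and> ?p f = 0" for f
    proof
      assume f: "f \<in> Fr m \<and> lincomb m c f = 0"
      then have "\<beta> (lincomb m c f) = 0" using linear_map_0[OF assms(4) sB] by simp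
      moreover have "?inv 0 = 0" using inv[of 0] linear_map_0[OF assms(3) sA] sA by (simp add: submod_def)
      ultimately show "f \<in> ?L \<and> ?p f = 0" using f \<beta>c by simp
    next
      assume f: "f \<in> ?L \<and> ?p f = 0"
      then obtain a where "a \<in> KA" "lincomb m c f = \<alpha> a" using L by blast
      then show "f \<in> Fr m \<and> lincomb m c f = 0"
        using f inv linear_map_0[OF assms(3) sA] by auto
    qed
    then show "(\<lambda>f. f) ` {f \<in> Fr m. lincomb m c f = 0} = {b \<in> ?L. ?p b = 0}"
      unfolding image_ident by blast
    show "?p ` ?L = KA"
    proof (intro equalityI subsetI)
      fix a assume "a \<in> ?p ` ?L"
      then obtain f where f: "f \<in> ?L" "a = ?p f" by blast
      show "a \<in> KA" unfolding f(2) by (rule inv_into_into[OF L[OF f(1)]])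
    next
      fix a assume a: "a \<in> KA"
      then have "\<alpha> a \<in> KB" "\<beta> (\<alpha> a) = 0" using assms(6) by blast+
      then obtain f where "f \<in> Fr m" "\<alpha> a = lincomb m c f" using c(1) by blast
      then have "f \<in> ?L" "?p f = a" using \<beta>c \<open>\<beta> (\<alpha> a) = 0\<close> inv[OF a] by auto
      then show "a \<in> ?p ` ?L" by blast
    qed
  qed simp
  moreover have "KC = lincomb m (\<lambda>i. \<beta> (c i)) ` Fr m"
    using assms(7) c(1) \<beta>c by auto
  ultimately show ?thesis unfolding free_res.simps by (intro exI conjI)
qed

end

section \<open>Squarefree monomial ideals\<close>

lemma poly_mapping_sum_single: "(\<Sum>k\<in>keys p. single k (Poly_Mapping.lookup p k)) = p"
proof (rule poly_mapping_eqI)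
  fix m
  show "Poly_Mapping.lookup (\<Sum>k\<in>keys p. single k (Poly_Mapping.lookup p k)) m = Poly_Mapping.lookup p m"
    by (simp add: lookup_sum lookup_single when_def sum.delta if_distrib in_keys_iff cong: if_cong)
qed

definition restrict_keys :: "('a \<Rightarrow> bool) \<Rightarrow> ('a \<Rightarrow>\<^sub>0 'b::comm_monoid_add) \<Rightarrow> 'a \<Rightarrow>\<^sub>0 'b"
  where "restrict_keys P p = (\<Sum>k\<in>{k\<in>keys p. P k}. single k (Poly_Mapping.lookup p k))"

lemma lookup_restrict_keys: "Poly_Mapping.lookup (restrict_keys P p) m = (if P m then Poly_Mapping.lookup p m else 0)"
  by (simp add: restrict_keys_def lookup_sum lookup_single when_def sum.delta if_distrib in_keys_iff cong: if_cong)

lemma keys_restrict_keys: "keys (restrict_keys P p) = {k\<in>keys p. P k}"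
  by (auto simp: in_keys_iff lookup_restrict_keys split: if_splits)

lemma restrict_keys_add: "p = restrict_keys P p + restrict_keys (\<lambda>k. \<not> P k) p"
  by (rule poly_mapping_eqI) (simp add: lookup_add lookup_restrict_keys)

lemma lookup_single_times:
  fixes p :: "'a::cancel_comm_monoid_add \<Rightarrow>\<^sub>0 'b::comm_semiring_1"
  shows "Poly_Mapping.lookup (single a 1 * p) (a + m) = Poly_Mapping.lookup p m"
proof -
  have "single a 1 * p = (\<Sum>k\<in>keys p. single (a + k) (Poly_Mapping.lookup p k))"
    by (subst poly_mapping_sum_single[of p, symmetric]) (simp add: sum_distrib_left mult_single)
  then show ?thesis
    by (simp add: lookup_sum lookup_single when_def sum.delta if_distrib in_keys_iff cong: if_cong)
qed

lemma keys_add_nat: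
  fixes a b :: "'x \<Rightarrow>\<^sub>0 nat"
  shows "keys (a + b) = keys a \<union> keys b"
  by (auto simp: in_keys_iff lookup_add)

lemma keys_var_times:
  fixes p :: "('x, 'k::field) mpoly"
  shows "keys (var x * p) = (+) (single x 1) ` keys p"
proof -
  have "keys (var x * p) \<subseteq> (+) (single x 1) ` keys p"
    using keys_mult[of "var x" p] by (auto simp: var_def)
  moreover have "single x 1 + m \<in> keys (var x * p)" if "m \<in> keys p" for m
    using that by (simp add: in_keys_iff var_def lookup_single_times)
  ultimately show ?thesis by blast
qed

lemma var_times_eq_0:
  fixes p :: "('x, 'k::field) mpoly"
  shows "var x * p = 0 \<longleftrightarrow> p = 0"
  using keys_var_times[of x p] by (metis image_is_empty keys_eq_empty)

lemma var_times_cancel: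
  fixes p q :: "('x, 'k::field) mpoly"
  shows "var x * p = var x * q \<longleftrightarrow> p = q"
  using var_times_eq_0[of x "p - q"] by (simp add: algebra_simps)

lemma var_dvdE:
  fixes p :: "('x, 'k::field) mpoly"
  assumes "\<forall>m\<in>keys p. x \<in> keys m"
  obtains q where "p = var x * q"
proof
  have "single x 1 + (k - single x 1) = k" if "k \<in> keys p" for k
    using assms that
    by (intro poly_mapping_eqI) (auto simp: lookup_add lookup_minus lookup_single when_def in_keys_iff)
  then have "var x * (\<Sum>k\<in>keys p. single (k - single x 1) (Poly_Mapping.lookup p k)) =
    (\<Sum>k\<in>keys p. single k (Poly_Mapping.lookup p k))"
    by (simp add: sum_distrib_left mult_single var_def)
  then show "p = var x * (\<Sum>k\<in>keys p. single (k - single x 1) (Poly_Mapping.lookup p k))"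
    by (simp add: poly_mapping_sum_single)
qed

definition poly_carrier :: "'x set \<Rightarrow> ('x, 'k::field) mpoly set"
  where "poly_carrier X = {p. \<forall>m\<in>keys p. keys m \<subseteq> X}"

text \<open>The squarefree monomial ideals: \<open>U\<close> is an up-closed property of supports, and the ideal is
  spanned by the monomials whose support satisfies it.\<close>

definition mono_ideal :: "'x set \<Rightarrow> ('x set \<Rightarrow> bool) \<Rightarrow> ('x, 'k::field) mpoly set"
  where "mono_ideal X U = {p \<in> poly_carrier X. \<forall>m\<in>keys p. U (keys m)}"

lemma carrier_poly_ring: "carrier (poly_ring X) = poly_carrier X"
  by (simp add: poly_ring_def poly_carrier_def)

interpretation pr: subring_of_type "poly_carrier X :: ('x, 'k::field) mpoly set" for X
proof -
  let ?R = "poly_ring X :: ('x, 'k) mpoly ring"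
  interpret R: cring ?R by (rule cring_poly_ring)
  have sel: "add ?R = (+)" "mult ?R = (*)" "zero ?R = 0" "one ?R = 1"
    by (simp_all add: poly_ring_def)
  show "subring_of_type (poly_carrier X :: ('x, 'k) mpoly set)"
  proof
    show "- a \<in> poly_carrier X" if "a \<in> poly_carrier X" for a :: "('x, 'k) mpoly"
      using that by (simp add: poly_carrier_def)
  qed (use R.zero_closed R.one_closed R.a_closed R.m_closed in \<open>simp_all only: sel carrier_poly_ring\<close>)
qed

lemma mono_ideal_subset: "mono_ideal X U \<subseteq> poly_carrier X"
  by (auto simp: mono_ideal_def)

lemma mono_ideal_0: "0 \<in> mono_ideal X U"
  by (simp add: mono_ideal_def pr.zero_mem)

lemma mono_ideal_add: "p \<in> mono_ideal X U \<Longrightarrow> q \<in> mono_ideal X U \<Longrightarrow> p + q \<in> mono_ideal X U"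
  using Poly_Mapping.keys_add[of p q] by (auto simp: mono_ideal_def pr.add_mem)

lemma mono_ideal_uminus: "p \<in> mono_ideal X U \<Longrightarrow> - p \<in> mono_ideal X U"
  by (auto simp: mono_ideal_def pr.uminus_mem)

lemma mono_ideal_mult:
  assumes "mono U" "a \<in> poly_carrier X" "p \<in> mono_ideal X U"
  shows "a * p \<in> mono_ideal X U"
proof -
  have "U (keys m)" if m: "m \<in> keys (a * p)" for m
  proof -
    obtain u v where "m = u + v" "v \<in> keys p" using m keys_mult[of a p] by blast
    moreover from this have "U (keys v)" using assms(3) by (auto simp: mono_ideal_def)
    ultimately show ?thesis
      using assms(1) monoD[OF assms(1), of "keys v" "keys m"] by (auto simp: keys_add_nat)
  qed
  then show ?thesis using assms by (auto simp: mono_ideal_def pr.mult_mem)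
qed

lemma var_mem: "x \<in> X \<Longrightarrow> var x \<in> poly_carrier X"
  by (auto simp: var_def poly_carrier_def)

text \<open>On supports, the colon ideal by \<open>x\<close> is the property
  \<open>T \<mapsto> U (insert x T)\<close>.\<close>

lemma mono_ideal_var_times:
  assumes "x \<in> X"
  shows "var x * p \<in> mono_ideal X U \<longleftrightarrow> p \<in> mono_ideal X (\<lambda>T. U (insert x T))"
  using assms by (auto simp: mono_ideal_def keys_var_times keys_add_nat poly_carrier_def)

text \<open>A disjunction of properties is a sum of ideals: the terms of \<open>p\<close> are sorted
  by \<open>U\<close>. The second summand remembers the failure of \<open>U\<close>, although that
  property is no longer up-closed.\<close>

lemma mono_ideal_disj:
  assumes "p \<in> mono_ideal X (\<lambda>T. U T \<or> W T)"
  obtains q r where "p = q + r" "q \<in> mono_ideal X U" "r \<in> mono_ideal X (\<lambda>T. W T \<and> \<not> U T)"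
proof
  let ?P = "\<lambda>k. U (keys k)"
  show "p = restrict_keys ?P p + restrict_keys (\<lambda>k. \<not> ?P k) p" by (rule restrict_keys_add)
  show "restrict_keys ?P p \<in> mono_ideal X U"
    "restrict_keys (\<lambda>k. \<not> ?P k) p \<in> mono_ideal X (\<lambda>T. W T \<and> \<not> U T)"
    using assms by (auto simp: mono_ideal_def poly_carrier_def keys_restrict_keys)
qed

lemma mono_ideal_mono: "(\<And>T. U T \<Longrightarrow> W T) \<Longrightarrow> mono_ideal X U \<subseteq> mono_ideal X W"
  by (auto simp: mono_ideal_def)

text \<open>Ideals enter the calculus of \<open>free_res\<close> as submodules of the free module of
  rank one.\<close>

definition rank_one :: "'a::zero \<Rightarrow> nat \<Rightarrow> 'a"
  where "rank_one p = (\<lambda>i. if i = 0 then p else 0)"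

definition ideal_res :: "'k::field itself \<Rightarrow> 'x set \<Rightarrow> nat \<Rightarrow> ('x set \<Rightarrow> bool) \<Rightarrow> bool"
  where "ideal_res _ X n U \<longleftrightarrow>
    pr.free_res X n (rank_one ` (mono_ideal X U :: ('x, 'k) mpoly set))"

lemma rank_one_simps [simp]: "rank_one p 0 = p" "rank_one p = rank_one q \<longleftrightarrow> p = q"
  by (auto simp: rank_one_def dest: fun_cong[of _ _ 0])

lemma rank_one_eq_0: "rank_one p = 0 \<longleftrightarrow> p = 0"
  by (auto simp: rank_one_def fun_eq_iff fun_ops)

lemma ideal_res_mono: "n \<le> m \<Longrightarrow> ideal_res k X n U \<Longrightarrow> ideal_res k X m U"
  unfolding ideal_res_def by (rule pr.free_res_mono)

lemma ideal_res_False: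
  fixes X :: "'x set"
  shows "ideal_res TYPE('k::field) X n (\<lambda>T. False)"
proof -
  have "(mono_ideal X (\<lambda>T. False) :: ('x, 'k) mpoly set) = {0}"
    by (auto simp: mono_ideal_def pr.zero_mem keys_eq_empty[symmetric] simp del: keys_eq_empty)
  moreover have "rank_one 0 = (0 :: nat \<Rightarrow> ('x, 'k) mpoly)" by (simp add: rank_one_eq_0)
  ultimately have "ideal_res TYPE('k) X 0 (\<lambda>T. False)" by (simp add: ideal_res_def)
  then show ?thesis by (rule ideal_res_mono[rotated]) simp
qed

text \<open>The unit ideal is free of rank one, hence needs one module; the bound
  \<open>Suc n\<close> fits the role of \<open>C\<close> in a splitting that merely adjoins a
  variable.\<close>

lemma ideal_res_True:
  fixes X :: "'x set"
  shows "ideal_res TYPE('k::field) X (Suc n) (\<lambda>T. True)"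
proof -
  have 1: "pr.lincomb 1 (\<lambda>_. rank_one 1) f = f" if "f \<in> pr.Fr X 1" for f :: "nat \<Rightarrow> ('x, 'k) mpoly"
    using that by (auto simp: pr.lincomb_def pr.Fr_def rank_one_def fun_eq_iff)
  have 2: "rank_one ` (mono_ideal X (\<lambda>T. True) :: ('x, 'k) mpoly set) = pr.Fr X 1"
  proof (intro equalityI subsetI)
    fix f :: "nat \<Rightarrow> ('x, 'k) mpoly" assume "f \<in> pr.Fr X 1"
    then have "f = rank_one (f 0)" "f 0 \<in> mono_ideal X (\<lambda>T. True)"
      by (auto simp: pr.Fr_def rank_one_def fun_eq_iff mono_ideal_def)
    then show "f \<in> rank_one ` mono_ideal X (\<lambda>T. True)" by blast
  qed (auto simp: pr.Fr_def rank_one_def mono_ideal_def pr.zero_mem)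
  have "pr.Fr X 1 = pr.lincomb 1 (\<lambda>_. rank_one 1) ` (pr.Fr X 1 :: (nat \<Rightarrow> ('x, 'k) mpoly) set)"
    using 1 by (simp add: image_cong)
  moreover have "{f \<in> pr.Fr X 1. pr.lincomb 1 (\<lambda>_. rank_one 1) f = 0} = {0 :: nat \<Rightarrow> ('x, 'k) mpoly}"
    using 1 pr.submod_Fr[of X 1] by (auto simp: pr.submod_def)
  ultimately have "pr.free_res X (Suc 0) (pr.Fr X 1 :: (nat \<Rightarrow> ('x, 'k) mpoly) set)"
    unfolding pr.free_res.simps by (intro exI conjI)
  then have "ideal_res TYPE('k) X (Suc 0) (\<lambda>T. True)" using 2 by (simp add: ideal_res_def)
  then show ?thesis by (rule ideal_res_mono[rotated]) simp
qed

text \<open>Betti splitting along the variable \<open>v\<close>: the ideal is \<open>D + v C\<close> with \<open>D\<close> contained in \<open>C\<close>, so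
  that it is the cokernel of \<open>f \<mapsto> (v f, - f)\<close> from \<open>D\<close> to the direct sum of \<open>D\<close> and \<open>C\<close>.\<close>

lemma ideal_res_split:
  fixes X :: "'x set"
  assumes v: "v \<in> X" and mono: "mono D" "mono C"
    and indep: "\<And>T. D (insert v T) \<Longrightarrow> D T" "\<And>T. C (insert v T) \<Longrightarrow> C T"
    and le: "\<And>T. D T \<Longrightarrow> C T"
    and U: "\<And>T. U T \<longleftrightarrow> D T \<or> v \<in> T \<and> C T"
    and res: "ideal_res TYPE('k::field) X n D" "ideal_res TYPE('k) X (Suc n) C"
  shows "ideal_res TYPE('k) X (Suc n) U"
proof -
  let ?D = "mono_ideal X D :: ('x, 'k) mpoly set"
  let ?C = "mono_ideal X C :: ('x, 'k) mpoly set"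
  let ?U = "mono_ideal X U :: ('x, 'k) mpoly set"
  \<comment> \<open>The direct sum of \<open>D\<close> and \<open>C\<close>, with \<open>D\<close>
    in coordinate 0 and \<open>C\<close> in coordinate 1.\<close>
  define B where "B = {f :: nat \<Rightarrow> ('x, 'k) mpoly. f 0 \<in> ?D \<and> f 1 \<in> ?C \<and> (\<forall>i\<ge>2. f i = 0)}"
  have B: "pr.submod X B"
    using mono by (auto simp: pr.submod_def B_def fun_ops mono_ideal_0 mono_ideal_add mono_ideal_mult)
  have "pr.free_res X (Suc n) B"
  proof (rule pr.free_res_extension[where KA = "rank_one ` ?D" and KC = "rank_one ` ?C"
        and \<alpha> = "\<lambda>f. f" and \<beta> = "\<lambda>f. rank_one (f 1)"])
    show "pr.free_res X (Suc n) (rank_one ` ?D)" "pr.free_res X (Suc n) (rank_one ` ?C)"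
      using res unfolding ideal_res_def by (auto intro: pr.free_res_Suc simp del: pr.free_res.simps)
    show "pr.linear_map X (rank_one ` ?D) (\<lambda>f. f)" by (simp add: pr.linear_map_def)
    show "pr.linear_map X B (\<lambda>f. rank_one (f 1))"
      by (auto simp: pr.linear_map_def rank_one_def fun_eq_iff fun_ops)
    show "(\<lambda>f. f) ` rank_one ` ?D = {b \<in> B. rank_one (b 1) = 0}"
    proof (intro equalityI subsetI)
      fix f assume f: "f \<in> {b \<in> B. rank_one (b 1) = 0}"
      then have "f i = 0" if "i \<noteq> 0" for i
        using that by (cases "i = 1") (auto simp: B_def rank_one_eq_0)
      then have "f = rank_one (f 0)" by (auto simp: rank_one_def fun_eq_iff)
      then show "f \<in> (\<lambda>f. f) ` rank_one ` ?D" using f by (auto simp: B_def)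
    qed (auto simp: B_def rank_one_def mono_ideal_0 fun_eq_iff fun_ops)
    show "(\<lambda>f. rank_one (f 1)) ` B = rank_one ` ?C"
    proof (intro equalityI subsetI)
      fix f assume "f \<in> rank_one ` ?C"
      then obtain p where p: "p \<in> ?C" "f = rank_one p" by blast
      then have "(\<lambda>i. if i = 1 then p else 0) \<in> B" by (auto simp: B_def mono_ideal_0)
      then show "f \<in> (\<lambda>f. rank_one (f 1)) ` B" using p by (intro image_eqI) simp_all
    qed (auto simp: B_def)
  qed (simp_all add: B)
  have "pr.free_res X (Suc n) (rank_one ` ?U)"
  proof (rule pr.free_res_cokernel[where KA = "rank_one ` ?D" and KB = B
        and \<alpha> = "\<lambda>f i. if i = 0 then var v * f 0 else if i = 1 then - f 0 else 0"
        and \<beta> = "\<lambda>f. rank_one (f 0 + var v * f 1)"])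
    let ?\<alpha> = "\<lambda>f i :: nat. if i = 0 then var v * f 0 else if i = 1 then - f 0 else (0 :: ('x, 'k) mpoly)"
    let ?\<beta> = "\<lambda>f. rank_one (f 0 + var v * (f 1 :: ('x, 'k) mpoly)) :: nat \<Rightarrow> ('x, 'k) mpoly"
    show "pr.free_res X n (rank_one ` ?D)" using res unfolding ideal_res_def by simp
    show "pr.free_res X (Suc n) B" by fact
    show "pr.linear_map X (rank_one ` ?D) ?\<alpha>"
      by (auto simp: pr.linear_map_def fun_eq_iff fun_ops algebra_simps)
    show "pr.linear_map X B ?\<beta>"
      by (auto simp: pr.linear_map_def rank_one_def fun_eq_iff fun_ops algebra_simps)
    show "inj_on ?\<alpha> (rank_one ` ?D)"
      by (rule inj_onI) (auto simp: var_times_cancel dest: fun_cong[of _ _ 0])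
    show "?\<alpha> ` rank_one ` ?D = {b \<in> B. ?\<beta> b = 0}"
    proof (intro equalityI subsetI)
      fix f assume "f \<in> ?\<alpha> ` rank_one ` ?D"
      then obtain p where "p \<in> ?D" "f = ?\<alpha> (rank_one p)" by blast
      then show "f \<in> {b \<in> B. ?\<beta> b = 0}"
        using mono_ideal_mult[OF mono(1) var_mem[OF v]] mono_ideal_mono[of D C X, OF le]
        by (auto simp: B_def rank_one_eq_0 mono_ideal_uminus)
    next
      \<comment> \<open>A relation \<open>f 0 + v f 1 = 0\<close> puts \<open>v (- f 1)\<close> into
        \<open>D\<close>; as \<open>D\<close> does not involve \<open>v\<close>, already
        \<open>- f 1\<close> lies in \<open>D\<close>.\<close>
      fix f assume f: "f \<in> {b \<in> B. ?\<beta> b = 0}"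
      then have eq: "f 0 = var v * (- f 1)" by (simp add: rank_one_eq_0 eq_neg_iff_add_eq_0)
      then have "- f 1 \<in> mono_ideal X (\<lambda>T. D (insert v T))"
        using f mono_ideal_var_times[OF v, of "- f 1" D] by (simp add: B_def)
      then have "- f 1 \<in> ?D" using mono_ideal_mono[of "\<lambda>T. D (insert v T)" D X] indep(1) by blast
      moreover have "f = ?\<alpha> (rank_one (- f 1))"
      proof
        fix i show "f i = ?\<alpha> (rank_one (- f 1)) i"
          using f eq by (cases "i = 0"; cases "i = 1") (auto simp: B_def)
      qed
      ultimately show "f \<in> ?\<alpha> ` rank_one ` ?D" by blast
    qed
    show "?\<beta> ` B = rank_one ` ?U"
    proof (intro equalityI subsetI)
      fix g assume "g \<in> ?\<beta> ` B"
      then obtain f where f: "f \<in> B" "g = ?\<beta> f" by blast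
      have "f 0 \<in> ?U" using f(1) mono_ideal_mono[of D U X] U by (auto simp: B_def)
      moreover have "var v * f 1 \<in> ?U"
      proof -
        have "C (insert v T)" if "C T" for T
          using monoD[OF mono(2), of T "insert v T"] that by auto
        then have "f 1 \<in> mono_ideal X (\<lambda>T. U (insert v T))"
          using f(1) U by (auto simp: B_def mono_ideal_def)
        then show ?thesis by (simp add: mono_ideal_var_times[OF v])
      qed
      ultimately show "g \<in> rank_one ` ?U" using f(2) mono_ideal_add by blast
    next
      fix g assume "g \<in> rank_one ` ?U"
      then obtain p where p: "p \<in> ?U" "g = rank_one p" by blast
      from p(1) have "p \<in> mono_ideal X (\<lambda>T. D T \<or> v \<in> T \<and> C T)" by (auto simp: mono_ideal_def U)
      \<comment> \<open>Every term of \<open>r\<close> lies outside \<open>D\<close>, so it is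
        divisible by \<open>v\<close>; cancelling \<open>v\<close> leaves an element of
        \<open>C\<close> because \<open>C\<close> does not involve \<open>v\<close>.\<close>
      then obtain q r where qr: "p = q + r" "q \<in> ?D"
        "r \<in> mono_ideal X (\<lambda>T. (v \<in> T \<and> C T) \<and> \<not> D T)" by (rule mono_ideal_disj)
      from qr(3) have "\<forall>m\<in>keys r. v \<in> keys m" by (auto simp: mono_ideal_def)
      then obtain s where s: "r = var v * s" by (rule var_dvdE)
      have "s \<in> mono_ideal X (\<lambda>T. (v \<in> insert v T \<and> C (insert v T)) \<and> \<not> D (insert v T))"
        using qr(3) mono_ideal_var_times[OF v, of s "\<lambda>T. (v \<in> T \<and> C T) \<and> \<not> D T"] s by simp
      then have "s \<in> ?C" using indep(2) by (auto simp: mono_ideal_def)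
      then have "(\<lambda>i. if i = 0 then q else if i = 1 then s else 0) \<in> B" using qr(2) by (auto simp: B_def)
      then show "g \<in> ?\<beta> ` B" using p(2) qr(1) s by force
    qed
  qed
  then show ?thesis by (simp add: ideal_res_def)
qed

section \<open>Koszul cohomology of modules\<close>

text \<open>The Koszul complex as an iterated mapping cone, which avoids signs indexed by subsets: a cochain of
  \<open>x # xs\<close> is a pair \<open>(a, b)\<close>, selected by the first bit, with differential \<open>(d a, x a - d b)\<close>. The
  number of \<open>True\<close> bits is the cohomological degree.\<close>

fun kos :: "('a, 'c) ring_scheme \<Rightarrow> ('a, 'm, 'd) module_scheme \<Rightarrow> 'a list \<Rightarrow>
    (bool list \<Rightarrow> 'm) \<Rightarrow> bool list \<Rightarrow> 'm" where
  "kos R M (x # xs) c (False # t) = kos R M xs (\<lambda>s. c (False # s)) t"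
| "kos R M (x # xs) c (True # t) = (x \<odot>\<^bsub>M\<^esub> c (False # t)) \<oplus>\<^bsub>M\<^esub>
    ((\<ominus>\<^bsub>R\<^esub> \<one>\<^bsub>R\<^esub>) \<odot>\<^bsub>M\<^esub> kos R M xs (\<lambda>s. c (True # s)) t)"
| "kos R M _ c _ = \<zero>\<^bsub>M\<^esub>"

text \<open>Degrees are integers so that degree -1 exists and contains only the zero cochain:
  exactness in degree 0 then says that a cocycle is zero.\<close>

definition cochain :: "('m, 'd) ring_scheme \<Rightarrow> nat \<Rightarrow> int \<Rightarrow> (bool list \<Rightarrow> 'm) \<Rightarrow> bool"
  where "cochain M n i c \<longleftrightarrow> (\<forall>t. c t \<in> carrier M) \<and>
    (\<forall>t. c t \<noteq> \<zero>\<^bsub>M\<^esub> \<longrightarrow> length t = n \<and> int (count_list t True) = i)"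

definition kos_exact :: "('a, 'c) ring_scheme \<Rightarrow> ('a, 'm, 'd) module_scheme \<Rightarrow> 'a list \<Rightarrow> int \<Rightarrow> bool"
  where "kos_exact R M xs i \<longleftrightarrow> (\<forall>c. cochain M (length xs) i c \<and> (\<forall>t. kos R M xs c t = \<zero>\<^bsub>M\<^esub>) \<longrightarrow>
    (\<exists>e. cochain M (length xs) (i - 1) e \<and> (\<forall>t. kos R M xs e t = c t)))"

text \<open>Submodules are represented by replacing the carrier; the differential sees only the
  operations.\<close>

lemma kos_carrier_update [simp]: "kos R (M\<lparr>carrier := K\<rparr>) xs c t = kos R M xs c t"
  by (induction R M xs c t rule: kos.induct) auto

context Module.module
begin

lemma kos_closed:
  assumes "\<And>t. c t \<in> carrier M" "set xs \<subseteq> carrier R"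
  shows "kos R M xs c t \<in> carrier M"
  using assms
proof (induction xs arbitrary: c t)
  case (Cons x xs)
  have "kos R M xs (\<lambda>s. c (b # s)) s \<in> carrier M" for b s using Cons by simp
  then show ?case using Cons.prems by (cases t; cases "hd t") auto
qed simp

lemma kos_zero:
  assumes "set xs \<subseteq> carrier R"
  shows "kos R M xs (\<lambda>t. \<zero>\<^bsub>M\<^esub>) t = \<zero>\<^bsub>M\<^esub>"
  using assms
proof (induction xs arbitrary: t)
  case (Cons x xs)
  then show ?case by (cases t; cases "hd t") auto
qed simp

lemma kos_add:
  assumes "\<And>t. c t \<in> carrier M" "\<And>t. e t \<in> carrier M" "set xs \<subseteq> carrier R"
  shows "kos R M xs (\<lambda>t. c t \<oplus>\<^bsub>M\<^esub> e t) t = kos R M xs c t \<oplus>\<^bsub>M\<^esub> kos R M xs e t"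
  using assms
proof (induction xs arbitrary: c e t)
  case (Cons x xs)
  show ?case
  proof (cases t)
    case (Cons b s)
    have "kos R M xs (\<lambda>s. c (b # s)) s \<in> carrier M" "kos R M xs (\<lambda>s. e (b # s)) s \<in> carrier M"
      using Cons.prems by (auto intro!: kos_closed)
    then show ?thesis
      using Cons.prems Cons.IH[of "\<lambda>s. c (b # s)" "\<lambda>s. e (b # s)" s] Cons
      by (cases b) (auto simp: smult_r_distr M.a_ac)
  qed simp
qed simp

lemma kos_smult:
  assumes "\<And>t. c t \<in> carrier M" "a \<in> carrier R" "set xs \<subseteq> carrier R"
  shows "kos R M xs (\<lambda>t. a \<odot>\<^bsub>M\<^esub> c t) t = a \<odot>\<^bsub>M\<^esub> kos R M xs c t"
  using assms
proof (induction xs arbitrary: c t)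
  case (Cons x xs)
  have comm: "u \<odot>\<^bsub>M\<^esub> (v \<odot>\<^bsub>M\<^esub> m) = v \<odot>\<^bsub>M\<^esub> (u \<odot>\<^bsub>M\<^esub> m)"
    if "u \<in> carrier R" "v \<in> carrier R" "m \<in> carrier M" for u v m
    using that by (metis smult_assoc1 R.m_comm)
  show ?case
  proof (cases t)
    case (Cons b s)
    have "kos R M xs (\<lambda>s. c (b # s)) s \<in> carrier M"
      using Cons.prems by (auto intro!: kos_closed)
    then show ?thesis
      using Cons.prems Cons.IH[of "\<lambda>s. c (b # s)" s] Cons comm[of a x] comm[of a "\<ominus>\<^bsub>R\<^esub> \<one>\<^bsub>R\<^esub>"]
      by (cases b) (auto simp: smult_r_distr)
  qed (use Cons.prems in simp)
qed (use assms in simp)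

lemma add_neg_smult: "m \<in> carrier M \<Longrightarrow> m \<oplus>\<^bsub>M\<^esub> ((\<ominus>\<^bsub>R\<^esub> \<one>\<^bsub>R\<^esub>) \<odot>\<^bsub>M\<^esub> m) = \<zero>\<^bsub>M\<^esub>"
  by (simp add: smult_l_minus M.r_neg)

lemma kos_kos:
  assumes "\<And>t. c t \<in> carrier M" "set xs \<subseteq> carrier R"
  shows "kos R M xs (kos R M xs c) t = \<zero>\<^bsub>M\<^esub>"
  using assms
proof (induction xs arbitrary: c t)
  case (Cons x xs)
  let ?m1 = "\<ominus>\<^bsub>R\<^esub> \<one>\<^bsub>R\<^esub>"
  show ?case
  proof (cases t)
    case (Cons b s)
    have cl: "kos R M xs (\<lambda>s. c (b # s)) u \<in> carrier M" for b u
      using Cons.prems by (auto intro!: kos_closed)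
    have z: "kos R M xs (kos R M xs (\<lambda>s. c (b # s))) u = \<zero>\<^bsub>M\<^esub>" for b u
      using Cons.prems Cons.IH[of "\<lambda>s. c (b # s)"] by simp
    show ?thesis
    proof (cases b)
      case True
      let ?a = "\<lambda>u. c (False # u)" and ?b = "kos R M xs (\<lambda>s. c (True # s))"
      have "kos R M xs (\<lambda>u. (x \<odot>\<^bsub>M\<^esub> ?a u) \<oplus>\<^bsub>M\<^esub> (?m1 \<odot>\<^bsub>M\<^esub> ?b u)) s =
        kos R M xs (\<lambda>u. x \<odot>\<^bsub>M\<^esub> ?a u) s \<oplus>\<^bsub>M\<^esub> kos R M xs (\<lambda>u. ?m1 \<odot>\<^bsub>M\<^esub> ?b u) s"
        using Cons.prems cl by (intro kos_add) auto
      also have "kos R M xs (\<lambda>u. x \<odot>\<^bsub>M\<^esub> ?a u) s = x \<odot>\<^bsub>M\<^esub> kos R M xs ?a s"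
        using Cons.prems by (intro kos_smult) auto
      also have "kos R M xs (\<lambda>u. ?m1 \<odot>\<^bsub>M\<^esub> ?b u) s = ?m1 \<odot>\<^bsub>M\<^esub> kos R M xs ?b s"
        using Cons.prems cl by (intro kos_smult) auto
      finally have "kos R M xs (\<lambda>u. (x \<odot>\<^bsub>M\<^esub> ?a u) \<oplus>\<^bsub>M\<^esub> (?m1 \<odot>\<^bsub>M\<^esub> ?b u)) s = x \<odot>\<^bsub>M\<^esub> kos R M xs ?a s"
        using z Cons.prems cl by simp
      then show ?thesis using Cons True Cons.prems cl by (simp add: add_neg_smult)
    qed (use z Cons in simp)
  qed simp
qed simp

lemma kos_degree:
  assumes "cochain M (length xs) i c" "set xs \<subseteq> carrier R"
  shows "cochain M (length xs) (i + 1) (kos R M xs c)"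
proof -
  have c: "c t \<in> carrier M" for t using assms by (simp add: cochain_def)
  have "length t = length xs \<and> int (count_list t True) = i + 1" if "kos R M xs c t \<noteq> \<zero>\<^bsub>M\<^esub>" for t
    using assms that
  proof (induction xs arbitrary: c t i)
    case (Cons x xs)
    show ?case
    proof (cases t)
      case (Cons b s)
      have 1: "cochain M (length xs) i (\<lambda>s. c (False # s))" "cochain M (length xs) (i - 1) (\<lambda>s. c (True # s))"
        using Cons.prems(1) by (auto simp: cochain_def)
      show ?thesis
      proof (cases b)
        case True
        then have "c (False # s) \<noteq> \<zero>\<^bsub>M\<^esub> \<or> kos R M xs (\<lambda>s. c (True # s)) s \<noteq> \<zero>\<^bsub>M\<^esub>"
          using Cons.prems Cons by auto
        then show ?thesis
          using Cons.prems(1,2) Cons.IH[OF 1(2), of s] Cons True by (auto simp: cochain_def)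
      qed (use Cons.prems Cons.IH[OF 1(1), of s] Cons in auto)
    qed (use Cons.prems in simp)
  qed simp
  then show ?thesis using kos_closed[OF c assms(2)] by (simp add: cochain_def)
qed

end

lemma kos_hom:
  assumes "h \<in> mod_hom R M N" "Module.module R M" "h \<zero>\<^bsub>M\<^esub> = \<zero>\<^bsub>N\<^esub>"
    "\<And>t. c t \<in> carrier M" "set xs \<subseteq> carrier R"
  shows "kos R N xs (\<lambda>t. h (c t)) t = h (kos R M xs c t)"
  using assms(4,5)
proof (induction xs arbitrary: c t)
  case (Cons x xs)
  interpret Module.module R M by fact
  show ?case
  proof (cases t)
    case (Cons b s)
    have "kos R M xs (\<lambda>s. c (b # s)) s \<in> carrier M"
      using Cons.prems by (auto intro!: kos_closed)
    then show ?thesis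
      using Cons.prems Cons.IH[of "\<lambda>s. c (b # s)" s] Cons assms(1)
      by (cases b) (auto simp: mod_hom_def)
  qed (simp add: assms)
qed (simp add: assms)

lemma cochain_hom:
  assumes "h \<in> mod_hom R M N" "h \<zero>\<^bsub>M\<^esub> = \<zero>\<^bsub>N\<^esub>" "cochain M n i c"
  shows "cochain N n i (\<lambda>t. h (c t))"
proof -
  have "h x \<in> carrier N" if "x \<in> carrier M" for x using assms(1) that by (auto simp: mod_hom_def)
  moreover have "c t \<noteq> \<zero>\<^bsub>M\<^esub>" if "h (c t) \<noteq> \<zero>\<^bsub>N\<^esub>" for t using assms(2) that by auto
  ultimately show ?thesis using assms(3) unfolding cochain_def by blast
qed

text \<open>The dimension shift along \<open>0 \<rightarrow> ker f \<rightarrow> P \<rightarrow> M \<rightarrow> 0\<close>.\<close>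

lemma kos_exact_quotient:
  assumes P: "Module.module R P" and xs: "set xs \<subseteq> carrier R"
    and f: "f \<in> mod_hom R P M" "f \<zero>\<^bsub>P\<^esub> = \<zero>\<^bsub>M\<^esub>" "f ` carrier P = carrier M"
    and ex: "kos_exact R P xs i" "kos_exact R (P\<lparr>carrier := {x \<in> carrier P. f x = \<zero>\<^bsub>M\<^esub>}\<rparr>) xs (i + 1)"
    and M: "\<And>m. m \<in> carrier M \<Longrightarrow> m \<oplus>\<^bsub>M\<^esub> ((\<ominus>\<^bsub>R\<^esub> \<one>\<^bsub>R\<^esub>) \<odot>\<^bsub>M\<^esub> \<zero>\<^bsub>M\<^esub>) = m"
  shows "kos_exact R M xs i"
  unfolding kos_exact_def
proof (intro allI impI, elim conjE)
  interpret Module.module R P by fact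
  let ?K = "P\<lparr>carrier := {x \<in> carrier P. f x = \<zero>\<^bsub>M\<^esub>}\<rparr>" and ?m1 = "\<ominus>\<^bsub>R\<^esub> \<one>\<^bsub>R\<^esub>"
  fix c assume c: "cochain M (length xs) i c" and kc: "\<forall>t. kos R M xs c t = \<zero>\<^bsub>M\<^esub>"
  \<comment> \<open>The lift must send zero to zero, since otherwise it would not vanish outside
    degree \<open>i\<close>.\<close>
  define c' where "c' t = (if c t = \<zero>\<^bsub>M\<^esub> then \<zero>\<^bsub>P\<^esub> else inv_into (carrier P) f (c t))" for t
  have c_im: "c t \<in> f ` carrier P" for t using c f(3) by (simp add: cochain_def)
  have fc': "f (c' t) = c t" "c' t \<in> carrier P" for t
    using c_im[of t] f(2) by (auto simp: c'_def f_inv_into_f inv_into_into)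
  have c': "cochain P (length xs) i c'" using c fc' by (auto simp: cochain_def c'_def)
  let ?k = "kos R P xs c'"
  have fk: "f (?k t) = \<zero>\<^bsub>M\<^esub>" for t
    using kos_hom[where c = c' and t = t, OF f(1) P f(2) fc'(2) xs] fc'(1) kc by simp
  have kP: "?k t \<in> carrier P" for t using kos_closed[OF fc'(2) xs] .
  have "cochain ?K (length xs) (i + 1) ?k"
    using kos_degree[OF c' xs] fk by (simp add: cochain_def)
  then obtain e where e: "cochain ?K (length xs) i e" "\<And>t. kos R P xs e t = ?k t"
    using ex(2) kos_kos[OF fc'(2) xs] unfolding kos_exact_def by auto
  have eP: "e t \<in> carrier P" "f (e t) = \<zero>\<^bsub>M\<^esub>" for t using e(1) by (auto simp: cochain_def)
  \<comment> \<open>The differential of the lift is a cocycle of the kernel, thus the differential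
    of some \<open>e\<close> there. Subtracting \<open>e\<close> makes the lift a cocycle without
    changing its image under \<open>f\<close>.\<close>
  let ?c = "\<lambda>t. c' t \<oplus>\<^bsub>P\<^esub> (?m1 \<odot>\<^bsub>P\<^esub> e t)"
  have "c' t \<noteq> \<zero>\<^bsub>P\<^esub> \<or> e t \<noteq> \<zero>\<^bsub>P\<^esub>" if "?c t \<noteq> \<zero>\<^bsub>P\<^esub>" for t
    using that by auto
  then have "cochain P (length xs) i ?c"
    using c' e(1) eP(1) unfolding cochain_def by auto blast+
  moreover have "kos R P xs ?c t = \<zero>\<^bsub>P\<^esub>" for t
  proof -
    have "kos R P xs ?c t = ?k t \<oplus>\<^bsub>P\<^esub> kos R P xs (\<lambda>t. ?m1 \<odot>\<^bsub>P\<^esub> e t) t"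
      using fc'(2) eP xs by (intro kos_add) auto
    also have "kos R P xs (\<lambda>t. ?m1 \<odot>\<^bsub>P\<^esub> e t) t = ?m1 \<odot>\<^bsub>P\<^esub> ?k t"
      using eP xs e(2) by (subst kos_smult) auto
    finally show ?thesis using add_neg_smult[OF kP] by simp
  qed
  ultimately obtain g where g: "cochain P (length xs) (i - 1) g" "\<And>t. kos R P xs g t = ?c t"
    using ex(1) unfolding kos_exact_def by blast
  have gP: "g t \<in> carrier P" for t using g(1) by (simp add: cochain_def)
  have "kos R M xs (\<lambda>t. f (g t)) t = c t" for t
  proof -
    have "kos R M xs (\<lambda>t. f (g t)) t = f (?c t)"
      using kos_hom[OF f(1) P f(2) gP xs, where t = t] g(2) by simp
    also have "\<dots> = f (c' t) \<oplus>\<^bsub>M\<^esub> (?m1 \<odot>\<^bsub>M\<^esub> f (e t))"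
      using f(1) fc'(2)[of t] eP(1)[of t] by (simp add: mod_hom_def)
    finally show ?thesis using M[of "c t"] c by (simp add: fc' eP cochain_def)
  qed
  moreover have "cochain M (length xs) (i - 1) (\<lambda>t. f (g t))"
    by (rule cochain_hom[OF f(1,2) g(1)])
  ultimately show "\<exists>e. cochain M (length xs) (i - 1) e \<and> (\<forall>t. kos R M xs e t = c t)" by blast
qed

lemma mod_hom_zero:
  assumes "h \<in> mod_hom R M N" "Module.module R M" "Module.module R N"
  shows "h \<zero>\<^bsub>M\<^esub> = \<zero>\<^bsub>N\<^esub>"
proof -
  interpret M: Module.module R M by fact
  interpret N: Module.module R N by fact
  have "h (\<zero>\<^bsub>R\<^esub> \<odot>\<^bsub>M\<^esub> \<zero>\<^bsub>M\<^esub>) = \<zero>\<^bsub>R\<^esub> \<odot>\<^bsub>N\<^esub> h \<zero>\<^bsub>M\<^esub>" "h \<zero>\<^bsub>M\<^esub> \<in> carrier N"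
    using assms(1) by (auto simp: mod_hom_def simp del: M.smult_l_null N.smult_l_null M.smult_r_null N.smult_r_null)
  then show ?thesis by (simp add: M.smult_l_null N.smult_l_null)
qed

text \<open>Downward induction over the syzygies \<open>K j\<close>, starting at
  \<open>K n = 0\<close>. Each short exact sequence trades one syzygy for one degree, and the terms
  of the resolution contribute nothing below degree \<open>length xs\<close>.\<close>

lemma kos_exact_resolution:
  assumes M: "Module.module R M" and xs: "set xs \<subseteq> carrier R"
    and res: "projective_resolution R M P e d" and n: "\<forall>j>n. carrier (P j) = {\<zero>\<^bsub>P j\<^esub>}"
    and ex: "\<And>j i. i < int (length xs) \<Longrightarrow> kos_exact R (P j) xs i"
    and i: "i + int n < int (length xs)"
  shows "kos_exact R M xs i"
proof -
  have P: "Module.module R (P j)" for j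
    using res by (simp add: projective_resolution_def projective_module_def)
  have e: "e \<in> mod_hom R (P 0) M" "e ` carrier (P 0) = carrier M"
    and d: "\<And>j. d j \<in> mod_hom R (P (Suc j)) (P j)"
    and d0: "d 0 ` carrier (P 1) = {x \<in> carrier (P 0). e x = \<zero>\<^bsub>M\<^esub>}"
    and dS: "\<And>j. d (Suc j) ` carrier (P (Suc (Suc j))) = {x \<in> carrier (P (Suc j)). d j x = \<zero>\<^bsub>P j\<^esub>}"
    using res by (auto simp: projective_resolution_def)
  define K where "K j = d j ` carrier (P (Suc j))" for j
  have dz: "d j \<zero>\<^bsub>P (Suc j)\<^esub> = \<zero>\<^bsub>P j\<^esub>" for j using mod_hom_zero[OF d P P] .
  have neutral: "m \<oplus>\<^bsub>N\<^esub> ((\<ominus>\<^bsub>R\<^esub> \<one>\<^bsub>R\<^esub>) \<odot>\<^bsub>N\<^esub> \<zero>\<^bsub>N\<^esub>) = m"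
    if "Module.module R N" "m \<in> carrier N" for N :: "('a, 'n, 'q) module_scheme" and m
  proof -
    interpret Module.module R N by fact
    show ?thesis using that by simp
  qed
  \<comment> \<open>\<open>K j\<close> sits in \<open>P j\<close> and has a resolution of length
    \<open>n - j - 1\<close>, whence the bound.\<close>
  have K: "kos_exact R ((P j)\<lparr>carrier := K j\<rparr>) xs i"
    if "j \<le> n" "i + int n < int (length xs) + int j + 1" for i j
    using that
  proof (induction "n - j" arbitrary: j i)
    case 0
    then have "j = n" by simp
    interpret Module.module R "P n" by (rule P)
    have "K n = {\<zero>\<^bsub>P n\<^esub>}" using n dz[of n] by (simp add: K_def)
    then show ?case
      unfolding kos_exact_def \<open>j = n\<close>
      using kos_zero[OF xs] by (auto simp: cochain_def intro!: exI[of _ "\<lambda>t. \<zero>\<^bsub>P n\<^esub>"])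
  next
    case (Suc m)
    have KK: "{x \<in> carrier (P (Suc j)). d j x = \<zero>\<^bsub>P j\<^esub>} = K (Suc j)" using dS by (simp add: K_def)
    have sub: "K j \<subseteq> carrier (P j)" using d[of j] by (auto simp: mod_hom_def K_def)
    show ?case
    proof (rule kos_exact_quotient[OF P[of "Suc j"] xs, of "d j"])
      show "d j \<in> mod_hom R (P (Suc j)) ((P j)\<lparr>carrier := K j\<rparr>)"
        using d[of j] by (auto simp: mod_hom_def K_def)
      show "kos_exact R (P (Suc j)) xs i" using Suc by (intro ex) auto
      have "kos_exact R ((P (Suc j))\<lparr>carrier := K (Suc j)\<rparr>) xs (i + 1)"
        using Suc by (intro Suc.hyps(1)) auto
      then show "kos_exact R ((P (Suc j))\<lparr>carrier := {x \<in> carrier (P (Suc j)).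
        d j x = \<zero>\<^bsub>(P j)\<lparr>carrier := K j\<rparr>\<^esub>}\<rparr>) xs (i + 1)"
        by (simp add: KK)
      show "m \<oplus>\<^bsub>(P j)\<lparr>carrier := K j\<rparr>\<^esub> ((\<ominus>\<^bsub>R\<^esub> \<one>\<^bsub>R\<^esub>) \<odot>\<^bsub>(P j)\<lparr>carrier := K j\<rparr>\<^esub>
        \<zero>\<^bsub>(P j)\<lparr>carrier := K j\<rparr>\<^esub>) = m" if "m \<in> carrier ((P j)\<lparr>carrier := K j\<rparr>)" for m
        using neutral[OF P[of j], of m] that sub by auto
    qed (simp_all add: dz K_def)
  qed
  have "kos_exact R ((P 0)\<lparr>carrier := {x \<in> carrier (P 0). e x = \<zero>\<^bsub>M\<^esub>}\<rparr>) xs (i + 1)"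
    using K[of 0 "i + 1"] i d0 by (simp add: K_def)
  then show ?thesis
    using i e mod_hom_zero[OF e(1) P M] neutral[OF M] ex[of i 0]
    by (intro kos_exact_quotient[OF P[of 0] xs, of e]) auto
qed

text \<open>Passes from free to projective modules: a cocycle is pushed along \<open>s\<close>, and
  its primitive is pulled back along \<open>p\<close>.\<close>

lemma kos_exact_retract:
  assumes "Module.module R P" "Module.module R N" "set xs \<subseteq> carrier R"
    and s: "s \<in> mod_hom R P N" and p: "p \<in> mod_hom R N P" and ps: "\<forall>x\<in>carrier P. p (s x) = x"
    and ex: "kos_exact R N xs i"
  shows "kos_exact R P xs i"
  unfolding kos_exact_def
proof (intro allI impI, elim conjE)
  note s0 = mod_hom_zero[OF s assms(1,2)] and p0 = mod_hom_zero[OF p assms(2,1)]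
  fix c assume c: "cochain P (length xs) i c" and kc: "\<forall>t. kos R P xs c t = \<zero>\<^bsub>P\<^esub>"
  have cP: "c t \<in> carrier P" for t using c by (simp add: cochain_def)
  have "cochain N (length xs) i (\<lambda>t. s (c t))" by (rule cochain_hom[OF s s0 c])
  moreover have "kos R N xs (\<lambda>t. s (c t)) t = \<zero>\<^bsub>N\<^esub>" for t
    using kos_hom[OF s assms(1) s0 cP assms(3)] kc s0 by simp
  ultimately obtain e where e: "cochain N (length xs) (i - 1) e" "\<And>t. kos R N xs e t = s (c t)"
    using ex unfolding kos_exact_def by blast
  have eN: "e t \<in> carrier N" for t using e by (simp add: cochain_def)
  have "cochain P (length xs) (i - 1) (\<lambda>t. p (e t))" by (rule cochain_hom[OF p p0 e(1)])
  moreover have "kos R P xs (\<lambda>t. p (e t)) t = c t" for t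
    using kos_hom[OF p assms(2) p0 eN assms(3)] e(2) ps cP by simp
  ultimately show "\<exists>e. cochain P (length xs) (i - 1) e \<and> (\<forall>t. kos R P xs e t = c t)" by blast
qed

section \<open>Koszul cohomology of the polynomial ring\<close>

text \<open>The same complex over the ring itself in type class operations;
  \<open>kos_free_module\<close> identifies it with each coordinate of \<open>kos\<close> on a free
  module.\<close>

fun tkos :: "'a::comm_ring_1 list \<Rightarrow> (bool list \<Rightarrow> 'a) \<Rightarrow> bool list \<Rightarrow> 'a" where
  "tkos (x # xs) c (False # t) = tkos xs (\<lambda>s. c (False # s)) t"
| "tkos (x # xs) c (True # t) = x * c (False # t) - tkos xs (\<lambda>s. c (True # s)) t"
| "tkos _ c _ = 0"

definition tdeg :: "nat \<Rightarrow> int \<Rightarrow> (bool list \<Rightarrow> 'a::zero) \<Rightarrow> bool"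
  where "tdeg n i c \<longleftrightarrow> (\<forall>t. c t \<noteq> 0 \<longrightarrow> length t = n \<and> int (count_list t True) = i)"

lemma tkos_add: "tkos xs (\<lambda>t. c t + e t) t = tkos xs c t + tkos xs e t"
proof (induction xs arbitrary: c e t)
  case (Cons x xs)
  then show ?case by (cases t; cases "hd t") (auto simp: algebra_simps)
qed simp

lemma tkos_mult: "tkos xs (\<lambda>t. a * c t) t = a * tkos xs c t"
proof (induction xs arbitrary: c t)
  case (Cons x xs)
  then show ?case by (cases t; cases "hd t") (auto simp: algebra_simps)
qed simp

lemma tkos_diff: "tkos xs (\<lambda>t. c t - e t) t = tkos xs c t - tkos xs e t"
  using tkos_add[of xs c "\<lambda>t. (-1) * e t" t] tkos_mult[of xs "-1" e t] by simp

lemma tkos_zero: "tkos xs (\<lambda>t. 0) t = 0"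
  using tkos_diff[of xs "\<lambda>t. 0" "\<lambda>t. 0" t] by simp

lemma tkos_tkos: "tkos xs (tkos xs c) t = 0"
proof (induction xs arbitrary: c t)
  case (Cons x xs)
  have "(\<lambda>s. tkos (x # xs) c (False # s)) = tkos xs (\<lambda>s. c (False # s))" by (simp add: fun_eq_iff)
  then show ?case
    by (cases t; cases "hd t") (auto simp: tkos_diff tkos_mult Cons)
qed simp

lemma tkos_mem:
  assumes "\<And>t. c t \<in> I" "0 \<in> I" "\<And>p q. p \<in> I \<Longrightarrow> q \<in> I \<Longrightarrow> p - q \<in> I" "\<And>x p. x \<in> set xs \<Longrightarrow> p \<in> I \<Longrightarrow> x * p \<in> I"
  shows "tkos xs c t \<in> I"
  using assms(1,4)
proof (induction xs arbitrary: c t)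
  case (Cons x xs)
  have "tkos xs (\<lambda>s. c (b # s)) s \<in> I" for b s using Cons by simp
  then show ?case using Cons.prems assms by (cases t; cases "hd t") auto
qed (simp add: assms)

lemma tdeg_Cons:
  assumes "tdeg (Suc n) i c"
  shows "tdeg n i (\<lambda>t. c (False # t))" "tdeg n (i - 1) (\<lambda>t. c (True # t))"
  using assms by (fastforce simp: tdeg_def)+

lemma tkos_tdeg:
  assumes "tdeg (length xs) i c"
  shows "tdeg (length xs) (i + 1) (tkos xs c)"
proof -
  have "length t = length xs \<and> int (count_list t True) = i + 1" if "tkos xs c t \<noteq> 0" for t
    using assms that
  proof (induction xs arbitrary: c t i)
    case (Cons x xs)
    show ?case
    proof (cases t)
      case (Cons b s)
      have 1: "tdeg (length xs) i (\<lambda>s. c (False # s))" "tdeg (length xs) (i - 1) (\<lambda>s. c (True # s))"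
        using Cons.prems(1) tdeg_Cons[of "length xs" i c] by auto
      show ?thesis
      proof (cases b)
        case True
        then have "c (False # s) \<noteq> 0 \<or> tkos xs (\<lambda>s. c (True # s)) s \<noteq> 0"
          using Cons.prems Cons by auto
        then show ?thesis
          using Cons.prems(1) Cons.IH[OF 1(2), of s] Cons True by (fastforce simp: tdeg_def)
      qed (use Cons.prems Cons.IH[OF 1(1), of s] Cons in auto)
    qed (use Cons.prems in simp)
  qed simp
  then show ?thesis by (simp add: tdeg_def)
qed

text \<open>\<open>tkos_exact X zs i I\<close>: in degree \<open>i\<close>, the Koszul cohomology of \<open>R / I\<close> with respect to the variables
  \<open>zs\<close> vanishes, expressed through representatives in \<open>R\<close>.\<close>

definition tkos_exact :: "'x set \<Rightarrow> 'x list \<Rightarrow> int \<Rightarrow> ('x, 'k::field) mpoly set \<Rightarrow> bool"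
  where "tkos_exact X zs i I \<longleftrightarrow> (\<forall>c. (\<forall>t. c t \<in> poly_carrier X) \<and> tdeg (length zs) i c \<and>
      (\<forall>t. tkos (map var zs) c t \<in> I) \<longrightarrow>
    (\<exists>e. (\<forall>t. e t \<in> poly_carrier X) \<and> tdeg (length zs) (i - 1) e \<and> (\<forall>t. c t - tkos (map var zs) e t \<in> I)))"

lemma poly_carrier_diff: "p \<in> poly_carrier X \<Longrightarrow> q \<in> poly_carrier X \<Longrightarrow> p - q \<in> poly_carrier X"
  using pr.add_mem[of p X "- q"] pr.uminus_mem[of q X] by simp

lemma mono_ideal_diff: "p \<in> mono_ideal X U \<Longrightarrow> q \<in> mono_ideal X U \<Longrightarrow> p - q \<in> mono_ideal X U"
  using mono_ideal_add[of p X U "- q"] mono_ideal_uminus[of q X U] by simp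

lemma tkos_carrier:
  assumes "\<And>t. c t \<in> poly_carrier X" "set zs \<subseteq> X"
  shows "tkos (map var zs) c t \<in> poly_carrier X"
  using assms by (intro tkos_mem) (auto intro: pr.zero_mem poly_carrier_diff pr.mult_mem var_mem)

text \<open>Together with \<open>tkos_exact_top\<close> this identifies the top cohomology with the
  quotient of the ring by the variables \<open>zs\<close>.\<close>

lemma tkos_top:
  assumes "\<And>t. c t \<in> poly_carrier X" "set zs \<subseteq> X"
  shows "tkos (map var zs) c t \<in> mono_ideal X (\<lambda>T. set zs \<inter> T \<noteq> {})"
  using assms
proof (induction zs arbitrary: c t)
  case (Cons z zs)
  have IH: "tkos (map var zs) (\<lambda>s. c (b # s)) s \<in> mono_ideal X (\<lambda>T. set (z # zs) \<inter> T \<noteq> {})" for b s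
    using Cons.IH[of "\<lambda>s. c (b # s)" s] Cons.prems
      mono_ideal_mono[of "\<lambda>T. set zs \<inter> T \<noteq> {}" "\<lambda>T. set (z # zs) \<inter> T \<noteq> {}" X] by auto
  have "var z * c s \<in> mono_ideal X (\<lambda>T. set (z # zs) \<inter> T \<noteq> {})" for s
    using Cons.prems by (subst mono_ideal_var_times) (auto simp: mono_ideal_def)
  then show ?case using IH
    by (cases t; cases "hd t") (auto simp del: Int_insert_left simp: mono_ideal_0 intro!: mono_ideal_diff)
qed (simp add: mono_ideal_0)

lemma count_list_True_le: "count_list t True \<le> length t"
  by (induction t) auto

lemma count_list_True_eq: "count_list t True = length t \<longleftrightarrow> t = replicate (length t) True"
proof (induction t)
  case (Cons b t)
  then show ?case using count_list_True_le[of t] by (cases b) auto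
qed simp

lemma count_list_replicate_True [simp]: "count_list (replicate n True) True = n"
  by (induction n) auto

lemma tdeg_big: "tdeg n i c \<Longrightarrow> int n < i \<Longrightarrow> c t = 0"
  using count_list_True_le[of t] by (force simp: tdeg_def)

lemma tdeg_top: "tdeg n (int n) c \<Longrightarrow> t \<noteq> replicate n True \<Longrightarrow> c t = 0"
  using count_list_True_eq[of t] by (auto simp: tdeg_def)

text \<open>A top cochain has a single coefficient. Its terms divisible by \<open>z\<close> but by
  none of \<open>zs\<close> are produced by the \<open>False\<close> half, the others by recursion
  in the \<open>True\<close> half.\<close>

lemma tkos_exact_top:
  fixes c :: "bool list \<Rightarrow> ('x, 'k::field) mpoly"
  assumes "\<And>t. c t \<in> poly_carrier X" "set zs \<subseteq> X" "tdeg (length zs) (int (length zs)) c"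
    "c (replicate (length zs) True) \<in> mono_ideal X (\<lambda>T. set zs \<inter> T \<noteq> {})"
  shows "\<exists>e. (\<forall>t. e t \<in> poly_carrier X) \<and> tdeg (length zs) (int (length zs) - 1) e \<and>
    (\<forall>t. tkos (map var zs) e t = c t)"
  using assms
proof (induction zs arbitrary: c)
  case Nil
  then have "c [] = 0" by (auto simp: mono_ideal_def keys_eq_empty[symmetric] simp del: keys_eq_empty)
  then have "c t = 0" for t using tdeg_top[of 0 c t] Nil by (cases t) auto
  then show ?case by (intro exI[of _ "\<lambda>t. 0"]) (simp add: tdeg_def pr.zero_mem)
next
  case (Cons z zs)
  let ?n = "length zs"
  let ?top = "replicate ?n True"
  have "c (True # ?top) \<in> mono_ideal X (\<lambda>T. set zs \<inter> T \<noteq> {} \<or> z \<in> T)"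
    using Cons.prems(4) mono_ideal_mono[of "\<lambda>T. set (z # zs) \<inter> T \<noteq> {}" "\<lambda>T. set zs \<inter> T \<noteq> {} \<or> z \<in> T" X]
    by auto
  then obtain q r where qr: "c (True # ?top) = q + r" "q \<in> mono_ideal X (\<lambda>T. set zs \<inter> T \<noteq> {})"
    "r \<in> mono_ideal X (\<lambda>T. z \<in> T \<and> \<not> set zs \<inter> T \<noteq> {})" by (rule mono_ideal_disj)
  obtain a where a: "r = var z * a" using qr(3) by (elim var_dvdE[rotated]) (auto simp: mono_ideal_def)
  have "r \<in> mono_ideal X (\<lambda>T. True)" using qr(3) by (auto simp: mono_ideal_def)
  then have aX: "a \<in> poly_carrier X"
    using mono_ideal_var_times[of z X a "\<lambda>T. True"] a Cons.prems(2) by (simp add: mono_ideal_def)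
  \<comment> \<open>The sign cancels the minus with which the differential acts on the
    \<open>True\<close> half.\<close>
  define c2 where "c2 t = (if t = ?top then - q else 0)" for t
  have "\<exists>e. (\<forall>t. e t \<in> poly_carrier X) \<and> tdeg ?n (int ?n - 1) e \<and> (\<forall>t. tkos (map var zs) e t = c2 t)"
    using qr(2) Cons.prems(2)
    by (intro Cons.IH) (auto simp: c2_def tdeg_def count_list_True_eq mono_ideal_uminus pr.zero_mem
        dest: subsetD[OF mono_ideal_subset] intro: pr.uminus_mem)
  then obtain e2 where e2: "\<And>t. e2 t \<in> poly_carrier X" "tdeg ?n (int ?n - 1) e2"
    "\<And>t. tkos (map var zs) e2 t = c2 t" by blast
  define e where "e t = (case t of [] \<Rightarrow> 0 | True # s \<Rightarrow> e2 s | False # s \<Rightarrow> if s = ?top then a else 0)" for t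
  have e_simps: "e (True # s) = e2 s" "e (False # s) = (if s = ?top then a else 0)" "e [] = 0" for s
    by (simp_all add: e_def)
  have "tdeg ?n (int ?n) (\<lambda>s. e (False # s))"
    by (auto simp: tdeg_def e_simps count_list_True_eq)
  then have z: "tkos (map var zs) (\<lambda>s. e (False # s)) t = 0" for t
    using tkos_tdeg[of "map var zs" "int ?n" "\<lambda>s. e (False # s)"] by (intro tdeg_big[of ?n "int ?n + 1"]) auto
  have "tkos (map var (z # zs)) e t = c t" for t
  proof (cases t)
    case Nil
    then show ?thesis using tdeg_top[OF Cons.prems(3), of t] by simp
  next
    case (Cons b s)
    show ?thesis
    proof (cases b)
      case True
      then show ?thesis
        using Cons tdeg_top[OF Cons.prems(3), of t] qr(1) a e2(3) by (auto simp: e_simps c2_def)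
    next
      case False
      then show ?thesis using Cons z tdeg_top[OF Cons.prems(3), of t] by simp
    qed
  qed
  moreover have "e t \<in> poly_carrier X" for t
    using e2(1) aX pr.zero_mem by (cases t; cases "hd t") (auto simp: e_simps)
  moreover have "length t = Suc ?n \<and> int (count_list t True) = int ?n" if "e t \<noteq> 0" for t
    using that e2(2) by (cases t; cases "hd t") (auto simp: e_simps tdeg_def count_list_True_eq split: if_splits)
  ultimately show ?case by (intro exI[of _ e]) (simp add: tdeg_def)
qed

text \<open>The variables form a regular sequence. A cocycle is a pair \<open>(a, b)\<close> with
  \<open>d a = 0\<close> and \<open>d b = z a\<close>. Below the top, \<open>a\<close> is a boundary
  by induction; in the top degree, \<open>z a\<close> lies in the ideal of \<open>zs\<close>, hence
  so does \<open>a\<close>.\<close>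

lemma tkos_exact_ring:
  fixes X :: "'x set"
  assumes "set zs \<subseteq> X" "distinct zs" "i < int (length zs)"
  shows "tkos_exact X zs i {0 :: ('x, 'k::field) mpoly}"
  using assms
proof (induction zs arbitrary: i)
  case Nil
  have "c t = 0" if "tdeg 0 i c" for c :: "bool list \<Rightarrow> ('x, 'k) mpoly" and t
    using that Nil(3) by (auto simp: tdeg_def)
  moreover have "tdeg n j (\<lambda>t. 0)" for n j by (simp add: tdeg_def)
  ultimately show ?case unfolding tkos_exact_def
    by (intro allI impI exI[of _ "\<lambda>t. 0"]) (simp add: pr.zero_mem)
next
  case (Cons z zs)
  let ?n = "length zs"
  show ?case unfolding tkos_exact_def
  proof (intro allI impI, elim conjE)
    fix c :: "bool list \<Rightarrow> ('x, 'k) mpoly"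
    assume cX: "\<forall>t. c t \<in> poly_carrier X" and c: "tdeg (length (z # zs)) i c"
      and kc: "\<forall>t. tkos (map var (z # zs)) c t \<in> {0}"
    define a where "a = (\<lambda>t. c (False # t))"
    define b where "b = (\<lambda>t. c (True # t))"
    have deg: "tdeg ?n i a" "tdeg ?n (i - 1) b" using tdeg_Cons[of ?n i c] c by (simp_all add: a_def b_def)
    have X: "a t \<in> poly_carrier X" "b t \<in> poly_carrier X" for t using cX by (simp_all add: a_def b_def)
    have ka: "tkos (map var zs) a t = 0" for t using kc[rule_format, of "False # t"] by (simp add: a_def)
    have kb: "tkos (map var zs) b t = var z * a t" for t using kc[rule_format, of "True # t"] by (simp add: a_def b_def)
    have "\<exists>e. (\<forall>t. e t \<in> poly_carrier X) \<and> tdeg ?n (i - 1) e \<and> (\<forall>t. tkos (map var zs) e t = a t)"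
    proof (cases "i < int ?n")
      case True
      then have "tkos_exact X zs i {0 :: ('x, 'k) mpoly}" using Cons by simp
      then obtain e where "\<forall>t. e t \<in> poly_carrier X" "tdeg ?n (i - 1) e" "\<forall>t. a t - tkos (map var zs) e t \<in> {0}"
        unfolding tkos_exact_def using X deg(1) ka by blast
      then show ?thesis by (intro exI[of _ e]) simp
    next
      case False
      then have i: "i = int ?n" using Cons.prems by simp
      have "var z * a (replicate ?n True) \<in> mono_ideal X (\<lambda>T. set zs \<inter> T \<noteq> {})"
        using tkos_top[of b X zs "replicate ?n True"] X Cons.prems kb by auto
      \<comment> \<open>Cancelling \<open>z\<close> modulo the ideal of \<open>zs\<close> works
        since \<open>z\<close> is not one of the \<open>zs\<close>.\<close>
      then have "a (replicate ?n True) \<in> mono_ideal X (\<lambda>T. set zs \<inter> insert z T \<noteq> {})"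
        using Cons.prems(1) by (subst (asm) mono_ideal_var_times) auto
      then show ?thesis
        using tkos_exact_top[of a X zs] X Cons.prems deg(1) i by (auto simp: mono_ideal_def)
    qed
    then obtain e1 where e1: "\<And>t. e1 t \<in> poly_carrier X" "tdeg ?n (i - 1) e1"
      "\<And>t. tkos (map var zs) e1 t = a t" by blast
    \<comment> \<open>The defect in the second component after using \<open>e1\<close> for the
      first. It is a cocycle in degree \<open>i - 1\<close>, below the top, so its primitive
      \<open>g\<close> completes the pair \<open>(e1, g)\<close>.\<close>
    define b' where "b' t = var z * e1 t - b t" for t
    have "tkos (map var zs) b' t = 0" for t
      unfolding b'_def by (simp add: tkos_diff tkos_mult e1 kb)
    moreover have b'X: "b' t \<in> poly_carrier X" for t
      using X e1(1) Cons.prems(1) by (auto simp: b'_def intro!: poly_carrier_diff pr.mult_mem var_mem)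
    moreover have "e1 t \<noteq> 0 \<or> b t \<noteq> 0" if "b' t \<noteq> 0" for t using that by (auto simp: b'_def)
    then have "tdeg ?n (i - 1) b'" using e1(2) deg(2) unfolding tdeg_def by blast
    ultimately have "\<exists>g. (\<forall>t. g t \<in> poly_carrier X) \<and> tdeg ?n (i - 1 - 1) g \<and> (\<forall>t. b' t - tkos (map var zs) g t \<in> {0})"
      using Cons.IH[of "i - 1"] Cons.prems unfolding tkos_exact_def by simp
    then obtain g where g: "\<And>t. g t \<in> poly_carrier X" "tdeg ?n (i - 1 - 1) g"
      "\<And>t. tkos (map var zs) g t = b' t" by (metis eq_iff_diff_eq_0 singletonD)
    define e where "e t = (case t of [] \<Rightarrow> 0 | True # s \<Rightarrow> g s | False # s \<Rightarrow> e1 s)" for t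
    have e_simps: "e (True # s) = g s" "e (False # s) = e1 s" "e [] = 0" for s by (simp_all add: e_def)
    have "c t - tkos (map var (z # zs)) e t = 0" for t
    proof (cases t)
      case Nil
      then show ?thesis using c by (auto simp: tdeg_def)
    next
      case (Cons d s)
      then show ?thesis by (cases d) (auto simp: e_simps e1 g a_def b_def b'_def)
    qed
    moreover have "e t \<in> poly_carrier X" for t
      using e1(1) g(1) pr.zero_mem by (cases t; cases "hd t") (auto simp: e_simps)
    moreover have "length t = Suc ?n \<and> int (count_list t True) = i - 1" if "e t \<noteq> 0" for t
      using that e1(2) g(2) by (cases t; cases "hd t") (fastforce simp: e_simps tdeg_def)+
    ultimately show "\<exists>e. (\<forall>t. e t \<in> poly_carrier X) \<and> tdeg (length (z # zs)) (i - 1) e \<and>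
        (\<forall>t. c t - tkos (map var (z # zs)) e t \<in> {0})"
      unfolding tdeg_def by (intro exI[of _ e]) simp
  qed
qed

section \<open>Projective dimension of a squarefree monomial quotient\<close>

lemma poly_ring_simps:
  "carrier (poly_ring X) = poly_carrier X" "mult (poly_ring X) = (*)" "add (poly_ring X) = (+)"
  "zero (poly_ring X) = 0" "one (poly_ring X) = 1"
  by (simp_all add: poly_ring_def poly_carrier_def)

lemma poly_ring_minus_one: "\<ominus>\<^bsub>poly_ring X\<^esub> \<one>\<^bsub>poly_ring X\<^esub> = (- 1 :: ('x, 'k::field) mpoly)"
proof -
  let ?R = "poly_ring X :: ('x, 'k) mpoly ring"
  interpret cring ?R by (rule cring_poly_ring)
  have "- 1 \<oplus>\<^bsub>?R\<^esub> \<one>\<^bsub>?R\<^esub> = \<zero>\<^bsub>?R\<^esub>" "- 1 \<in> carrier ?R" "\<one>\<^bsub>?R\<^esub> \<in> carrier ?R"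
    by (simp_all add: poly_ring_simps pr.uminus_mem pr.one_mem)
  then show ?thesis using minus_equality by blast
qed

lemma free_module_simps:
  "carrier (free_module (poly_ring X) B) = {f. (\<forall>i\<in>B. f i \<in> poly_carrier X) \<and> (\<forall>i. i \<notin> B \<longrightarrow> f i = 0) \<and> finite {i. f i \<noteq> 0}}"
  "zero (free_module (poly_ring X) B) = (\<lambda>i. 0)"
  "add (free_module (poly_ring X) B) = (\<lambda>f g i. f i + g i)"
  "smult (free_module (poly_ring X) B) = (\<lambda>a f i. a * f i)"
  by (simp_all add: free_module_def poly_ring_simps)

lemma module_free_module:
  fixes X :: "'x set"
  shows "Module.module (poly_ring X) (free_module (poly_ring X :: ('x, 'k::field) mpoly ring) B)"
proof (rule Module.moduleI)
  let ?R = "poly_ring X :: ('x, 'k) mpoly ring"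
  let ?F = "free_module ?R B"
  show "cring ?R" by (rule cring_poly_ring)
  have fin_add: "finite {i. f i + g i \<noteq> 0}" if "finite {i. f i \<noteq> 0}" "finite {i. g i \<noteq> 0}"
    for f g :: "'b \<Rightarrow> ('x, 'k) mpoly"
    by (rule finite_subset[OF _ finite_UnI[OF that]]) auto
  have fin_mult: "finite {i. a * f i \<noteq> 0}" if "finite {i. f i \<noteq> 0}"
    for f :: "'b \<Rightarrow> ('x, 'k) mpoly" and a
    by (rule finite_subset[OF _ that]) auto
  show "abelian_group ?F"
  proof (rule abelian_groupI)
    fix f assume f: "f \<in> carrier ?F"
    have "(\<lambda>i. - 1 * f i) \<in> carrier ?F"
      using f fin_mult[of f "-1"] by (auto simp: free_module_simps pr.uminus_mem)
    then show "\<exists>g\<in>carrier ?F. g \<oplus>\<^bsub>?F\<^esub> f = \<zero>\<^bsub>?F\<^esub>"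
      by (intro bexI[of _ "\<lambda>i. - 1 * f i"]) (auto simp: free_module_simps)
  qed (auto simp: free_module_simps pr.add_mem pr.zero_mem algebra_simps fin_add)
  show "a \<odot>\<^bsub>?F\<^esub> f \<in> carrier ?F" if "a \<in> carrier ?R" "f \<in> carrier ?F" for a f
    using that by (auto simp: free_module_simps poly_ring_simps pr.mult_mem fin_mult)
qed (auto simp: free_module_simps poly_ring_simps algebra_simps)

lemma carrier_free_module_lessThan:
  "carrier (free_module (poly_ring X) {..<m}) = pr.Fr X m"
proof -
  have "finite {i. f i \<noteq> 0}" if "\<forall>i\<ge>m. f i = 0" for f :: "nat \<Rightarrow> ('a \<Rightarrow>\<^sub>0 nat) \<Rightarrow>\<^sub>0 'b"
    by (rule finite_subset[of _ "{..<m}"]) (use that in \<open>auto simp: not_le[symmetric]\<close>)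
  then show ?thesis
    unfolding free_module_simps pr.Fr_def by (auto simp: pr.zero_mem not_le)
qed

text \<open>The definition of projectivity wants a basis inside the element type of the module, hence the
  detour through the unit vectors.\<close>

lemma projective_free_module:
  fixes X :: "'x set"
  shows "projective_module (poly_ring X) (free_module (poly_ring X :: ('x, 'k::field) mpoly ring) {..<m::nat})"
proof -
  let ?R = "poly_ring X :: ('x, 'k) mpoly ring"
  define u where "u i = (\<lambda>j. if j = i then 1 else 0 :: ('x, 'k) mpoly)" for i :: nat
  have inj: "u i = u j \<longleftrightarrow> i = j" for i j
    by (auto simp: u_def fun_eq_iff split: if_splits)
  let ?B = "u ` {..<m}"
  define s where "s f = (\<lambda>g. if g \<in> ?B then f (the_inv_into {..<m} u g) else 0)"
    for f :: "nat \<Rightarrow> ('x, 'k) mpoly"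
  define p where "p h = (\<lambda>i. if i < m then h (u i) else 0)"
    for h :: "(nat \<Rightarrow> ('x, 'k) mpoly) \<Rightarrow> ('x, 'k) mpoly"
  have iu: "inj_on u {..<m}" by (auto simp: inj_on_def inj)
  have su: "s f (u i) = f i" if "i < m" for f i
    using that the_inv_into_f_f[OF iu, of i] by (auto simp: s_def)
  have s0: "s f g = 0" if "g \<notin> ?B" for f g using that by (simp add: s_def)
  have fin: "finite {i. h i \<noteq> 0}" if "\<forall>i. i \<notin> A \<longrightarrow> h i = 0" "finite A"
    for h :: "'b \<Rightarrow> ('x, 'k) mpoly" and A
    by (rule finite_subset[OF _ that(2)]) (use that(1) in auto)
  have "s f \<in> carrier (free_module ?R ?B)" if "f \<in> carrier (free_module ?R {..<m})" for f
    using that fin[of ?B "s f"] s0[of _ f] by (auto simp: free_module_simps su)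
  moreover have "s (\<lambda>i. f i + g i) = (\<lambda>i. s f i + s g i)" "s (\<lambda>i. a * f i) = (\<lambda>i. a * s f i)" for f g a
    by (auto simp: s_def)
  ultimately have s: "s \<in> mod_hom ?R (free_module ?R {..<m}) (free_module ?R ?B)"
    by (auto simp: mod_hom_def free_module_simps(2-))
  have "p h \<in> carrier (free_module ?R {..<m})" if "h \<in> carrier (free_module ?R ?B)" for h
    using that fin[of "{..<m}" "p h"] by (auto simp: free_module_simps p_def)
  moreover have "p (\<lambda>i. f i + g i) = (\<lambda>i. p f i + p g i)" "p (\<lambda>i. a * f i) = (\<lambda>i. a * p f i)" for f g a
    by (auto simp: p_def)
  ultimately have p: "p \<in> mod_hom ?R (free_module ?R ?B) (free_module ?R {..<m})"
    by (auto simp: mod_hom_def free_module_simps(2-))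
  have "p (s f) = f" if "f \<in> carrier (free_module ?R {..<m})" for f
    using that by (auto simp: free_module_simps p_def su fun_eq_iff)
  then show ?thesis unfolding projective_module_def using module_free_module s p by blast
qed

lemma kos_free_module:
  "kos (poly_ring X) (free_module (poly_ring X) B) xs c t b = tkos xs (\<lambda>t. c t b) t"
proof (induction xs arbitrary: c t)
  case (Cons x xs)
  then show ?case
    by (cases t; cases "hd t") (auto simp: free_module_simps poly_ring_minus_one)
qed (simp add: free_module_simps)

lemma kos_exact_free_module:
  fixes X :: "'x set"
  assumes "set zs \<subseteq> X" "distinct zs" "i < int (length zs)"
  shows "kos_exact (poly_ring X) (free_module (poly_ring X :: ('x, 'k::field) mpoly ring) B) (map var zs) i"
  unfolding kos_exact_def
proof (intro allI impI, elim conjE)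
  let ?R = "poly_ring X :: ('x, 'k) mpoly ring"
  let ?F = "free_module ?R B"
  fix c assume c: "cochain ?F (length (map var zs)) i c" and kc: "\<forall>t. kos ?R ?F (map var zs) c t = \<zero>\<^bsub>?F\<^esub>"
  have cF: "c t \<in> carrier ?F" for t using c by (simp add: cochain_def)
  have cX: "c t b \<in> poly_carrier X" for t b
    using cF[of t] by (cases "b \<in> B") (auto simp: free_module_simps pr.zero_mem)
  have deg: "length t = length zs \<and> int (count_list t True) = i" if "c t \<noteq> (\<lambda>i. 0)" for t
    using c that by (simp add: cochain_def free_module_simps)
  \<comment> \<open>Primitives are found coordinate by coordinate. The last clause makes them vanish
    in every coordinate where \<open>c\<close> does, which later gives finite support over an
    infinite basis.\<close>
  have "\<exists>e. (\<forall>t. e t \<in> poly_carrier X) \<and> tdeg (length zs) (i - 1) e \<and>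
      (\<forall>t. tkos (map var zs) e t = c t b) \<and> ((\<forall>t. c t b = 0) \<longrightarrow> (\<forall>t. e t = 0))" for b
  proof (cases "\<forall>t. c t b = 0")
    case True
    then show ?thesis by (intro exI[of _ "\<lambda>t. 0"]) (simp add: pr.zero_mem tdeg_def tkos_zero)
  next
    case False
    have "tkos_exact X zs i {0 :: ('x, 'k) mpoly}" by (rule tkos_exact_ring[OF assms])
    moreover have "tdeg (length zs) i (\<lambda>t. c t b)" using deg unfolding tdeg_def by metis
    moreover have "tkos (map var zs) (\<lambda>t. c t b) t = 0" for t
      using kc kos_free_module[of X B "map var zs" c t b] by (simp add: free_module_simps)
    ultimately have "\<exists>e. (\<forall>t. e t \<in> poly_carrier X) \<and> tdeg (length zs) (i - 1) e \<and>
        (\<forall>t. c t b - tkos (map var zs) e t \<in> {0})"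
      unfolding tkos_exact_def by (elim allE[of _ "\<lambda>t. c t b"] mp) (simp add: cX)
    then obtain e where "\<forall>t. e t \<in> poly_carrier X" "tdeg (length zs) (i - 1) e"
      "\<forall>t. c t b - tkos (map var zs) e t \<in> {0}" by blast
    then show ?thesis using False by (intro exI[of _ e]) auto
  qed
  then have "\<forall>b. \<exists>e. (\<forall>t. e t \<in> poly_carrier X) \<and> tdeg (length zs) (i - 1) e \<and>
      (\<forall>t. tkos (map var zs) e t = c t b) \<and> ((\<forall>t. c t b = 0) \<longrightarrow> (\<forall>t. e t = 0))" by blast
  from choice[OF this] obtain e where e: "\<And>b t. e b t \<in> poly_carrier X" "\<And>b. tdeg (length zs) (i - 1) (e b)"
    "\<And>b t. tkos (map var zs) (e b) t = c t b" "\<And>b t. (\<forall>t. c t b = 0) \<Longrightarrow> e b t = 0" by blast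
  have fin: "finite {b. e b t \<noteq> 0}" for t
  proof (rule finite_subset)
    show "{b. e b t \<noteq> 0} \<subseteq> (\<Union>s\<in>{s. set s \<subseteq> UNIV \<and> length s = length zs}. {b. c s b \<noteq> 0})"
    proof
      fix b assume "b \<in> {b. e b t \<noteq> 0}"
      then obtain s where "c s b \<noteq> 0" using e(4) by blast
      moreover from this have "c s \<noteq> (\<lambda>i. 0)" by (auto dest: fun_cong[of _ _ b])
      then have "length s = length zs" using deg[of s] by blast
      ultimately show "b \<in> (\<Union>s\<in>{s. set s \<subseteq> UNIV \<and> length s = length zs}. {b. c s b \<noteq> 0})" by blast
    qed
    have "finite {b. c s b \<noteq> 0}" for s using cF[of s] by (simp add: free_module_simps)
    then show "finite (\<Union>s\<in>{s :: bool list. set s \<subseteq> UNIV \<and> length s = length zs}. {b. c s b \<noteq> 0})"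
      by (intro finite_UN_I finite_lists_length_eq) simp_all
  qed
  have "b \<notin> B \<Longrightarrow> e b t = 0" for b t using cF by (intro e(4)) (simp add: free_module_simps)
  then have "(\<lambda>b. e b t) \<in> carrier ?F" for t using e(1) fin[of t] by (simp add: free_module_simps)
  moreover have "length t = length zs \<and> int (count_list t True) = i - 1" if nz: "(\<lambda>b. e b t) \<noteq> (\<lambda>b. 0)" for t
  proof -
    obtain b where "e b t \<noteq> 0" using nz by (auto simp: fun_eq_iff)
    then show ?thesis using e(2)[of b] by (simp add: tdeg_def)
  qed
  ultimately have "cochain ?F (length (map var zs)) (i - 1) (\<lambda>t b. e b t)"
    unfolding cochain_def free_module_simps(2) length_map by blast
  moreover have "kos ?R ?F (map var zs) (\<lambda>t b. e b t) t = c t" for t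
    using e(3) by (simp add: fun_eq_iff kos_free_module)
  ultimately show "\<exists>e. cochain ?F (length (map var zs)) (i - 1) e \<and> (\<forall>t. kos ?R ?F (map var zs) e t = c t)"
    by blast
qed

section \<open>Quotients by squarefree monomial ideals\<close>

context
  fixes X :: "'x set" and U :: "'x set \<Rightarrow> bool"
  assumes mono_U: "mono U"
begin

lemma ideal_mono_ideal: "ideal (mono_ideal X U) (poly_ring X :: ('x, 'k::field) mpoly ring)"
proof -
  let ?R = "poly_ring X :: ('x, 'k) mpoly ring"
  interpret cring ?R by (rule cring_poly_ring)
  have inv: "\<ominus>\<^bsub>?R\<^esub> p = - p" if "p \<in> poly_carrier X" for p
    using that by (intro minus_equality) (simp_all add: poly_ring_simps pr.uminus_mem)
  show ?thesis
  proof (rule idealI)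
    show "ring ?R" by (rule ring_axioms)
    show "subgroup (mono_ideal X U) (add_monoid ?R)"
      using mono_ideal_subset[of X U]
    proof (intro group.subgroupI[OF a_group])
      show "inv\<^bsub>add_monoid ?R\<^esub> p \<in> mono_ideal X U" if "p \<in> mono_ideal X U" for p
        using inv[of p] that mono_ideal_subset[of X U] mono_ideal_uminus[OF that] by (auto simp: a_inv_def)
    qed (auto simp: poly_ring_simps mono_ideal_add intro: mono_ideal_0)
    show "x \<otimes>\<^bsub>?R\<^esub> a \<in> mono_ideal X U" "a \<otimes>\<^bsub>?R\<^esub> x \<in> mono_ideal X U"
      if "a \<in> mono_ideal X U" "x \<in> carrier ?R" for a x
      using mono_ideal_mult[OF mono_U, of x X a] that by (simp_all add: poly_ring_simps mult.commute[of a x])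
  qed
qed

lemma quot_simps:
  fixes p q :: "('x, 'k::field) mpoly"
  defines "Q \<equiv> quot_module (poly_ring X) (mono_ideal X U)"
    and "cl \<equiv> \<lambda>p. mono_ideal X U +>\<^bsub>poly_ring X\<^esub> p"
  shows "carrier Q = cl ` poly_carrier X" "\<zero>\<^bsub>Q\<^esub> = mono_ideal X U"
    "p \<in> poly_carrier X \<Longrightarrow> q \<in> poly_carrier X \<Longrightarrow> cl p \<oplus>\<^bsub>Q\<^esub> cl q = cl (p + q)"
    "p \<in> poly_carrier X \<Longrightarrow> q \<in> poly_carrier X \<Longrightarrow> p \<odot>\<^bsub>Q\<^esub> cl q = cl (p * q)"
    "cl p = cl q \<longleftrightarrow> p - q \<in> mono_ideal X U" "cl p = mono_ideal X U \<longleftrightarrow> p \<in> mono_ideal X U"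
proof -
  let ?R = "poly_ring X :: ('x, 'k) mpoly ring" and ?I = "mono_ideal X U :: ('x, 'k) mpoly set"
  interpret ideal ?I ?R by (rule ideal_mono_ideal)
  have cl: "cl p = (\<lambda>i. i + p) ` ?I" for p
    by (auto simp: cl_def a_r_coset_def' poly_ring_simps)
  have sel: "carrier Q = carrier (?R Quot ?I)" "add Q = add (?R Quot ?I)" "zero Q = zero (?R Quot ?I)"
    "smult Q = (\<lambda>a Z. (?I +>\<^bsub>?R\<^esub> a) \<otimes>\<^bsub>?R Quot ?I\<^esub> Z)"
    by (simp_all add: Q_def quot_module_def ring.defs module.defs)
  show "carrier Q = cl ` poly_carrier X"
    by (auto simp: sel FactRing_def A_RCOSETS_def' cl_def poly_ring_simps)
  show "\<zero>\<^bsub>Q\<^esub> = ?I" by (simp add: sel FactRing_def)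
  have hom: "(+>\<^bsub>?R\<^esub>) ?I \<in> ring_hom ?R (?R Quot ?I)"
    using rcos_ring_hom .
  show "cl p \<oplus>\<^bsub>Q\<^esub> cl q = cl (p + q)" if "p \<in> poly_carrier X" "q \<in> poly_carrier X"
    using ring_hom_add[OF hom, of p q] that by (simp add: sel cl_def poly_ring_simps)
  show "p \<odot>\<^bsub>Q\<^esub> cl q = cl (p * q)" if "p \<in> poly_carrier X" "q \<in> poly_carrier X"
    using ring_hom_mult[OF hom, of p q] that by (simp add: sel cl_def poly_ring_simps)
  have eq: "cl p = cl q \<longleftrightarrow> p - q \<in> ?I" for p q
  proof
    assume "cl p = cl q"
    then have "0 + p \<in> (\<lambda>i. i + q) ` ?I" unfolding cl using mono_ideal_0 by blast
    then show "p - q \<in> ?I" by auto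
  next
    assume pq: "p - q \<in> ?I"
    have "i + p = (i + (p - q)) + q" "i + q = (i - (p - q)) + p" for i by simp_all
    then show "cl p = cl q" unfolding cl using mono_ideal_add[OF _ pq] mono_ideal_diff[OF _ pq] by blast
  qed
  then show "cl p = cl q \<longleftrightarrow> p - q \<in> ?I" .
  have "cl 0 = ?I" by (simp add: cl)
  then show "cl p = ?I \<longleftrightarrow> p \<in> ?I" using eq[of p 0] by simp
qed

lemma kos_exact_quot:
  assumes ex: "kos_exact (poly_ring X) (quot_module (poly_ring X :: ('x, 'k::field) mpoly ring) (mono_ideal X U)) (map var zs) i"
    and zs: "set zs \<subseteq> X"
  shows "tkos_exact X zs i (mono_ideal X U :: ('x, 'k) mpoly set)"
  unfolding tkos_exact_def
proof (intro allI impI, elim conjE)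
  let ?R = "poly_ring X :: ('x, 'k) mpoly ring" and ?I = "mono_ideal X U :: ('x, 'k) mpoly set"
  let ?Q = "quot_module ?R ?I" and ?cl = "\<lambda>p. ?I +>\<^bsub>?R\<^esub> p"
  note qs = quot_simps[where 'k = 'k]
  have cl0: "?cl 0 = ?I" using qs(6)[of 0] mono_ideal_0[of X U] by blast
  have kos_cl: "kos ?R ?Q (map var zs) (\<lambda>t. ?cl (c t)) t = ?cl (tkos (map var zs) c t)"
    if "\<And>t. c t \<in> poly_carrier X" for c t
    using that zs
  proof (induction zs arbitrary: c t)
    case Nil
    then show ?case by (simp add: qs cl0)
  next
    case (Cons z zs)
    have X: "tkos (map var zs) (\<lambda>s. c (b # s)) s \<in> poly_carrier X" for b s
      using Cons.prems by (intro tkos_carrier) auto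
    show ?case
    proof (cases t)
      case Nil
      then show ?thesis by (simp add: qs cl0)
    next
      case t: (Cons b s)
      have IH: "kos ?R ?Q (map var zs) (\<lambda>s. ?cl (c (b # s))) s = ?cl (tkos (map var zs) (\<lambda>s. c (b # s)) s)"
        using Cons.prems by (intro Cons.IH) auto
      show ?thesis
        using t IH X Cons.prems
        by (cases b) (auto simp: poly_ring_minus_one qs pr.mult_mem var_mem pr.uminus_mem pr.one_mem)
    qed
  qed
  fix c :: "bool list \<Rightarrow> ('x, 'k) mpoly"
  assume c: "\<forall>t. c t \<in> poly_carrier X" "tdeg (length zs) i c" "\<forall>t. tkos (map var zs) c t \<in> ?I"
  have "c t \<noteq> 0" if "?cl (c t) \<noteq> ?I" for t
    using that qs(6)[of "c t"] mono_ideal_0[of X U] by auto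
  then have "cochain ?Q (length (map var zs)) i (\<lambda>t. ?cl (c t))"
    using c(1,2) by (auto simp: cochain_def qs tdeg_def)
  moreover have "kos ?R ?Q (map var zs) (\<lambda>t. ?cl (c t)) t = \<zero>\<^bsub>?Q\<^esub>" for t
    using kos_cl[of c t] c qs(6) by (simp add: qs)
  ultimately obtain E where E: "cochain ?Q (length zs) (i - 1) E"
    "\<And>t. kos ?R ?Q (map var zs) E t = ?cl (c t)"
    using ex unfolding kos_exact_def by auto
  \<comment> \<open>A zero class gets the representative 0, since \<open>tdeg\<close> tests
    vanishing in the ring and not modulo the ideal.\<close>
  have "\<exists>p. p \<in> poly_carrier X \<and> ?cl p = E t \<and> (E t = ?I \<longrightarrow> p = 0)" for t
  proof (cases "E t = ?I")
    case True
    then show ?thesis using cl0 by (intro exI[of _ 0]) (simp add: pr.zero_mem)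
  next
    case False
    have "E t \<in> ?cl ` poly_carrier X" using E(1) by (simp add: cochain_def qs)
    then show ?thesis using False by auto
  qed
  then obtain e where e: "\<And>t. e t \<in> poly_carrier X" "\<And>t. ?cl (e t) = E t" "\<And>t. E t = ?I \<Longrightarrow> e t = 0" by metis
  have "tdeg (length zs) (i - 1) e"
    using E(1) e(3) unfolding tdeg_def cochain_def by (metis qs(2))
  moreover have "c t - tkos (map var zs) e t \<in> ?I" for t
    using kos_cl[of e t] e E(2)[of t] qs(5) by simp
  ultimately show "\<exists>e. (\<forall>t. e t \<in> poly_carrier X) \<and> tdeg (length zs) (i - 1) e \<and>
      (\<forall>t. c t - tkos (map var zs) e t \<in> ?I)" using e(1) by blast
qed

end

text \<open>Unrolls the recursion of \<open>free_res\<close> into one sequence of ranks and one of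
  matrices, the shape in which \<open>projective_resolution\<close> wants a complex.\<close>

lemma (in subring_of_type) free_res_sequence:
  assumes "free_res n K"
  shows "\<exists>b c. K = lincomb (b 0) (c 0) ` Fr (b 0) \<and> (\<forall>j\<ge>n. b j = 0) \<and>
    (\<forall>j. lincomb (b (Suc j)) (c (Suc j)) ` Fr (b (Suc j)) = {f \<in> Fr (b j). lincomb (b j) (c j) f = 0})"
  using assms
proof (induction n arbitrary: K)
  case 0
  have F: "Fr 0 = {0}" by (auto simp: Fr_def fun_eq_iff fun_ops zero_mem)
  then have "lincomb 0 c ` Fr 0 = {0}" "{f \<in> Fr 0. lincomb 0 c f = 0} = {0}" for c
    using lincomb_zero[of 0 c] by auto
  then show ?case using 0 by (intro exI[of _ "\<lambda>_. 0"] exI[of _ "\<lambda>_ _. 0"]) simp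
next
  case (Suc n)
  then obtain m c where c: "K = lincomb m c ` Fr m" "free_res n {f \<in> Fr m. lincomb m c f = 0}" by auto
  from Suc.IH[OF c(2)] obtain b' c' where b':
    "{f \<in> Fr m. lincomb m c f = 0} = lincomb (b' 0) (c' 0) ` Fr (b' 0)" "\<forall>j\<ge>n. b' j = 0"
    "\<forall>j. lincomb (b' (Suc j)) (c' (Suc j)) ` Fr (b' (Suc j)) = {f \<in> Fr (b' j). lincomb (b' j) (c' j) f = 0}"
    by auto
  have "lincomb (case_nat m b' (Suc j)) (case_nat c c' (Suc j)) ` Fr (case_nat m b' (Suc j)) =
    {f \<in> Fr (case_nat m b' j). lincomb (case_nat m b' j) (case_nat c c' j) f = 0}" for j
    using b' by (cases j) simp_all
  moreover have "case_nat m b' j = 0" if "j \<ge> Suc n" for j using that b'(2) by (cases j) simp_all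
  ultimately show ?case using c(1)
    by (intro exI[of _ "case_nat m b'"] exI[of _ "case_nat c c'"]) simp
qed

lemma proj_dim_le:
  fixes X :: "'x set"
  assumes "ideal_res TYPE('k::field) X n U" "mono U"
  shows "proj_dim (poly_ring X) (quot_module (poly_ring X :: ('x, 'k) mpoly ring) (mono_ideal X U)) \<le> enat n"
proof -
  let ?R = "poly_ring X :: ('x, 'k) mpoly ring" and ?I = "mono_ideal X U :: ('x, 'k) mpoly set"
  let ?Q = "quot_module ?R ?I" and ?cl = "\<lambda>p. ?I +>\<^bsub>?R\<^esub> p"
  note qs = quot_simps[OF assms(2), where X = X and 'k = 'k]
  obtain b c where bc: "rank_one ` ?I = pr.lincomb (b 0) (c 0) ` pr.Fr X (b 0)" "\<forall>j\<ge>n. b j = 0"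
    "\<And>j. pr.lincomb (b (Suc j)) (c (Suc j)) ` pr.Fr X (b (Suc j)) = {f \<in> pr.Fr X (b j). pr.lincomb (b j) (c j) f = 0}"
    using pr.free_res_sequence[OF assms(1)[unfolded ideal_res_def]] by auto
  \<comment> \<open>The ring itself stands in degree 0, so the resolution of the ideal is shifted by
    one: \<open>b j = 0\<close> for \<open>j \<ge> n\<close> makes \<open>P i\<close> vanish for
    \<open>i > n\<close>.\<close>
  define P where "P j = free_module ?R {..<case_nat 1 b j}" for j
  have P: "carrier (P j) = pr.Fr X (case_nat 1 b j)" "\<zero>\<^bsub>P j\<^esub> = 0" "add (P j) = (+)"
    "smult (P j) = (\<lambda>a f i. a * f i)" for j
    unfolding P_def by (rule carrier_free_module_lessThan) (simp_all add: free_module_simps fun_eq_iff fun_ops)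
  define d where "d j = pr.lincomb (b j) (c j)" for j
  define e where "e = (\<lambda>f :: nat \<Rightarrow> ('x, 'k) mpoly. ?cl (f 0))"
  have d0: "d 0 ` carrier (P 1) = {x \<in> carrier (P 0). e x = \<zero>\<^bsub>?Q\<^esub>}"
  proof -
    have "rank_one ` ?I = {x \<in> pr.Fr X 1. x 0 \<in> ?I}"
    proof (intro equalityI subsetI)
      fix x assume "x \<in> {x \<in> pr.Fr X 1. x 0 \<in> ?I}"
      then have "x = rank_one (x 0)" "x 0 \<in> ?I" by (auto simp: pr.Fr_def rank_one_def fun_eq_iff)
      then show "x \<in> rank_one ` ?I" by blast
    qed (use mono_ideal_subset[of X U] in \<open>auto simp: pr.Fr_def rank_one_def pr.zero_mem\<close>)
    then show ?thesis using bc(1) qs(6) by (simp add: P d_def e_def qs)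
  qed
  have dS: "d (Suc j) ` carrier (P (Suc (Suc j))) = {x \<in> carrier (P (Suc j)). d j x = \<zero>\<^bsub>P j\<^esub>}" for j
    using bc(3)[of j] by (simp add: P d_def)
  have dP: "d j f \<in> carrier (P j)" if "f \<in> carrier (P (Suc j))" for j f
  proof (cases j)
    case 0
    then have "d 0 f \<in> d 0 ` carrier (P 1)" using that by simp
    then show ?thesis unfolding d0 using 0 by simp
  next
    case (Suc i)
    then have "d (Suc i) f \<in> d (Suc i) ` carrier (P (Suc (Suc i)))" using that by simp
    then show ?thesis unfolding dS using Suc by simp
  qed
  have "d j \<in> mod_hom ?R (P (Suc j)) (P j)" for j
    using dP by (auto simp: mod_hom_def d_def P pr.lincomb_add pr.lincomb_smult)
  moreover have "e \<in> mod_hom ?R (P 0) ?Q"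
    by (auto simp: mod_hom_def e_def P qs pr.Fr_def poly_ring_simps fun_ops)
  moreover have "e ` carrier (P 0) = carrier ?Q"
  proof -
    have "?cl p = e (rank_one p)" "rank_one p \<in> pr.Fr X 1" if "p \<in> poly_carrier X" for p
      using that by (auto simp: e_def pr.Fr_def rank_one_def pr.zero_mem)
    then have "?cl ` poly_carrier X \<subseteq> e ` pr.Fr X 1" by (metis image_eqI image_subsetI)
    moreover have "e ` pr.Fr X 1 \<subseteq> ?cl ` poly_carrier X" by (auto simp: e_def pr.Fr_def)
    ultimately show ?thesis by (simp add: P qs)
  qed
  moreover have "projective_module ?R (P j)" for j
    unfolding P_def by (rule projective_free_module)
  ultimately have "projective_resolution ?R ?Q P e d"
    unfolding projective_resolution_def using d0 dS by simp
  moreover have "carrier (P i) = {\<zero>\<^bsub>P i\<^esub>}" if i: "i > n" for i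
  proof -
    obtain j where "i = Suc j" "j \<ge> n" using i by (cases i) auto
    then have "carrier (P i) = pr.Fr X 0" using bc(2) by (simp add: P)
    then show ?thesis by (auto simp: P pr.Fr_def pr.zero_mem fun_eq_iff fun_ops)
  qed
  ultimately show ?thesis unfolding proj_dim_def by (intro Inf_lower) blast
qed

lemma proj_dim_le_imp_tkos_exact:
  fixes X :: "'x set"
  assumes "proj_dim (poly_ring X) (quot_module (poly_ring X :: ('x, 'k::field) mpoly ring) (mono_ideal X U)) \<le> enat n"
    and "mono U" "set zs \<subseteq> X" "distinct zs" "i + int n < int (length zs)"
  shows "tkos_exact X zs i (mono_ideal X U :: ('x, 'k) mpoly set)"
proof -
  let ?R = "poly_ring X :: ('x, 'k) mpoly ring" and ?I = "mono_ideal X U :: ('x, 'k) mpoly set"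
  let ?Q = "quot_module ?R ?I"
  let ?S = "{enat m | m. \<exists>(P :: nat \<Rightarrow> (('x, 'k) mpoly, nat \<Rightarrow> ('x, 'k) mpoly) module) e d.
      projective_resolution ?R ?Q P e d \<and> (\<forall>i>m. carrier (P i) = {\<zero>\<^bsub>P i\<^esub>})}"
  have "?S \<noteq> {}" using assms(1) unfolding proj_dim_def by (auto simp: Inf_enat_def split: if_splits)
  \<comment> \<open>The infimum of a nonempty set of extended naturals is attained, which provides
    an actual resolution.\<close>
  then have "Inf ?S \<in> ?S" unfolding Inf_enat_def by (metis (mono_tags, lifting) LeastI_ex ex_in_conv)
  then obtain m and P :: "nat \<Rightarrow> (('x, 'k) mpoly, nat \<Rightarrow> ('x, 'k) mpoly) module" and e d where m: "Inf ?S = enat m" "projective_resolution ?R ?Q P e d"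
    "\<forall>i>m. carrier (P i) = {\<zero>\<^bsub>P i\<^esub>}" by blast
  have "m \<le> n" using assms(1) m(1) unfolding proj_dim_def by simp
  have zs: "set (map var zs) \<subseteq> carrier ?R" using assms(3) by (auto simp: poly_ring_simps var_mem)
  have "kos_exact ?R (P j) (map var zs) k" if k: "k < int (length (map var zs))" for j k
  proof -
    have "projective_module ?R (P j)" using m(2) by (simp add: projective_resolution_def)
    then obtain B :: "(nat \<Rightarrow> ('x, 'k) mpoly) set" and s p where "Module.module ?R (P j)"
      "s \<in> mod_hom ?R (P j) (free_module ?R B)" "p \<in> mod_hom ?R (free_module ?R B) (P j)"
      "\<forall>x\<in>carrier (P j). p (s x) = x" unfolding projective_module_def by blast
    then show ?thesis
      using kos_exact_retract[OF _ module_free_module zs, of "P j" s B p k]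
        kos_exact_free_module[OF assms(3,4), of k B] k by simp
  qed
  moreover have "Module.module ?R ?Q"
    by (rule module_quot_module[OF cring_poly_ring ideal_mono_ideal[OF assms(2)]])
  ultimately have "kos_exact ?R ?Q (map var zs) i"
    using assms(5) \<open>m \<le> n\<close> by (intro kos_exact_resolution[OF _ zs m(2,3)]) auto
  then show ?thesis by (rule kos_exact_quot[OF assms(2) _ assms(3)])
qed

text \<open>A certificate for projective dimension at least \<open>n\<close>: with a smaller value
  \<open>m\<close>, \<open>i + m < length zs\<close> would force vanishing in degree
  \<open>i\<close>. The degree stays free because \<open>pd_ge_inter\<close> raises it.\<close>

definition pd_ge :: "'k::field itself \<Rightarrow> 'x set \<Rightarrow> nat \<Rightarrow> ('x set \<Rightarrow> bool) \<Rightarrow> bool"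
  where "pd_ge _ X n U \<longleftrightarrow> (\<exists>zs i. set zs \<subseteq> X \<and> distinct zs \<and> length zs = n + i \<and>
    \<not> tkos_exact X zs (int i) (mono_ideal X U :: ('x, 'k) mpoly set))"

lemma proj_dim_eq:
  fixes X :: "'x set"
  assumes "ideal_res TYPE('k::field) X n U" "pd_ge TYPE('k) X n U" "mono U"
  shows "proj_dim (poly_ring X) (quot_module (poly_ring X :: ('x, 'k) mpoly ring) (mono_ideal X U)) = enat n"
proof -
  let ?R = "poly_ring X :: ('x, 'k) mpoly ring" and ?I = "mono_ideal X U :: ('x, 'k) mpoly set"
  have le: "proj_dim ?R (quot_module ?R ?I) \<le> enat n" by (rule proj_dim_le[OF assms(1,3)])
  then obtain m where m: "proj_dim ?R (quot_module ?R ?I) = enat m" "m \<le> n"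
    by (cases "proj_dim ?R (quot_module ?R ?I)") auto
  have "m = n"
  proof (rule ccontr)
    assume "m \<noteq> n"
    obtain zs i where zs: "set zs \<subseteq> X" "distinct zs" "length zs = n + i" "\<not> tkos_exact X zs (int i) ?I"
      using assms(2) unfolding pd_ge_def by blast
    moreover have "proj_dim ?R (quot_module ?R ?I) \<le> enat m" using m(1) by simp
    moreover have "int i + int m < int (length zs)" using zs(3) m(2) \<open>m \<noteq> n\<close> by simp
    ultimately show False using proj_dim_le_imp_tkos_exact assms(3) by blast
  qed
  then show ?thesis using m by simp
qed

text \<open>The connecting map of \<open>0 \<rightarrow> R / I \<rightarrow> R / I\<^sub>1 \<oplus> R / I\<^sub>2 \<rightarrow> R / (I\<^sub>1 + I\<^sub>2) \<rightarrow> 0\<close> for \<open>I = I\<^sub>1 \<inter> I\<^sub>2\<close>.\<close>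

lemma tkos_exact_sum:
  assumes U: "\<And>T. U T \<longleftrightarrow> U1 T \<and> U2 T" and zs: "set zs \<subseteq> X" and mono: "mono U1" "mono U2"
    and ex: "tkos_exact X zs i (mono_ideal X U1 :: ('x, 'k::field) mpoly set)"
      "tkos_exact X zs i (mono_ideal X U2 :: ('x, 'k) mpoly set)"
      "tkos_exact X zs (i + 1) (mono_ideal X U :: ('x, 'k) mpoly set)"
  shows "tkos_exact X zs i (mono_ideal X (\<lambda>T. U1 T \<or> U2 T) :: ('x, 'k) mpoly set)"
  unfolding tkos_exact_def
proof (intro allI impI, elim conjE)
  let ?M = "\<lambda>U. mono_ideal X U :: ('x, 'k) mpoly set"
  let ?k = "tkos (map var zs)" and ?n = "length zs"
  have I12: "p \<in> ?M U \<longleftrightarrow> p \<in> ?M U1 \<and> p \<in> ?M U2" for p by (auto simp: mono_ideal_def U)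
  have Mor: "?M U1 \<subseteq> ?M (\<lambda>T. U1 T \<or> U2 T)" "?M U2 \<subseteq> ?M (\<lambda>T. U1 T \<or> U2 T)" by (auto simp: mono_ideal_def)
  have kM: "?k c t \<in> ?M W" if "\<And>t. c t \<in> ?M W" "mono W" for c t W
    using that zs by (intro tkos_mem) (auto intro: mono_ideal_0 mono_ideal_diff mono_ideal_mult var_mem)
  fix c :: "bool list \<Rightarrow> ('x, 'k) mpoly"
  assume c: "\<forall>t. c t \<in> poly_carrier X" "tdeg ?n i c" "\<forall>t. ?k c t \<in> ?M (\<lambda>T. U1 T \<or> U2 T)"
  \<comment> \<open>The coboundary of \<open>c\<close> is divided between the two ideals by sorting
    its terms; \<open>a\<close> represents the image under the connecting map.\<close>
  define a where "a t = restrict_keys (\<lambda>m. U1 (keys m)) (?k c t)" for t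
  define b where "b t = ?k c t - a t" for t
  have ab: "?k c t = a t + b t" for t by (simp add: b_def)
  have a: "a t \<in> ?M U1" for t
    using c(3)[rule_format, of t] by (auto simp: a_def mono_ideal_def poly_carrier_def keys_restrict_keys)
  have "b t = restrict_keys (\<lambda>m. \<not> U1 (keys m)) (?k c t)" for t
    using restrict_keys_add[of "?k c t" "\<lambda>m. U1 (keys m)"] by (simp add: b_def a_def algebra_simps)
  then have b: "b t \<in> ?M U2" for t
    using c(3)[rule_format, of t] by (auto simp: mono_ideal_def poly_carrier_def keys_restrict_keys)
  have "a t = 0" if "?k c t = 0" for t using that by (simp add: a_def restrict_keys_def)
  moreover have "tdeg ?n (i + 1) (?k c)" using tkos_tdeg[of "map var zs" i c] c(2) by simp
  ultimately have a_deg: "tdeg ?n (i + 1) a" unfolding tdeg_def by blast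
  have "(\<lambda>t. a t + b t) = ?k c" using ab by auto
  then have "?k (\<lambda>t. a t + b t) t = 0" for t by (simp add: tkos_tkos)
  then have kab: "?k a t = - ?k b t" for t by (simp add: tkos_add eq_neg_iff_add_eq_0)
  \<comment> \<open>By \<open>d a = - d b\<close> this element lies in both ideals, so
    \<open>a\<close> is a cocycle modulo the intersection.\<close>
  have "?k a t \<in> ?M U" for t
    unfolding I12 using kM[of a U1 t] kM[of b U2 t] a b mono mono_ideal_uminus[of "?k b t" X U2] kab by simp
  then have "\<exists>e. (\<forall>t. e t \<in> poly_carrier X) \<and> tdeg ?n (i + 1 - 1) e \<and> (\<forall>t. a t - ?k e t \<in> ?M U)"
    using ex(3) a a_deg mono_ideal_subset[of X U1] unfolding tkos_exact_def by blast
  then obtain e where e: "\<And>t. e t \<in> poly_carrier X" "tdeg ?n i e" "\<And>t. a t - ?k e t \<in> ?M U" by auto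
  have "?k e t \<in> ?M U1" for t
    using mono_ideal_diff[of "a t" X U1 "a t - ?k e t"] a e(3)[of t] by (simp add: I12)
  then have "\<exists>g. (\<forall>t. g t \<in> poly_carrier X) \<and> tdeg ?n (i - 1) g \<and> (\<forall>t. e t - ?k g t \<in> ?M U1)"
    using ex(1) e unfolding tkos_exact_def by blast
  then obtain g where g: "\<And>t. g t \<in> poly_carrier X" "tdeg ?n (i - 1) g" "\<And>t. e t - ?k g t \<in> ?M U1" by blast
  have "?k (\<lambda>t. c t - e t) t \<in> ?M U2" for t
    using mono_ideal_add[of "a t - ?k e t" X U2 "b t"] e(3)[of t] b[of t] ab[of t]
    by (simp add: I12 tkos_diff algebra_simps)
  moreover have "c t - e t \<in> poly_carrier X" for t using c(1) e(1) by (simp add: poly_carrier_diff)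
  moreover have "c t \<noteq> 0 \<or> e t \<noteq> 0" if "c t - e t \<noteq> 0" for t using that by auto
  then have "tdeg ?n i (\<lambda>t. c t - e t)" using c(2) e(2) unfolding tdeg_def by blast
  ultimately have "\<exists>h. (\<forall>t. h t \<in> poly_carrier X) \<and> tdeg ?n (i - 1) h \<and> (\<forall>t. (c t - e t) - ?k h t \<in> ?M U2)"
    using ex(2) unfolding tkos_exact_def by (elim allE[of _ "\<lambda>t. c t - e t"] mp) simp
  then obtain h where h: "\<And>t. h t \<in> poly_carrier X" "tdeg ?n (i - 1) h" "\<And>t. (c t - e t) - ?k h t \<in> ?M U2" by blast
  have "c t - ?k (\<lambda>t. g t + h t) t \<in> ?M (\<lambda>T. U1 T \<or> U2 T)" for t
  proof -
    have eq: "c t - ?k (\<lambda>t. g t + h t) t = (e t - ?k g t) + ((c t - e t) - ?k h t)" by (simp add: tkos_add)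
    show ?thesis unfolding eq
      by (rule mono_ideal_add[OF subsetD[OF Mor(1) g(3)[of t]] subsetD[OF Mor(2) h(3)[of t]]])
  qed
  moreover have "g t \<noteq> 0 \<or> h t \<noteq> 0" if "g t + h t \<noteq> 0" for t using that by auto
  then have "tdeg ?n (i - 1) (\<lambda>t. g t + h t)" using g(2) h(2) unfolding tdeg_def by blast
  ultimately show "\<exists>e. (\<forall>t. e t \<in> poly_carrier X) \<and> tdeg ?n (i - 1) e \<and> (\<forall>t. c t - ?k e t \<in> ?M (\<lambda>T. U1 T \<or> U2 T))"
    using g(1) h(1) by (intro exI[of _ "\<lambda>t. g t + h t"]) (simp add: pr.add_mem)
qed

text \<open>With \<open>n + 1 + i\<close> variables, the cohomology of both \<open>R / I1\<close>
  and \<open>R / I2\<close> vanishes in degree \<open>i\<close>, so the connecting map is injective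
  there. The image has degree \<open>i + 1\<close> on the same variables, and one unit of
  \<open>n\<close> is spent on the degree.\<close>

lemma pd_ge_inter:
  fixes X :: "'x set"
  assumes "pd_ge TYPE('k::field) X (Suc n) (\<lambda>T. U1 T \<or> U2 T)"
    and "ideal_res TYPE('k) X n U1" "ideal_res TYPE('k) X n U2" "mono U1" "mono U2"
    and U: "\<And>T. U T \<longleftrightarrow> U1 T \<and> U2 T"
  shows "pd_ge TYPE('k) X n U"
proof -
  let ?M = "\<lambda>U. mono_ideal X U :: ('x, 'k) mpoly set"
  obtain zs i where zs: "set zs \<subseteq> X" "distinct zs" "length zs = Suc n + i"
    "\<not> tkos_exact X zs (int i) (?M (\<lambda>T. U1 T \<or> U2 T))"
    using assms(1) unfolding pd_ge_def by blast
  have "tkos_exact X zs (int i) (?M U1)" "tkos_exact X zs (int i) (?M U2)"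
    using zs assms(2-5) by (auto intro!: proj_dim_le_imp_tkos_exact proj_dim_le)
  then have "\<not> tkos_exact X zs (int i + 1) (?M U)"
    using tkos_exact_sum[OF U zs(1) assms(4,5)] zs(4) by blast
  then show ?thesis unfolding pd_ge_def
    using zs by (intro exI[of _ zs] exI[of _ "Suc i"]) (simp add: add.commute)
qed

text \<open>A squarefree monomial outside the ideal that is killed by all the variables \<open>zs\<close> is a nonzero
  class in degree zero.\<close>

lemma pd_ge_socle:
  fixes X :: "'x set"
  assumes "set zs \<subseteq> X" "distinct zs" "\<sigma> \<subseteq> X" "finite \<sigma>" "\<not> U \<sigma>" "\<And>z. z \<in> set zs \<Longrightarrow> U (insert z \<sigma>)"
  shows "pd_ge TYPE('k::field) X (length zs) U"
proof -
  let ?I = "mono_ideal X U :: ('x, 'k) mpoly set"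
  define m :: "'x \<Rightarrow>\<^sub>0 nat" where "m = (\<Sum>v\<in>\<sigma>. single v 1)"
  have km: "keys m = \<sigma>"
    using assms(4) unfolding m_def
    by (induction \<sigma> rule: finite_induct) (auto simp: keys_add_nat)
  define p :: "('x, 'k) mpoly" where "p = single m 1"
  have p: "p \<in> poly_carrier X" "p \<notin> ?I"
    using assms(3,5) by (auto simp: p_def poly_carrier_def mono_ideal_def km)
  have zp: "var z * p \<in> ?I" if "z \<in> set zs" for z
    using assms(1,3,6) that by (subst mono_ideal_var_times) (auto simp: p_def poly_carrier_def mono_ideal_def km)
  define c where "c t = (if t = replicate (length zs) False then p else 0)" for t
  have kc: "tkos (map var ys) c' t \<in> ?I" if "\<And>t z. z \<in> set ys \<Longrightarrow> var z * c' t \<in> ?I" for ys c' t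
    using that
  proof (induction ys arbitrary: c' t)
    case (Cons y ys)
    have "tkos (map var ys) (\<lambda>s. c' (b # s)) s \<in> ?I" for b s using Cons by simp
    then show ?case using Cons.prems by (cases t; cases "hd t") (auto intro: mono_ideal_0 mono_ideal_diff)
  qed (simp add: mono_ideal_0)
  have "tkos (map var zs) c t \<in> ?I" for t
    by (rule kc) (auto simp: c_def zp mono_ideal_0)
  moreover have "count_list (replicate n False) True = 0" for n by (induction n) auto
  then have "tdeg (length zs) (int 0) c" by (auto simp: tdeg_def c_def)
  moreover have "\<forall>t. c t \<in> poly_carrier X" using p(1) by (simp add: c_def pr.zero_mem)
  \<comment> \<open>There are no cochains in degree -1, so exactness would put the monomial itself
    into the ideal.\<close>
  moreover have "e = (\<lambda>t. 0)" if "tdeg (length zs) (int 0 - 1) e" for e :: "bool list \<Rightarrow> ('x, 'k) mpoly"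
    using that by (force simp: tdeg_def fun_eq_iff)
  moreover have "c (replicate (length zs) False) \<notin> ?I" using p(2) by (simp add: c_def)
  ultimately have "\<not> tkos_exact X zs (int 0) ?I"
    unfolding tkos_exact_def by (metis diff_zero tkos_zero)
  then show ?thesis unfolding pd_ge_def using assms(1,2) by (intro exI[of _ zs] exI[of _ 0]) simp
qed

section \<open>Path ideals: upper bounds\<close>

text \<open>The edge ideal of a path with some edges missing, a flag saying whether the edge is present.\<close>

fun path_sub :: "'x list \<Rightarrow> bool list \<Rightarrow> 'x set \<Rightarrow> bool" where
  "path_sub (v # v' # vs) (p # ps) T \<longleftrightarrow> p \<and> v \<in> T \<and> v' \<in> T \<or> path_sub (v' # vs) ps T"
| "path_sub _ _ _ \<longleftrightarrow> False"

text \<open>The ideal of the string with an additional edge: the flag of a generator says whether it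
  contains the new variable \<open>y\<close>.\<close>

fun path_gen :: "'x \<Rightarrow> 'x list \<Rightarrow> bool list \<Rightarrow> 'x set \<Rightarrow> bool" where
  "path_gen y (v # v' # vs) (b # bs) T \<longleftrightarrow>
    v \<in> T \<and> v' \<in> T \<and> (b \<longrightarrow> y \<in> T) \<or> path_gen y (v' # vs) bs T"
| "path_gen _ _ _ _ \<longleftrightarrow> False"

text \<open>The projective dimension belonging to \<open>path_sub\<close>: a run of \<open>3 l + r\<close> edges, \<open>r \<le> 2\<close>,
  contributes \<open>2 l + r\<close>.\<close>

fun kappa :: "bool list \<Rightarrow> nat" where
  "kappa [] = 0"
| "kappa (False # bs) = kappa bs"
| "kappa [True] = 1"
| "kappa (True # False # bs) = Suc (kappa bs)"
| "kappa [True, True] = 2"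
| "kappa (True # True # b # bs) = Suc (Suc (kappa bs))"

abbreviation kap :: "bool list \<Rightarrow> nat"
  where "kap bs \<equiv> kappa (map Not bs)"

text \<open>The marks cut the path into runs of unmarked edges. The patterns prescribe the lengths of the
  runs modulo 3: all are 2 in \<open>two_pat\<close>; exactly one is 1, respectively 0, and the others are 2 in
  \<open>one_pat\<close>, respectively \<open>zero_pat\<close>; exactly two are 1 and the others 2 in \<open>special_pat\<close>.\<close>

fun two_pat :: "bool list \<Rightarrow> bool" where
  "two_pat [False, False] = True"
| "two_pat (False # False # b # bs) = two_pat bs"
| "two_pat _ = False"

fun one_pat :: "bool list \<Rightarrow> bool" where
  "one_pat [False] = True"
| "one_pat (False # True # bs) = two_pat bs"
| "one_pat (False # False # b # bs) = one_pat bs"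
| "one_pat _ = False"

fun zero_pat :: "bool list \<Rightarrow> bool" where
  "zero_pat [] = True"
| "zero_pat (True # bs) = two_pat bs"
| "zero_pat (False # False # b # bs) = zero_pat bs"
| "zero_pat _ = False"

fun special_pat :: "bool list \<Rightarrow> bool" where
  "special_pat (False # True # bs) = one_pat bs"
| "special_pat (False # False # b # bs) = special_pat bs"
| "special_pat _ = False"

section \<open>Numerical invariants of the run patterns\<close>

lemma kappa_Cons: "kappa bs \<le> kappa (b # bs) \<and> kappa (b # bs) \<le> Suc (kappa bs)"
proof (induction bs arbitrary: b rule: kappa.induct)
  case (6 c bs b)
  then show ?case by (cases b) auto
qed (case_tac [!] b, auto)

lemma kappa_replicate: "kappa (replicate n True) = n - n div 3"
proof (induction n rule: less_induct)
  case (less n)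
  consider "n = 0" | "n = 1" | "n = 2" | m where "n = Suc (Suc (Suc m))"
    by (metis One_nat_def Suc_1 nat.exhaust)
  then show ?case
  proof cases
    case 4
    then show ?thesis using less[of m] by simp
  qed (simp_all add: numeral_2_eq_2)
qed

text \<open>Pattern and \<open>kappa\<close> both advance by three flags of which the third is
  arbitrary: if unmarked, it continues a run by three; if marked, it closes a run of length two.
  Either way length grows by 3 and \<open>kap\<close> by 2.\<close>

lemma two_pat_kap: "two_pat bs \<Longrightarrow> length bs mod 3 = 2 \<and> kap bs = length bs - length bs div 3"
  by (induction bs rule: two_pat.induct) auto

lemma kap_arith:
  fixes n :: nat
  shows "n mod 3 = 2 \<Longrightarrow> (n + 2) mod 3 = 1 \<and> Suc (n - n div 3) = n + 2 - (n + 2) div 3"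
    "n mod 3 = 2 \<Longrightarrow> (n + 1) mod 3 = 0 \<and> n - n div 3 = n + 1 - (n + 1) div 3"
    "n mod 3 = 1 \<Longrightarrow> (n + 2) mod 3 = 0 \<and> Suc (n - n div 3) = n + 2 - (n + 2) div 3"
proof -
  define q where "q = n div 3"
  have n: "n = 3 * q + n mod 3" by (simp add: q_def)
  {
    assume r: "n mod 3 = 2"
    have "n + 2 = 3 * (q + 1) + 1" "n + 1 = 3 * (q + 1)" using n r by simp_all
    then have e: "(n + 2) div 3 = q + 1" "(n + 2) mod 3 = 1" "(n + 1) div 3 = q + 1" "(n + 1) mod 3 = 0"
      by presburger+
    show "(n + 2) mod 3 = 1 \<and> Suc (n - n div 3) = n + 2 - (n + 2) div 3"
      "(n + 1) mod 3 = 0 \<and> n - n div 3 = n + 1 - (n + 1) div 3"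
      unfolding e q_def[symmetric] using n r by simp_all
  next
    assume r: "n mod 3 = 1"
    have "n + 2 = 3 * (q + 1)" using n r by simp
    then have e: "(n + 2) div 3 = q + 1" "(n + 2) mod 3 = 0" by presburger+
    show "(n + 2) mod 3 = 0 \<and> Suc (n - n div 3) = n + 2 - (n + 2) div 3"
      unfolding e q_def[symmetric] using n r by simp
  }
qed

lemma one_pat_kap: "one_pat bs \<Longrightarrow> length bs mod 3 = 1 \<and> kap bs = length bs - length bs div 3"
proof (induction bs rule: one_pat.induct)
  case (2 bs)
  then have "length bs mod 3 = 2 \<and> kap bs = length bs - length bs div 3" using two_pat_kap[of bs] by simp
  then show ?case using kap_arith(1)[of "length bs"] by simp
qed auto

lemma zero_pat_kap: "zero_pat bs \<Longrightarrow> length bs mod 3 = 0 \<and> kap bs = length bs - length bs div 3"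
proof (induction bs rule: zero_pat.induct)
  case (2 bs)
  then have "length bs mod 3 = 2 \<and> kap bs = length bs - length bs div 3" using two_pat_kap[of bs] by simp
  then show ?case using kap_arith(2)[of "length bs"] by simp
qed auto

lemma special_pat_kap: "special_pat bs \<Longrightarrow> length bs mod 3 = 0 \<and> kap bs = length bs - length bs div 3"
proof (induction bs rule: special_pat.induct)
  case (1 bs)
  then have "length bs mod 3 = 1 \<and> kap bs = length bs - length bs div 3" using one_pat_kap[of bs] by simp
  then show ?case using kap_arith(3)[of "length bs"] by simp
qed auto

text \<open>One more unmarked edge in front turns the residue 2 of the first run into 0, which
  leaves its value unchanged. For \<open>one_pat\<close> and \<open>zero_pat\<close> there is an
  exception if the irregular run comes first: its residue becomes 2, respectively 1.\<close>

lemma two_pat_kappa_True: "two_pat bs \<Longrightarrow> kappa (True # map Not bs) = kap bs"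
proof (induction bs rule: two_pat.induct)
  case (2 b bs)
  then show ?case by (cases b) auto
qed auto

lemma one_pat_kappa_True: "one_pat bs \<Longrightarrow> two_pat (False # bs) \<or> kappa (True # map Not bs) = kap bs"
proof (induction bs rule: one_pat.induct)
  case (3 b bs)
  then show ?case by (cases b) auto
qed auto

lemma zero_pat_kappa_True: "zero_pat bs \<Longrightarrow> one_pat (False # bs) \<or> kappa (True # map Not bs) = kap bs"
proof (induction bs rule: zero_pat.induct)
  case (3 b bs)
  then show ?case by (cases b) auto
qed auto

text \<open>The residue of the first run drops from 2 to 1. The recursions of the two patterns run
  offset by one flag, hence the induction on length.\<close>

lemma two_pat_tl: "two_pat (False # bs) \<Longrightarrow> one_pat bs"
proof (induction bs rule: length_induct)
  case (1 bs)
  show ?case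
  proof (cases "bs = [False]")
    case False
    then obtain b cs where bs: "bs = False # b # cs" "two_pat cs"
      using "1.prems" by (cases "False # bs" rule: two_pat.cases) auto
    show ?thesis
    proof (cases b)
      case False
      obtain ds where ds: "cs = False # ds" using bs(2) by (cases cs rule: two_pat.cases) auto
      obtain es where es: "ds = False # es" using bs(2) ds by (cases cs rule: two_pat.cases) auto
      have "one_pat ds" using "1.IH" bs ds by simp
      then show ?thesis using bs False ds by simp
    qed (use bs in simp)
  qed simp
qed

section \<open>Path ideals as properties of supports\<close>

lemma path_sub_insert: "v \<notin> set vs \<Longrightarrow> path_sub vs ps (insert v T) = path_sub vs ps T"
  by (induction vs ps T rule: path_sub.induct) auto

lemma path_gen_insert: "v \<notin> set vs \<Longrightarrow> v \<noteq> y \<Longrightarrow> path_gen y vs bs (insert v T) = path_gen y vs bs T"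
  by (induction y vs bs T rule: path_gen.induct) auto

lemma path_sub_mono: "T \<subseteq> T' \<Longrightarrow> path_sub vs ps T \<Longrightarrow> path_sub vs ps T'"
  by (induction vs ps T rule: path_sub.induct) auto

lemma path_gen_mono: "T \<subseteq> T' \<Longrightarrow> path_gen y vs bs T \<Longrightarrow> path_gen y vs bs T'"
  by (induction y vs bs T rule: path_gen.induct) auto

lemma path_sub_all: "path_sub vs (map Not bs) T \<Longrightarrow> path_sub vs (replicate (length bs) True) T"
  by (induction vs bs T rule: path_gen.induct[of "\<lambda>y. P" for P, case_names 1 2]) auto

text \<open>The decomposition \<open>D + y C\<close> of the splitting along
  \<open>y\<close>.\<close>

lemma path_gen_iff: "path_gen y vs bs T \<longleftrightarrow>
    path_sub vs (map Not bs) T \<or> y \<in> T \<and> path_sub vs (replicate (length bs) True) T"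
  using path_sub_all by (induction y vs bs T rule: path_gen.induct) auto

lemma mono_path_sub [simp]: "mono (path_sub vs ps)"
  using path_sub_mono[of _ _ vs ps] by (intro monoI le_boolI) blast

lemma mono_path_gen [simp]: "mono (path_gen y vs bs)"
  using path_gen_mono[of _ _ y vs bs] by (intro monoI le_boolI) blast

lemma mono_mem [simp]: "mono (\<lambda>T. v \<in> T)"
  by (auto intro!: monoI)

lemma mono_disj [simp]:
  assumes "mono P" "mono Q"
  shows "mono (\<lambda>T :: 'x set. P T \<or> Q T)"
proof (rule monoI)
  fix S T :: "'x set" assume "S \<le> T"
  then have "P S \<le> P T" "Q S \<le> Q T" using assms by (auto dest: monoD simp del: le_bool_def)
  then show "(P S \<or> Q S) \<le> (P T \<or> Q T)" by auto
qed

lemma mono_conj [simp]: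
  assumes "mono P" "mono Q"
  shows "mono (\<lambda>T :: 'x set. P T \<and> Q T)"
proof (rule monoI)
  fix S T :: "'x set" assume "S \<le> T"
  then have "P S \<le> P T" "Q S \<le> Q T" using assms by (auto dest: monoD simp del: le_bool_def)
  then show "(P S \<and> Q S) \<le> (P T \<and> Q T)" by auto
qed

lemma mono_const [simp]: "mono (\<lambda>T :: 'x set. c :: bool)"
  by (auto intro!: monoI)

lemma mono_meets [simp]: "mono (\<lambda>T. Z \<inter> T \<noteq> {})"
  by (intro monoI le_boolI) blast

text \<open>Adjoining a fresh variable is a splitting whose colon ideal is the unit ideal; it costs
  one.\<close>

lemma ideal_res_var:
  assumes "ideal_res TYPE('k::field) X n U" "z \<in> X" "mono U" "\<And>T. U (insert z T) \<Longrightarrow> U T"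
  shows "ideal_res TYPE('k) X (Suc n) (\<lambda>T. z \<in> T \<or> U T)"
  by (rule ideal_res_split[where v = z and D = U and C = "\<lambda>T. True"])
    (use assms in \<open>auto intro: ideal_res_True\<close>)

lemma ideal_res_vars:
  assumes "ideal_res TYPE('k::field) X n U" "set zs \<subseteq> X" "distinct zs" "mono U"
    "\<And>z T. z \<in> set zs \<Longrightarrow> U (insert z T) \<Longrightarrow> U T"
  shows "ideal_res TYPE('k) X (length zs + n) (\<lambda>T. set zs \<inter> T \<noteq> {} \<or> U T)"
  using assms(2,3,5)
proof (induction zs)
  case Nil
  then show ?case using assms(1) by simp
next
  case (Cons z zs)
  have m: "mono (\<lambda>T. set zs \<inter> T \<noteq> {} \<or> U T)" 
    by (intro mono_disj mono_meets assms(4))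
  have "ideal_res TYPE('k) X (Suc (length zs + n)) (\<lambda>T. z \<in> T \<or> (set zs \<inter> T \<noteq> {} \<or> U T))"
    by (rule ideal_res_var) (use Cons m in auto)
  moreover have "(\<lambda>T. z \<in> T \<or> (set zs \<inter> T \<noteq> {} \<or> U T)) = (\<lambda>T. set (z # zs) \<inter> T \<noteq> {} \<or> U T)" by auto
  ultimately show ?case by simp
qed

text \<open>A run consisting of one edge is split at its end vertex, a longer one at its second
  vertex. The colon ideal then consists of variables and a shorter path, and the flags removed match
  the recursion of \<open>kappa\<close>.\<close>

lemma ideal_res_path_sub:
  assumes "distinct vs" "set vs \<subseteq> X" "length vs = Suc (length ps)"
  shows "ideal_res TYPE('k::field) X (kappa ps) (path_sub vs ps)"
  using assms
proof (induction "length ps" arbitrary: ps vs rule: less_induct)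
  case less
  note IH = less(1)
  show ?case
  proof (cases ps rule: kappa.cases)
    case 1
    with less.prems obtain v where "vs = [v]" by (cases vs) auto
    then have "path_sub vs ps = (\<lambda>T. False)" by (simp add: fun_eq_iff 1)
    then show ?thesis by (simp add: ideal_res_False)
  next
    case (2 qs)
    with less.prems obtain v w us where vs: "vs = v # w # us" by (auto simp: length_Suc_conv)
    have "path_sub vs (False # qs) = path_sub (w # us) qs" by (simp add: vs fun_eq_iff)
    then show ?thesis using IH[of qs "w # us"] less.prems 2 vs by simp
  next
    case 3
    with less.prems obtain v w where vs: "vs = [v, w]" by (auto simp: length_Suc_conv)
    have "ideal_res TYPE('k) X (Suc 0) (path_sub vs ps)"
    proof (rule ideal_res_split[where v = v and D = "\<lambda>T. False" and C = "\<lambda>T. w \<in> T \<or> False"])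
      show "ideal_res TYPE('k) X (Suc 0) (\<lambda>T. w \<in> T \<or> False)"
        by (rule ideal_res_var) (use less.prems 3 vs in \<open>auto intro: ideal_res_False\<close>)
    qed (use less.prems 3 vs in \<open>auto intro: ideal_res_False\<close>)
    then show ?thesis using 3 by simp
  next
    case (4 qs)
    with less.prems obtain v w x us where vs: "vs = v # w # x # us" by (auto simp: length_Suc_conv)
    let ?P = "path_sub (x # us) qs"
    have P: "ideal_res TYPE('k) X (kappa qs) ?P" using IH[of qs "x # us"] less.prems 4 vs by simp
    have "ideal_res TYPE('k) X (Suc (kappa qs)) (path_sub vs ps)"
    proof (rule ideal_res_split[where v = v and D = ?P and C = "\<lambda>T. w \<in> T \<or> ?P T"])
      show "ideal_res TYPE('k) X (Suc (kappa qs)) (\<lambda>T. w \<in> T \<or> ?P T)"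
        by (rule ideal_res_var) (use less.prems 4 vs P in \<open>auto simp: path_sub_insert\<close>)
    qed (use less.prems 4 vs P in \<open>auto simp: path_sub_insert\<close>)
    then show ?thesis using 4 by simp
  next
    case 5
    with less.prems obtain v w x where vs: "vs = [v, w, x]" by (auto simp: length_Suc_conv)
    have "ideal_res TYPE('k) X (Suc (Suc 0)) (path_sub vs ps)"
    proof (rule ideal_res_split[where v = w and D = "\<lambda>T. False" and C = "\<lambda>T. v \<in> T \<or> x \<in> T \<or> False"])
      show "ideal_res TYPE('k) X (Suc (Suc 0)) (\<lambda>T. v \<in> T \<or> x \<in> T \<or> False)"
        by (intro ideal_res_var) (use less.prems 5 vs in \<open>auto intro: ideal_res_False\<close>)
    qed (use less.prems 5 vs in \<open>auto intro: ideal_res_False\<close>)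
    then show ?thesis using 5 by (simp add: numeral_2_eq_2)
  next
    \<comment> \<open>The colon at \<open>w\<close> contains \<open>v\<close> and \<open>x\<close>,
      and \<open>x\<close> absorbs the edge between \<open>x\<close> and \<open>z\<close> whatever
      \<open>b\<close> is. \<open>D\<close> loses only two flags, but \<open>kappa_Cons\<close>
      bounds the cost of the third by one.\<close>
    case (6 b qs)
    with less.prems obtain v w x z us where vs: "vs = v # w # x # z # us" by (auto simp: length_Suc_conv)
    let ?P = "path_sub (z # us) qs" and ?D = "path_sub (x # z # us) (b # qs)"
    have P: "ideal_res TYPE('k) X (kappa qs) ?P" using IH[of qs "z # us"] less.prems 6 vs by simp
    have "ideal_res TYPE('k) X (kappa (b # qs)) ?D"
      using IH[of "b # qs" "x # z # us"] less.prems 6 vs by simp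
    then have D: "ideal_res TYPE('k) X (Suc (kappa qs)) ?D"
      by (rule ideal_res_mono[rotated]) (simp add: kappa_Cons)
    have "ideal_res TYPE('k) X (Suc (Suc (kappa qs))) (path_sub vs ps)"
    proof (rule ideal_res_split[where v = w and D = ?D and C = "\<lambda>T. v \<in> T \<or> x \<in> T \<or> ?P T"])
      show "ideal_res TYPE('k) X (Suc (Suc (kappa qs))) (\<lambda>T. v \<in> T \<or> x \<in> T \<or> ?P T)"
        by (intro ideal_res_var) (use less.prems 6 vs P in \<open>auto simp: path_sub_insert\<close>)
      show "?D (insert w T) \<Longrightarrow> ?D T" for T
        using less.prems vs path_sub_insert[of w "x # z # us" "b # qs" T] by simp
    qed (use less.prems 6 vs D in \<open>auto simp: path_sub_insert\<close>)
    then show ?thesis using 6 by simp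
  qed
qed

text \<open>The crude bound from the splitting along \<open>y\<close>. The two numerical hypotheses
  are the demands of \<open>ideal_res_split\<close> on \<open>D\<close> and on
  \<open>C\<close>.\<close>

lemma ideal_res_path_gen_le:
  assumes "distinct vs" "set vs \<subseteq> X" "length vs = Suc (length bs)" "y \<in> X" "y \<notin> set vs"
    and "kap bs \<le> m" "length bs - length bs div 3 \<le> Suc m"
  shows "ideal_res TYPE('k::field) X (Suc m) (path_gen y vs bs)"
proof (rule ideal_res_split[where v = y and D = "path_sub vs (map Not bs)"
      and C = "path_sub vs (replicate (length bs) True)"])
  show "ideal_res TYPE('k) X m (path_sub vs (map Not bs))"
    by (rule ideal_res_mono[OF assms(6)]) (use assms in \<open>simp add: ideal_res_path_sub\<close>)
  show "ideal_res TYPE('k) X (Suc m) (path_sub vs (replicate (length bs) True))"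
    using ideal_res_path_sub[of vs X "replicate (length bs) True"] assms(1-3)
    by (intro ideal_res_mono[OF assms(7)]) (simp add: kappa_replicate)
qed (use assms in \<open>auto simp: path_sub_insert path_gen_iff path_sub_all\<close>)

text \<open>Serves the ideal \<open>D\<close> that keeps one flag more than \<open>C\<close>: it is
  either good again, so that the induction applies, or the extra flag is free and the crude bound
  suffices.\<close>

lemma good_pat_tail:
  assumes "two_pat bs \<or> one_pat bs \<or> zero_pat bs"
  shows "(two_pat (b # bs) \<or> one_pat (b # bs) \<or> zero_pat (b # bs)) \<or> kap (b # bs) = kap bs"
  using assms two_pat_kappa_True[of bs] one_pat_kappa_True[of bs] zero_pat_kappa_True[of bs]
  by (cases b) auto

lemma good_pat_kap:
  assumes "two_pat bs \<or> one_pat bs \<or> zero_pat bs"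
  shows "kap bs = length bs - length bs div 3"
  using assms two_pat_kap one_pat_kap zero_pat_kap by blast

text \<open>The empty first run: the generator at \<open>v0 v1\<close> is marked, so the colon at
  \<open>v1\<close> contains \<open>y v0\<close> instead of a variable. This colon ideal is split
  once more along \<open>y\<close>, into \<open>v2\<close> with the unmarked part and
  \<open>v0, v2\<close> with the whole path from \<open>v3\<close> on.\<close>

lemma ideal_res_path_gen_zero:
  assumes "distinct vs" "set vs \<subseteq> X" "length vs = Suc (length bs)" "y \<in> X" "y \<notin> set vs"
    and bs: "bs = True # False # False # cs" "two_pat (False # False # cs)"
    and IH: "\<And>us. distinct us \<Longrightarrow> set us \<subseteq> X \<Longrightarrow> length us = Suc (length (False # cs)) \<Longrightarrow> y \<notin> set us
      \<Longrightarrow> ideal_res TYPE('k::field) X (kap (False # cs)) (path_gen y us (False # cs))"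
  shows "ideal_res TYPE('k) X (kap bs) (path_gen y vs bs)"
proof -
  from assms(3) bs obtain v0 v1 v2 v3 us where vs: "vs = v0 # v1 # v2 # v3 # us"
    by (auto simp: length_Suc_conv)
  define n where "n = length cs"
  have k1: "kap (False # cs) = Suc n - Suc n div 3" "Suc n mod 3 = 1"
    using one_pat_kap[OF two_pat_tl[OF bs(2)]] by (simp_all add: n_def)
  have k2: "kap bs = n + 2 - (n + 2) div 3"
    using two_pat_kap[OF bs(2)] by (simp add: bs n_def)
  have "n mod 3 = 0" using k1(2) by presburger
  then obtain q where q: "n = 3 * q" by auto
  have d: "(n + 2) div 3 = q" "Suc n div 3 = q" "n div 3 = q" using q by presburger+
  have kb: "kap bs = 2 * q + 2" "kap (False # cs) = 2 * q + 1" using k1 k2 d q by simp_all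
  \<comment> \<open>\<open>cs\<close> is empty or \<open>b # ds\<close> with
    \<open>two_pat ds\<close>. A mark in front does not count, and an unmarked edge in front of a
    run of residue 2 is free.\<close>
  have kc: "kap cs \<le> 2 * q"
  proof (cases cs)
    case (Cons b ds)
    then have "two_pat ds" using bs(2) by simp
    then have "kap ds = length ds - length ds div 3" "length ds mod 3 = 2" using two_pat_kap[of ds] by simp_all
    moreover have l: "Suc (length ds) = 3 * q" using q by (simp add: n_def Cons)
    moreover from this have "length ds div 3 = q - 1" by presburger
    ultimately have "kap ds = 2 * q" by simp
    moreover have "kap cs = kap ds"
      using Cons \<open>two_pat ds\<close> two_pat_kappa_True[of ds] by (cases b) auto
    ultimately show ?thesis by simp
  qed simp
  let ?P = "path_gen y (v3 # us) cs" and ?D = "path_gen y (v2 # v3 # us) (False # cs)"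
  let ?S = "path_sub (v3 # us) (map Not cs)" and ?A = "path_sub (v3 # us) (replicate n True)"
  have len: "length (v3 # us) = Suc n" using assms(3) vs bs by (simp add: n_def)
  note vs' = assms(1,2,4,5)[unfolded vs]
  have S: "ideal_res TYPE('k) X (2 * q) ?S"
    by (rule ideal_res_mono[OF kc]) (use vs' len in \<open>simp add: ideal_res_path_sub n_def\<close>)
  have A: "ideal_res TYPE('k) X (2 * q) ?A"
    using ideal_res_path_sub[of "v3 # us" X "replicate n True"] vs' len d q by (simp add: kappa_replicate)
  have "ideal_res TYPE('k) X (Suc (2 * q + 1)) (\<lambda>T. y \<in> T \<and> v0 \<in> T \<or> v2 \<in> T \<or> ?P T)"
  proof (rule ideal_res_split[where v = y and D = "\<lambda>T. v2 \<in> T \<or> ?S T" and C = "\<lambda>T. v0 \<in> T \<or> v2 \<in> T \<or> ?A T"])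
    have "ideal_res TYPE('k) X (Suc (2 * q)) (\<lambda>T. v2 \<in> T \<or> ?S T)"
      by (intro ideal_res_var) (use vs' S in \<open>auto simp: path_sub_insert\<close>)
    then show "ideal_res TYPE('k) X (2 * q + 1) (\<lambda>T. v2 \<in> T \<or> ?S T)" by simp
    have "ideal_res TYPE('k) X (Suc (Suc (2 * q))) (\<lambda>T. v0 \<in> T \<or> v2 \<in> T \<or> ?A T)"
      by (intro ideal_res_var) (use vs' A in \<open>auto simp: path_sub_insert\<close>)
    then show "ideal_res TYPE('k) X (Suc (2 * q + 1)) (\<lambda>T. v0 \<in> T \<or> v2 \<in> T \<or> ?A T)" by simp
  qed (use vs' path_sub_all[of "v3 # us" cs] in \<open>auto simp: path_sub_insert path_gen_iff n_def\<close>)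
  note C = this
  have D: "ideal_res TYPE('k) X (2 * q + 1) ?D"
    using IH[of "v2 # v3 # us"] vs' len kb by (simp add: n_def)
  have "ideal_res TYPE('k) X (Suc (2 * q + 1)) (path_gen y vs bs)"
  proof (rule ideal_res_split[where v = v1 and D = ?D
        and C = "\<lambda>T. y \<in> T \<and> v0 \<in> T \<or> v2 \<in> T \<or> ?P T"])
    show "?D (insert v1 T) \<Longrightarrow> ?D T" for T
      using vs' path_gen_insert[of v1 "v2 # v3 # us" y "False # cs" T] by auto
  qed (use vs' C D bs in \<open>auto simp: path_gen_insert vs\<close>)
  then show ?thesis using kb by simp
qed

text \<open>The crude bound would exceed \<open>kap bs\<close> by one, as both parts of the
  splitting along \<open>y\<close> have this value. Splitting at the front of the path keeps
  \<open>y\<close> inside both parts.\<close>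

lemma ideal_res_path_gen_good:
  assumes "distinct vs" "set vs \<subseteq> X" "length vs = Suc (length bs)" "y \<in> X" "y \<notin> set vs"
    and "two_pat bs \<or> one_pat bs \<or> zero_pat bs"
  shows "ideal_res TYPE('k::field) X (kap bs) (path_gen y vs bs)"
  using assms(1-3,5,6)
proof (induction "length bs" arbitrary: bs vs rule: less_induct)
  case less
  note IH = less(1)
  consider "bs = []" | "bs = [False]" | "bs = [False, False]"
    | b cs where "bs = False # False # b # cs" "two_pat cs \<or> one_pat cs \<or> zero_pat cs"
    | cs where "bs = False # True # cs" "two_pat cs"
    | cs where "bs = True # cs" "two_pat cs"
    using less.prems(5)
    by (cases bs rule: two_pat.cases; cases bs rule: one_pat.cases; cases bs rule: zero_pat.cases) auto
  then show ?case
  proof cases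
    case 1
    then have "path_gen y vs bs = (\<lambda>T. False)" by (simp add: fun_eq_iff)
    then show ?thesis by (simp add: ideal_res_False)
  next
    case 2
    then obtain v w where "vs = [v, w]" using less.prems by (auto simp: length_Suc_conv)
    then have "path_gen y vs bs = path_sub vs (map Not bs)" by (simp add: fun_eq_iff 2)
    then show ?thesis using ideal_res_path_sub[of vs X "map Not bs"] less.prems by simp
  next
    case 3
    then obtain v w x where "vs = [v, w, x]" using less.prems by (auto simp: length_Suc_conv)
    then have "path_gen y vs bs = path_sub vs (map Not bs)" by (simp add: fun_eq_iff 3)
    then show ?thesis using ideal_res_path_sub[of vs X "map Not bs"] less.prems by simp
  next
    case (4 b cs)
    with less.prems obtain v0 v1 v2 v3 us where vs: "vs = v0 # v1 # v2 # v3 # us"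
      by (auto simp: length_Suc_conv)
    note vs' = less.prems(1,2,4)[unfolded vs]
    let ?P = "path_gen y (v3 # us) cs" and ?D = "path_gen y (v2 # v3 # us) (b # cs)"
    have P: "ideal_res TYPE('k) X (kap cs) ?P" using IH[of cs "v3 # us"] less.prems 4 vs by simp
    have D: "ideal_res TYPE('k) X (Suc (kap cs)) ?D"
    \<comment> \<open>\<open>D\<close> may use one more than \<open>kap cs\<close>. This is also
      what the crude bound gives if \<open>b\<close> leaves \<open>kap\<close> unchanged.\<close>
    proof (cases "two_pat (b # cs) \<or> one_pat (b # cs) \<or> zero_pat (b # cs)")
      case True
      have "kap (b # cs) \<le> Suc (kap cs)" by (simp add: kappa_Cons)
      then show ?thesis
        by (rule ideal_res_mono) (use IH[of "b # cs" "v2 # v3 # us"] less.prems 4 vs True in simp)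
    next
      case False
      then have "kap (b # cs) = kap cs" using good_pat_tail[OF 4(2)] by blast
      moreover have "length cs div 3 \<le> Suc (length cs) div 3" by (rule div_le_mono) simp
      ultimately show ?thesis
        by (intro ideal_res_path_gen_le)
          (use less.prems 4(1) vs assms(4) good_pat_kap[OF 4(2)] in auto)
    qed
    have "ideal_res TYPE('k) X (Suc (Suc (kap cs))) (path_gen y vs bs)"
    proof (rule ideal_res_split[where v = v1 and D = ?D and C = "\<lambda>T. v0 \<in> T \<or> v2 \<in> T \<or> ?P T"])
      show "ideal_res TYPE('k) X (Suc (Suc (kap cs))) (\<lambda>T. v0 \<in> T \<or> v2 \<in> T \<or> ?P T)"
        by (intro ideal_res_var) (use vs' P in \<open>auto simp: path_gen_insert\<close>)
      show "?D (insert v1 T) \<Longrightarrow> ?D T" for T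
        using vs' path_gen_insert[of v1 "v2 # v3 # us" y "b # cs" T] by auto
    qed (use vs' D 4(1) in \<open>auto simp: path_gen_insert vs\<close>)
    then show ?thesis using 4 by simp
  next
    \<comment> \<open>The first run has length one, and the split is at the end vertex
      \<open>v0\<close>. In the colon, \<open>v1\<close> absorbs the marked edge; in
      \<open>D\<close> the run becomes empty, giving a \<open>zero_pat\<close> with the same
      \<open>kap\<close> as \<open>cs\<close>.\<close>
    case (5 cs)
    with less.prems obtain v0 v1 v2 us where vs: "vs = v0 # v1 # v2 # us"
      by (auto simp: length_Suc_conv)
    note vs' = less.prems(1,2,4)[unfolded vs]
    let ?P = "path_gen y (v2 # us) cs" and ?D = "path_gen y (v1 # v2 # us) (True # cs)"
    have P: "ideal_res TYPE('k) X (kap cs) ?P" using IH[of cs "v2 # us"] less.prems 5 vs by simp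
    have D: "ideal_res TYPE('k) X (kap cs) ?D"
      using IH[of "True # cs" "v1 # v2 # us"] less.prems 5 vs by simp
    have "ideal_res TYPE('k) X (Suc (kap cs)) (path_gen y vs bs)"
    proof (rule ideal_res_split[where v = v0 and D = ?D and C = "\<lambda>T. v1 \<in> T \<or> ?P T"])
      show "ideal_res TYPE('k) X (Suc (kap cs)) (\<lambda>T. v1 \<in> T \<or> ?P T)"
        by (intro ideal_res_var) (use vs' P in \<open>auto simp: path_gen_insert\<close>)
      show "?D (insert v0 T) \<Longrightarrow> ?D T" for T
        using vs' path_gen_insert[of v0 "v1 # v2 # us" y "True # cs" T] by auto
    qed (use vs' D 5(1) in \<open>auto simp: path_gen_insert vs\<close>)
    then show ?thesis using 5 by simp
  next
    case (6 cs)
    then obtain ds where ds: "cs = False # False # ds" by (cases cs rule: two_pat.cases) auto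
    show ?thesis
    proof (rule ideal_res_path_gen_zero[of vs X bs y ds])
      show "ideal_res TYPE('k) X (kap (False # ds)) (path_gen y us (False # ds))"
        if "distinct us" "set us \<subseteq> X" "length us = Suc (length (False # ds))" "y \<notin> set us" for us
        using IH[of "False # ds" us] that two_pat_tl[of "False # ds"] 6 ds by simp
    qed (use less.prems assms(4) 6 ds in auto)
  qed
qed

section \<open>Path ideals: lower bounds\<close>

text \<open>Cut the path into triples of consecutive vertices. The middle ones form the socle
  monomial, the outer ones kill it: two killing variables for three vertices, one for a remaining
  pair, none for a remaining single vertex.\<close>

lemma path_dominating:
  assumes "distinct vs"
  shows "\<exists>\<sigma> zs. \<sigma> \<subseteq> set vs \<and> set zs \<subseteq> set vs \<and> distinct zs \<and>
    length zs = (length vs - 1) - (length vs - 1) div 3 \<and>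
    \<not> path_sub vs (replicate (length vs - 1) True) \<sigma> \<and>
    (\<forall>z\<in>set zs. path_sub vs (replicate (length vs - 1) True) (insert z \<sigma>))"
  using assms
proof (induction "length vs" arbitrary: vs rule: less_induct)
  case less
  consider "vs = []" | v where "vs = [v]" | v w where "vs = [v, w]"
    | v w x us where "vs = v # w # x # us"
    by (metis list.exhaust)
  then show ?case
  proof cases
    case 2
    then show ?thesis by (intro exI[of _ "{}"] exI[of _ "[]"]) simp
  next
    case 3
    then show ?thesis using less.prems by (intro exI[of _ "{w}"] exI[of _ "[v]"]) simp
  next
    case (4 v w x us)
    then obtain \<sigma> zs where *: "\<sigma> \<subseteq> set us" "set zs \<subseteq> set us" "distinct zs"
      "length zs = (length us - 1) - (length us - 1) div 3"
      "\<not> path_sub us (replicate (length us - 1) True) \<sigma>"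
      "\<forall>z\<in>set zs. path_sub us (replicate (length us - 1) True) (insert z \<sigma>)"
      using less.hyps[of us] less.prems by auto
    have split: "path_sub vs (replicate (length vs - 1) True) T \<longleftrightarrow>
        v \<in> T \<and> w \<in> T \<or> w \<in> T \<and> x \<in> T \<or> us \<noteq> [] \<and> x \<in> T \<and> hd us \<in> T \<or>
        path_sub us (replicate (length us - 1) True) T" for T
      by (cases us) (auto simp: 4)
    have ins: "path_sub us ps (insert w T) = path_sub us ps T" for ps T
      using less.prems 4 by (intro path_sub_insert) simp
    have "length (v # x # zs) = (length vs - 1) - (length vs - 1) div 3"
      using *(4) by (cases us) (auto simp: 4)
    moreover have "\<not> path_sub vs (replicate (length vs - 1) True) (insert w \<sigma>)"
      unfolding split using less.prems * 4 ins by auto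
    moreover have "path_sub vs (replicate (length vs - 1) True) (insert z (insert w \<sigma>))"
      if "z \<in> set (v # x # zs)" for z
      unfolding split using *(6) that ins[of _ "insert z \<sigma>"] by (auto simp: insert_commute)
    ultimately show ?thesis
      using less.prems * 4 by (intro exI[of _ "insert w \<sigma>"] exI[of _ "v # x # zs"]) auto
  qed simp_all
qed

lemma pd_ge_path_sub:
  assumes "distinct vs" "set vs \<subseteq> X" "length vs = Suc n"
  shows "pd_ge TYPE('k::field) X (n - n div 3) (path_sub vs (replicate n True))"
proof -
  obtain \<sigma> zs where *: "\<sigma> \<subseteq> set vs" "set zs \<subseteq> set vs" "distinct zs" "length zs = n - n div 3"
    "\<not> path_sub vs (replicate n True) \<sigma>" "\<forall>z\<in>set zs. path_sub vs (replicate n True) (insert z \<sigma>)"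
    using path_dominating[OF assms(1)] assms(3) by auto
  then have "pd_ge TYPE('k) X (length zs) (path_sub vs (replicate n True))"
    using assms by (intro pd_ge_socle[of zs X \<sigma>]) (auto intro: finite_subset[of \<sigma>])
  then show ?thesis using * by simp
qed

text \<open>With \<open>y\<close> in the socle monomial, marked edges behave like unmarked ones, and
  the selection for the full path works.\<close>

lemma pd_ge_path_gen:
  assumes "distinct vs" "set vs \<subseteq> X" "length vs = Suc (length bs)" "y \<in> X" "y \<notin> set vs"
  shows "pd_ge TYPE('k::field) X (length bs - length bs div 3) (path_gen y vs bs)"
proof -
  let ?A = "path_sub vs (replicate (length bs) True)"
  obtain \<sigma> zs where *: "\<sigma> \<subseteq> set vs" "set zs \<subseteq> set vs" "distinct zs"
    "length zs = length bs - length bs div 3" "\<not> ?A \<sigma>" "\<forall>z\<in>set zs. ?A (insert z \<sigma>)"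
    using path_dominating[OF assms(1)] assms(3) by auto
  have y: "path_gen y vs bs (insert y T) = ?A T" for T
    using path_sub_insert[OF assms(5)] path_sub_all[of vs bs T] by (auto simp: path_gen_iff)
  have "pd_ge TYPE('k) X (length zs) (path_gen y vs bs)"
    using assms * by (intro pd_ge_socle[of zs X "insert y \<sigma>"])
      (auto intro: finite_subset[of \<sigma>] simp: y insert_commute[of _ y])
  then show ?thesis using * by simp
qed

text \<open>The same triples, but with \<open>y\<close> outside the monomial: the flags
  \<open>False, False\<close> make both edges at each middle vertex unmarked. So \<open>y\<close>
  stays available as a further killing variable in \<open>pd_ge_special\<close>.\<close>

lemma two_pat_dominating:
  assumes "two_pat bs" "distinct vs" "length vs = Suc (length bs)" "y \<notin> set vs"
  shows "\<exists>\<sigma> zs. \<sigma> \<subseteq> set vs \<and> set zs \<subseteq> set vs \<and> distinct zs \<and> length zs = kap bs \<and>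
    \<not> path_gen y vs bs \<sigma> \<and> (\<forall>z\<in>set zs. path_gen y vs bs (insert z \<sigma>))"
  using assms
proof (induction bs arbitrary: vs rule: two_pat.induct)
  case 1
  then obtain v w x where "vs = [v, w, x]" by (auto simp: length_Suc_conv)
  then show ?case using 1 by (intro exI[of _ "{w}"] exI[of _ "[v, x]"]) (auto simp: numeral_2_eq_2)
next
  case (2 b bs)
  then obtain v w x u us where vs: "vs = v # w # x # u # us" by (auto simp: length_Suc_conv)
  have "two_pat bs" "distinct (u # us)" "length (u # us) = Suc (length bs)" "y \<notin> set (u # us)"
    using "2.prems" vs by auto
  from "2.IH"[OF this] obtain \<sigma> zs where *: "\<sigma> \<subseteq> set (u # us)" "set zs \<subseteq> set (u # us)" "distinct zs"
    "length zs = kap bs" "\<not> path_gen y (u # us) bs \<sigma>" "\<forall>z\<in>set zs. path_gen y (u # us) bs (insert z \<sigma>)"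
    by blast
  have ins: "path_gen y (u # us) bs (insert w T) = path_gen y (u # us) bs T" for T
    using "2.prems" vs by (intro path_gen_insert) auto
  have "\<not> path_gen y vs (False # False # b # bs) (insert w \<sigma>)"
    using "2.prems" * ins by (auto simp: vs)
  moreover have "path_gen y vs (False # False # b # bs) (insert z (insert w \<sigma>))"
    if "z \<in> set (v # x # zs)" for z
    using *(6) that ins[of "insert z \<sigma>"] by (auto simp: vs insert_commute)
  ultimately show ?case
    using "2.prems" * by (intro exI[of _ "insert w \<sigma>"] exI[of _ "v # x # zs"]) (auto simp: vs)
qed auto

text \<open>Bounds \<open>(I, u, f)\<close> without the variable \<open>u\<close> in the second
  reduction, with \<open>f = y v1 v5\<close>. It is split along \<open>y\<close>; the part
  \<open>C\<close> is then split along \<open>v1\<close>, whose colon contains \<open>v5\<close>,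
  which absorbs the first two edges of the path from \<open>v4\<close> on.\<close>

lemma ideal_res_merge_bound:
  assumes "distinct (y # v0 # v1 # v2 # v4 # v5 # us)" "insert y (set (v0 # v1 # v2 # v4 # v5 # us)) \<subseteq> X"
    and ds: "one_pat ds" "length us = length ds"
  shows "ideal_res TYPE('k::field) X (kap ds + 3)
    (\<lambda>T. v0 \<in> T \<and> v1 \<in> T \<or> y \<in> T \<and> v1 \<in> T \<and> v2 \<in> T \<or> y \<in> T \<and> v1 \<in> T \<and> v5 \<in> T \<or>
      path_gen y (v4 # v5 # us) (b # ds) T)"
proof -
  define n where "n = length ds"
  have k: "kap ds = n - n div 3" "n mod 3 = 1" using one_pat_kap[OF ds(1)] by (simp_all add: n_def)
  obtain m where m: "n = Suc m" using k(2) by (cases n) auto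
  obtain u us' where us: "us = u # us'" using ds(2) m by (cases us) (auto simp: n_def)
  obtain q where q: "n = 3 * q + 1" using k(2) by (metis mult.commute mod_mult_div_eq add.commute)
  then have d: "n div 3 = q" "Suc n div 3 = q" "m div 3 = q" "m = 3 * q" using m by presburger+
  have le: "Suc n - Suc n div 3 \<le> Suc (Suc (kap ds))" "m - m div 3 \<le> kap ds"
    using q k(1) unfolding d by simp_all
  let ?S = "path_sub (v4 # v5 # us) (map Not (b # ds))"
  let ?A = "path_sub (v4 # v5 # us) (replicate (Suc n) True)" and ?B = "path_sub us (replicate m True)"
  note vs = assms(1,2)
  have len: "length (v4 # v5 # us) = Suc (Suc n)" "length us = Suc m" using ds(2) m by (simp_all add: n_def)
  have "ideal_res TYPE('k) X (kap (b # ds)) ?S"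
    by (rule ideal_res_path_sub) (use vs len in \<open>auto simp: n_def\<close>)
  then have S: "ideal_res TYPE('k) X (Suc (kap ds)) ?S"
    by (rule ideal_res_mono[rotated]) (simp add: kappa_Cons)
  have "ideal_res TYPE('k) X (kappa (replicate (Suc n) True)) ?A"
    by (rule ideal_res_path_sub) (use vs len in auto)
  then have A: "ideal_res TYPE('k) X (Suc (Suc (kap ds))) ?A"
    by (rule ideal_res_mono[rotated]) (use le in \<open>simp only: kappa_replicate\<close>)
  have "ideal_res TYPE('k) X (kappa (replicate m True)) ?B"
    by (rule ideal_res_path_sub) (use vs len in auto)
  then have B: "ideal_res TYPE('k) X (kap ds) ?B"
    by (rule ideal_res_mono[rotated]) (use le in \<open>simp only: kappa_replicate\<close>)
  have insA: "?A (insert v T) \<Longrightarrow> ?A T" and insS: "?S (insert v T) \<Longrightarrow> ?S T"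
    if "v \<in> {v0, v1, v2, y}" for v T
  proof -
    have nv: "v \<notin> set (v4 # v5 # us)" using vs that by auto
    show "?A (insert v T) \<Longrightarrow> ?A T" "?S (insert v T) \<Longrightarrow> ?S T"
      by (simp_all only: path_sub_insert[OF nv])
  qed
  have insB: "?B (insert v T) \<Longrightarrow> ?B T" if "v \<in> {v0, v1, v2, v5, y}" for v T
  proof -
    have nv: "v \<notin> set us" using vs that by auto
    show "?B (insert v T) \<Longrightarrow> ?B T" by (simp only: path_sub_insert[OF nv])
  qed
  have SA: "?S T \<Longrightarrow> ?A T" for T using path_sub_all[of "v4 # v5 # us" "b # ds" T] by (simp add: n_def)
  have AB: "?A T \<Longrightarrow> v5 \<in> T \<or> ?B T" for T by (auto simp: us m)
  have D: "ideal_res TYPE('k) X (Suc (Suc (kap ds))) (\<lambda>T. v0 \<in> T \<and> v1 \<in> T \<or> ?S T)"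
  proof (rule ideal_res_split[where v = v0 and D = ?S and C = "\<lambda>T. v1 \<in> T \<or> ?S T"])
    show "ideal_res TYPE('k) X (Suc (Suc (kap ds))) (\<lambda>T. v1 \<in> T \<or> ?S T)"
      by (rule ideal_res_var[OF S]) (use vs insS in auto)
    show "ideal_res TYPE('k) X (Suc (kap ds)) ?S" by (rule S)
  qed (use vs insS in \<open>auto simp del: path_sub.simps\<close>)
  have C: "ideal_res TYPE('k) X (Suc (Suc (Suc (kap ds))))
    (\<lambda>T. v0 \<in> T \<and> v1 \<in> T \<or> v1 \<in> T \<and> v2 \<in> T \<or> v1 \<in> T \<and> v5 \<in> T \<or> ?A T)"
  proof (rule ideal_res_split[where v = v1 and D = ?A and C = "\<lambda>T. v0 \<in> T \<or> v2 \<in> T \<or> v5 \<in> T \<or> ?B T"])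
    show "ideal_res TYPE('k) X (Suc (Suc (Suc (kap ds)))) (\<lambda>T. v0 \<in> T \<or> v2 \<in> T \<or> v5 \<in> T \<or> ?B T)"
      by (intro ideal_res_var B) (use vs insB in auto)
    show "v0 \<in> T \<and> v1 \<in> T \<or> v1 \<in> T \<and> v2 \<in> T \<or> v1 \<in> T \<and> v5 \<in> T \<or> ?A T \<longleftrightarrow>
      ?A T \<or> v1 \<in> T \<and> (v0 \<in> T \<or> v2 \<in> T \<or> v5 \<in> T \<or> ?B T)" for T
      by (auto simp: us m)
    show "ideal_res TYPE('k) X (Suc (Suc (kap ds))) ?A" by (rule A)
    show "v0 \<in> T \<or> v2 \<in> T \<or> v5 \<in> T \<or> ?B T" if "?A T" for T using AB[OF that] by blast
    show "?A (insert v1 T) \<Longrightarrow> ?A T" for T by (erule insA[rotated]) simp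
    show "v0 \<in> T \<or> v2 \<in> T \<or> v5 \<in> T \<or> ?B T"
      if "v0 \<in> insert v1 T \<or> v2 \<in> insert v1 T \<or> v5 \<in> insert v1 T \<or> ?B (insert v1 T)" for T
      using that insB[of v1 T] vs by auto
  qed (use vs in auto)
  have "ideal_res TYPE('k) X (Suc (Suc (Suc (kap ds))))
    (\<lambda>T. v0 \<in> T \<and> v1 \<in> T \<or> y \<in> T \<and> v1 \<in> T \<and> v2 \<in> T \<or> y \<in> T \<and> v1 \<in> T \<and> v5 \<in> T \<or>
      path_gen y (v4 # v5 # us) (b # ds) T)"
  proof (rule ideal_res_split[where v = y and D = "\<lambda>T. v0 \<in> T \<and> v1 \<in> T \<or> ?S T"
        and C = "\<lambda>T. v0 \<in> T \<and> v1 \<in> T \<or> v1 \<in> T \<and> v2 \<in> T \<or> v1 \<in> T \<and> v5 \<in> T \<or> ?A T"])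
    show "(v0 \<in> T \<and> v1 \<in> T \<or> y \<in> T \<and> v1 \<in> T \<and> v2 \<in> T \<or> y \<in> T \<and> v1 \<in> T \<and> v5 \<in> T \<or>
      path_gen y (v4 # v5 # us) (b # ds) T) \<longleftrightarrow> (v0 \<in> T \<and> v1 \<in> T \<or> ?S T) \<or>
      y \<in> T \<and> (v0 \<in> T \<and> v1 \<in> T \<or> v1 \<in> T \<and> v2 \<in> T \<or> v1 \<in> T \<and> v5 \<in> T \<or> ?A T)" for T
      unfolding path_gen_iff by (auto simp: n_def simp del: path_sub.simps)
    show "v0 \<in> T \<and> v1 \<in> T \<or> v1 \<in> T \<and> v2 \<in> T \<or> v1 \<in> T \<and> v5 \<in> T \<or> ?A T" if "v0 \<in> T \<and> v1 \<in> T \<or> ?S T" for T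
      using that SA[of T] by blast
    show "v0 \<in> T \<and> v1 \<in> T \<or> ?S T" if "v0 \<in> insert y T \<and> v1 \<in> insert y T \<or> ?S (insert y T)" for T
      using that insS[of y T] vs by auto
    show "v0 \<in> T \<and> v1 \<in> T \<or> v1 \<in> T \<and> v2 \<in> T \<or> v1 \<in> T \<and> v5 \<in> T \<or> ?A T"
      if "v0 \<in> insert y T \<and> v1 \<in> insert y T \<or> v1 \<in> insert y T \<and> v2 \<in> insert y T \<or>
        v1 \<in> insert y T \<and> v5 \<in> insert y T \<or> ?A (insert y T)" for T
      using that insA[of y T] vs by auto
  qed (use vs C D in auto)
  then show ?thesis by (simp add: numeral_3_eq_3)
qed

text \<open>Both reductions delete three consecutive vertices of the path around some \<open>u\<close>, writing the ideal as
  \<open>I = (I : u) \<inter> (I, u, f)\<close>. In the first one \<open>f\<close> is absent. In the second one \<open>f\<close> is the marked edge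
  between the two vertices that become neighbours.\<close>

lemma pd_ge_special:
  assumes "special_pat bs" "distinct (y # zs @ vs)" "insert y (set zs \<union> set vs) \<subseteq> X"
    "length vs = Suc (length bs)"
  shows "pd_ge TYPE('k::field) X (length zs + Suc (kap bs)) (\<lambda>T. set zs \<inter> T \<noteq> {} \<or> path_gen y vs bs T)"
  using assms
proof (induction "length bs" arbitrary: bs vs zs rule: less_induct)
  case less
  consider b cs where "bs = False # False # b # cs" "special_pat cs"
    | "bs = [False, True, False]"
    | cs where "bs = False # True # False # True # cs" "two_pat cs"
    | b ds where "bs = False # True # False # False # b # ds" "one_pat ds"
    using less.prems(1)
    by (cases bs rule: special_pat.cases; cases "tl (tl bs)" rule: one_pat.cases) auto
  then show ?case
  proof cases
    \<comment> \<open>Here \<open>u = v1\<close>. The colon ideal is generated by \<open>v0\<close>,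
      \<open>v2\<close> and the path from \<open>v3\<close> on; the sum of both ideals contains all
      of \<open>v0, v1, v2\<close>. Deleted vertices move into \<open>zs\<close>, so the polynomial
      ring stays the same.\<close>
    case (1 b cs)
    with less.prems obtain v0 v1 v2 v3 us where vs: "vs = v0 # v1 # v2 # v3 # us"
      by (auto simp: length_Suc_conv)
    note p = less.prems(2-4)[unfolded vs 1]
    let ?n = "length zs + Suc (kap bs)" and ?P = "path_gen y (v3 # us) cs"
    let ?D = "path_gen y (v2 # v3 # us) (b # cs)"
    have kcs: "kap cs = length cs - length cs div 3" using special_pat_kap[OF 1(2)] by simp
    have le: "length cs div 3 \<le> Suc (length cs) div 3" by (rule div_le_mono) simp
    have P: "ideal_res TYPE('k) X (Suc (kap cs)) ?P"
      by (rule ideal_res_path_gen_le) (use p kcs in auto)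
    have D: "ideal_res TYPE('k) X (Suc (Suc (kap cs))) ?D"
      by (rule ideal_res_path_gen_le) (use p kcs le kappa_Cons[of "map Not cs" "\<not> b"] in auto)
    show ?thesis
    proof (rule pd_ge_inter[where ?U1.0 = "\<lambda>T. set (v0 # v2 # zs) \<inter> T \<noteq> {} \<or> ?P T"
          and ?U2.0 = "\<lambda>T. set (v1 # zs) \<inter> T \<noteq> {} \<or> ?D T"])
      have "pd_ge TYPE('k) X (length (v0 # v1 # v2 # zs) + Suc (kap cs))
          (\<lambda>T. set (v0 # v1 # v2 # zs) \<inter> T \<noteq> {} \<or> ?P T)"
        by (rule less.hyps) (use 1 p in auto)
      moreover have "(\<lambda>T. set (v0 # v1 # v2 # zs) \<inter> T \<noteq> {} \<or> ?P T) =
        (\<lambda>T. (set (v0 # v2 # zs) \<inter> T \<noteq> {} \<or> ?P T) \<or> (set (v1 # zs) \<inter> T \<noteq> {} \<or> ?D T))"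
        by (auto simp: fun_eq_iff)
      ultimately show "pd_ge TYPE('k) X (Suc ?n)
          (\<lambda>T. (set (v0 # v2 # zs) \<inter> T \<noteq> {} \<or> ?P T) \<or> (set (v1 # zs) \<inter> T \<noteq> {} \<or> ?D T))"
        by (simp add: 1)
      have "ideal_res TYPE('k) X (length (v0 # v2 # zs) + Suc (kap cs))
          (\<lambda>T. set (v0 # v2 # zs) \<inter> T \<noteq> {} \<or> ?P T)"
      proof (rule ideal_res_vars[OF P])
        show "?P T" if "z \<in> set (v0 # v2 # zs)" "?P (insert z T)" for z T
          using that p path_gen_insert[of z "v3 # us" y cs T] by auto
      qed (use p in auto)
      then show "ideal_res TYPE('k) X ?n (\<lambda>T. set (v0 # v2 # zs) \<inter> T \<noteq> {} \<or> ?P T)" by (simp add: 1)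
      have "ideal_res TYPE('k) X (length (v1 # zs) + Suc (Suc (kap cs)))
          (\<lambda>T. set (v1 # zs) \<inter> T \<noteq> {} \<or> ?D T)"
      proof (rule ideal_res_vars[OF D])
        show "?D T" if "z \<in> set (v1 # zs)" "?D (insert z T)" for z T
          using that p path_gen_insert[of z "v2 # v3 # us" y "b # cs" T] by auto
      qed (use p in auto)
      then show "ideal_res TYPE('k) X ?n (\<lambda>T. set (v1 # zs) \<inter> T \<noteq> {} \<or> ?D T)" by (simp add: 1)
      show "mono (\<lambda>T. set (v0 # v2 # zs) \<inter> T \<noteq> {} \<or> ?P T)" "mono (\<lambda>T. set (v1 # zs) \<inter> T \<noteq> {} \<or> ?D T)"
        by (intro mono_disj mono_meets mono_path_gen)+
    qed (auto simp: vs 1)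
  next
    \<comment> \<open>The support \<open>v1, v2\<close> of the marked edge lacks only
      \<open>y\<close>. So \<open>y\<close> kills the monomial besides \<open>v0\<close> and
      \<open>v3\<close>, one variable more than \<open>kap bs = 2\<close>.\<close>
    case 2
    with less.prems obtain v0 v1 v2 v3 where vs: "vs = [v0, v1, v2, v3]"
      by (auto simp: length_Suc_conv)
    note p = less.prems(2-4)[unfolded vs 2]
    have "pd_ge TYPE('k) X (length (y # v0 # v3 # zs)) (\<lambda>T. set zs \<inter> T \<noteq> {} \<or> path_gen y vs bs T)"
      by (rule pd_ge_socle[where \<sigma> = "{v1, v2}"]) (use p in \<open>auto simp: vs 2\<close>)
    then show ?thesis by (simp add: 2)
  next
    \<comment> \<open>The two runs of residue 1 have come together at the front. The base monomial
      \<open>v1 v2\<close> is multiplied by a \<open>y\<close>-free socle monomial of the rest, so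
      that \<open>y\<close> is still a killing variable.\<close>
    case (3 cs)
    with less.prems obtain v0 v1 v2 v3 v4 us where vs: "vs = v0 # v1 # v2 # v3 # v4 # us"
      by (auto simp: length_Suc_conv)
    note p = less.prems(2-4)[unfolded vs 3]
    obtain \<sigma> ws where *: "\<sigma> \<subseteq> set (v4 # us)" "set ws \<subseteq> set (v4 # us)" "distinct ws" "length ws = kap cs"
      "\<not> path_gen y (v4 # us) cs \<sigma>" "\<forall>z\<in>set ws. path_gen y (v4 # us) cs (insert z \<sigma>)"
      using two_pat_dominating[OF 3(2), of "v4 # us" y] p by auto
    have ins: "path_gen y (v4 # us) cs (insert v1 (insert v2 T)) = path_gen y (v4 # us) cs T" for T
    proof -
      have nv: "v1 \<notin> set (v4 # us)" "v2 \<notin> set (v4 # us)" "v1 \<noteq> y" "v2 \<noteq> y" using p by auto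
      show ?thesis by (simp only: path_gen_insert[OF nv(1,3)] path_gen_insert[OF nv(2,4)])
    qed
    have "pd_ge TYPE('k) X (length (y # v0 # v3 # zs @ ws)) (\<lambda>T. set zs \<inter> T \<noteq> {} \<or> path_gen y vs bs T)"
    proof (rule pd_ge_socle[where \<sigma> = "insert v1 (insert v2 \<sigma>)"])
      show "finite (insert v1 (insert v2 \<sigma>))" using *(1) by (auto intro: finite_subset)
      show "\<not> (set zs \<inter> insert v1 (insert v2 \<sigma>) \<noteq> {} \<or> path_gen y vs bs (insert v1 (insert v2 \<sigma>)))"
        using p *(1,5) ins[of \<sigma>] by (auto simp: vs 3)
      fix z assume z: "z \<in> set (y # v0 # v3 # zs @ ws)"
      have "path_gen y (v4 # us) cs (insert z (insert v1 (insert v2 \<sigma>)))" if "z \<in> set ws"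
        using *(6) that ins[of "insert z \<sigma>"] by (simp add: insert_commute)
      then show "set zs \<inter> insert z (insert v1 (insert v2 \<sigma>)) \<noteq> {} \<or>
          path_gen y vs bs (insert z (insert v1 (insert v2 \<sigma>)))"
        using z by (auto simp: vs 3)
    qed (use p * in auto)
    then show ?thesis using *(4) by (simp add: 3)
  next
    \<comment> \<open>Here \<open>u = v3\<close> and \<open>f = y v1 v5\<close>. Multiplying
      \<open>f\<close> by the colon generators \<open>v2\<close> and \<open>v4\<close> gives
      elements of \<open>I\<close>, so adding \<open>f\<close> does not enlarge the intersection. In
      the sum, \<open>f\<close> is the marked edge joining \<open>v1\<close> to \<open>v5\<close>,
      and the pattern stays special.\<close>
    case (4 b ds)
    with less.prems obtain v0 v1 v2 v3 v4 v5 us where vs: "vs = v0 # v1 # v2 # v3 # v4 # v5 # us"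
      by (auto simp: length_Suc_conv)
    note p = less.prems(2-4)[unfolded vs 4]
    let ?n = "length zs + Suc (kap bs)" and ?P = "path_gen y (v5 # us) ds"
    let ?E = "\<lambda>T. v0 \<in> T \<and> v1 \<in> T \<or> ?P T"
    let ?Q = "\<lambda>T. v0 \<in> T \<and> v1 \<in> T \<or> y \<in> T \<and> v1 \<in> T \<and> v2 \<in> T \<or> y \<in> T \<and> v1 \<in> T \<and> v5 \<in> T \<or>
      path_gen y (v4 # v5 # us) (b # ds) T"
    have kds: "kap ds = length ds - length ds div 3" using one_pat_kap[OF 4(2)] by simp
    have P: "ideal_res TYPE('k) X (Suc (kap ds)) ?P"
      by (rule ideal_res_path_gen_le) (use p kds in auto)
    have E: "ideal_res TYPE('k) X (Suc (Suc (kap ds))) ?E"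
    proof (rule ideal_res_split[where v = v0 and D = ?P and C = "\<lambda>T. v1 \<in> T \<or> ?P T"])
      show "ideal_res TYPE('k) X (Suc (Suc (kap ds))) (\<lambda>T. v1 \<in> T \<or> ?P T)"
        by (rule ideal_res_var[OF P]) (use p in \<open>auto simp: path_gen_insert\<close>)
    qed (use p P in \<open>auto simp: path_gen_insert\<close>)
    have Q: "ideal_res TYPE('k) X (kap ds + 3) ?Q"
      by (rule ideal_res_merge_bound) (use p 4(2) in auto)
    have monoE: "mono ?E" by (intro mono_disj mono_conj mono_mem mono_path_gen)
    have monoQ: "mono ?Q" by (intro mono_disj mono_conj mono_mem mono_path_gen)
    show ?thesis
    proof (rule pd_ge_inter[where ?U1.0 = "\<lambda>T. set (v2 # v4 # zs) \<inter> T \<noteq> {} \<or> ?E T"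
          and ?U2.0 = "\<lambda>T. set (v3 # zs) \<inter> T \<noteq> {} \<or> ?Q T"])
      have "pd_ge TYPE('k) X (length (v2 # v3 # v4 # zs) + Suc (kap (False # True # ds)))
          (\<lambda>T. set (v2 # v3 # v4 # zs) \<inter> T \<noteq> {} \<or> path_gen y (v0 # v1 # v5 # us) (False # True # ds) T)"
        by (rule less.hyps) (use 4 p in auto)
      moreover have "(\<lambda>T. set (v2 # v3 # v4 # zs) \<inter> T \<noteq> {} \<or> path_gen y (v0 # v1 # v5 # us) (False # True # ds) T) =
        (\<lambda>T. (set (v2 # v4 # zs) \<inter> T \<noteq> {} \<or> ?E T) \<or> (set (v3 # zs) \<inter> T \<noteq> {} \<or> ?Q T))"
        by (auto simp: fun_eq_iff)
      ultimately show "pd_ge TYPE('k) X (Suc ?n)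
          (\<lambda>T. (set (v2 # v4 # zs) \<inter> T \<noteq> {} \<or> ?E T) \<or> (set (v3 # zs) \<inter> T \<noteq> {} \<or> ?Q T))"
        by (simp add: 4)
      have "ideal_res TYPE('k) X (length (v2 # v4 # zs) + Suc (Suc (kap ds)))
          (\<lambda>T. set (v2 # v4 # zs) \<inter> T \<noteq> {} \<or> ?E T)"
      proof (rule ideal_res_vars[OF E _ _ monoE])
        show "?E T" if "z \<in> set (v2 # v4 # zs)" "?E (insert z T)" for z T
          using that p path_gen_insert[of z "v5 # us" y ds T] by auto
      qed (use p in auto)
      then show "ideal_res TYPE('k) X ?n (\<lambda>T. set (v2 # v4 # zs) \<inter> T \<noteq> {} \<or> ?E T)" by (simp add: 4)
      have n: "length (v3 # zs) + (kap ds + 3) = ?n" by (simp add: 4)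
      have "ideal_res TYPE('k) X (length (v3 # zs) + (kap ds + 3))
          (\<lambda>T. set (v3 # zs) \<inter> T \<noteq> {} \<or> ?Q T)"
      proof (rule ideal_res_vars[OF Q _ _ monoQ])
        show "?Q T" if "z \<in> set (v3 # zs)" "?Q (insert z T)" for z T
          using that p path_gen_insert[of z "v4 # v5 # us" y "b # ds" T] by auto
      qed (use p in auto)
      then show "ideal_res TYPE('k) X ?n (\<lambda>T. set (v3 # zs) \<inter> T \<noteq> {} \<or> ?Q T)" unfolding n .
      show "mono (\<lambda>T. set (v2 # v4 # zs) \<inter> T \<noteq> {} \<or> ?E T)" by (intro mono_disj mono_meets monoE)
      show "mono (\<lambda>T. set (v3 # zs) \<inter> T \<noteq> {} \<or> ?Q T)" by (intro mono_disj mono_meets monoQ)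
    qed (auto simp: vs 4)
  qed
qed

section \<open>Strings with one additional edge\<close>

lemma prod_var:
  "finite A \<Longrightarrow> (\<Prod>E\<in>A. var E) = (single (\<Sum>E\<in>A. single E 1) 1 :: ('x, 'k::field) mpoly)"
  by (induction A rule: finite_induct) (simp_all add: var_def mult_single)

lemma lookup_sum_single:
  "finite A \<Longrightarrow> Poly_Mapping.lookup (\<Sum>E\<in>A. single E (1::nat)) x = (if x \<in> A then 1 else 0)"
  by (simp add: lookup_sum lookup_single when_def)

text \<open>All exponents of the generators are 0 or 1, so divisibility by a generator is
  containment of supports.\<close>

lemma hypergraph_ideal_eq:
  fixes H :: "'v set set"
  assumes "finite H"
  shows "(hypergraph_ideal H :: ('v set, 'k::field) mpoly set) =
    mono_ideal H (\<lambda>T. \<exists>v\<in>\<Union>H. {E \<in> H. v \<in> E} \<subseteq> T)"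
proof -
  let ?R = "poly_ring H :: ('v set, 'k) mpoly ring"
  let ?U = "\<lambda>T. \<exists>v\<in>\<Union>H. {E \<in> H. v \<in> E} \<subseteq> T"
  let ?G = "vertex_monomial H ` \<Union>H :: ('v set, 'k) mpoly set"
  define m where "m v = (\<Sum>E\<in>{E \<in> H. v \<in> E}. single E (1::nat))" for v
  have vm: "vertex_monomial H v = (single (m v) 1 :: ('v set, 'k) mpoly)" for v
    using assms by (simp add: vertex_monomial_def prod_var m_def)
  have lm: "Poly_Mapping.lookup (m v) E = (if E \<in> H \<and> v \<in> E then 1 else 0)" for v E
    unfolding m_def using assms by (subst lookup_sum_single) auto
  have km: "keys (m v) = {E \<in> H. v \<in> E}" for v by (auto simp: in_keys_iff lm split: if_splits)
  have mono: "mono ?U" by (intro monoI le_boolI) blast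
  interpret R: cring ?R by (rule cring_poly_ring)
  interpret I: ideal "hypergraph_ideal H" ?R by (rule ideal_hypergraph_ideal)
  show ?thesis
  proof
    have "?G \<subseteq> mono_ideal H ?U"
      by (auto simp: mono_ideal_def poly_carrier_def vm km) blast
    then show "hypergraph_ideal H \<subseteq> (mono_ideal H ?U :: ('v set, 'k) mpoly set)"
      unfolding hypergraph_ideal_def by (rule R.genideal_minimal[OF ideal_mono_ideal[OF mono]])
  next
    show "mono_ideal H ?U \<subseteq> (hypergraph_ideal H :: ('v set, 'k) mpoly set)"
    proof
      fix p :: "('v set, 'k) mpoly"
      assume p: "p \<in> mono_ideal H ?U"
      have monom: "single k c \<in> hypergraph_ideal H"
        if k: "k \<in> keys p" for k and c :: 'k
      proof -
        obtain v where v: "v \<in> \<Union>H" "{E \<in> H. v \<in> E} \<subseteq> keys k"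
          using p k unfolding mono_ideal_def by blast
        \<comment> \<open>Subtraction of exponents is truncated; the support condition ensures that
          nothing is cut off.\<close>
        have "(k - m v) + m v = k"
        proof (rule poly_mapping_eqI)
          fix E
          have "E \<in> keys k" if "E \<in> H" "v \<in> E" using v(2) that by blast
          then have "Poly_Mapping.lookup (m v) E \<le> Poly_Mapping.lookup k E"
            by (simp add: lm in_keys_iff Suc_le_eq)
          then show "Poly_Mapping.lookup ((k - m v) + m v) E = Poly_Mapping.lookup k E"
            by (simp add: lookup_add lookup_minus)
        qed
        then have "single k c = single (k - m v) c * vertex_monomial H v"
          by (simp add: vm mult_single)
        moreover have "keys (k - m v) \<subseteq> keys k"
          by (auto simp: in_keys_iff lookup_minus)
        then have "single (k - m v) c \<in> carrier ?R"
          using p k by (auto simp: poly_ring_simps mono_ideal_def poly_carrier_def)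
        moreover have "vertex_monomial H v \<in> (hypergraph_ideal H :: ('v set, 'k) mpoly set)"
        proof -
          have G: "?G \<subseteq> carrier ?R" by (rule image_subsetI) (rule vertex_monomial_in_carrier)
          show ?thesis
            unfolding hypergraph_ideal_def by (rule subsetD[OF R.genideal_self[OF G] imageI[OF v(1)]])
        qed
        ultimately show ?thesis using I.I_l_closed by (simp add: poly_ring_simps)
      qed
      have "(\<Sum>k\<in>A. single k (Poly_Mapping.lookup p k)) \<in> hypergraph_ideal H"
        if "A \<subseteq> keys p" for A
        using finite_subset[OF that finite_keys] that
      proof (induction A rule: finite_induct)
        case empty
        then show ?case using I.zero_closed by (simp add: poly_ring_simps)
      next
        case (insert k A)
        then show ?case using I.a_closed monom by (simp add: poly_ring_simps)
      qed
      from this[of "keys p"] show "p \<in> hypergraph_ideal H"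
        by (simp add: poly_mapping_sum_single)
    qed
  qed
qed

lemma pd_eq:
  assumes "finite H" "\<And>T. U T \<longleftrightarrow> (\<exists>v\<in>\<Union>H. {E \<in> H. v \<in> E} \<subseteq> T)"
    "ideal_res TYPE('k::field) H n U" "pd_ge TYPE('k) H n U"
  shows "pd TYPE('k) H = enat n"
proof -
  have U: "U = (\<lambda>T. \<exists>v\<in>\<Union>H. {E \<in> H. v \<in> E} \<subseteq> T)" using assms(2) by (simp add: fun_eq_iff)
  have "mono U" unfolding U by (intro monoI le_boolI) blast
  then show ?thesis
    using proj_dim_eq[OF assms(3,4)] hypergraph_ideal_eq[OF assms(1), where 'k = 'k] by (simp add: pd_def U Let_def)
qed

section \<open>The string as a path of variables\<close>

lemma path_gen_nth:
  "length vs = Suc (length bs) \<Longrightarrow> path_gen y vs bs T \<longleftrightarrow>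
    (\<exists>j<length bs. vs ! j \<in> T \<and> vs ! Suc j \<in> T \<and> (bs ! j \<longrightarrow> y \<in> T))"
proof (induction y vs bs T rule: path_gen.induct)
  case (1 y v v' vs b bs T)
  then show ?case by (simp add: Ex_less_Suc2)
qed auto

lemma path_sub_nth:
  "length vs = Suc (length bs) \<Longrightarrow> path_sub vs bs T \<longleftrightarrow>
    (\<exists>j<length bs. bs ! j \<and> vs ! j \<in> T \<and> vs ! Suc j \<in> T)"
proof (induction vs bs T rule: path_sub.induct)
  case (1 v v' vs b bs T)
  then show ?case by (simp add: Ex_less_Suc2)
qed auto

text \<open>Intersecting with the index range gives the end edges \<open>{w 1}\<close> and
  \<open>{w \<mu>}\<close> the same formula as the others, at \<open>j = 0\<close> and
  \<open>j = \<mu>\<close>.\<close>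

definition string_edge :: "(nat \<Rightarrow> 'v) \<Rightarrow> nat \<Rightarrow> nat \<Rightarrow> 'v set"
  where "string_edge w \<mu> j = w ` ({j, Suc j} \<inter> {1..\<mu>})"

lemma open_string_eq:
  assumes "\<mu> \<ge> 2"
  shows "open_string w \<mu> = string_edge w \<mu> ` {..\<mu>}"
proof -
  have "{0, Suc 0} \<inter> {1..\<mu>} = {1}" "{\<mu>, Suc \<mu>} \<inter> {1..\<mu>} = {\<mu>}" using assms by auto
  then have e: "string_edge w \<mu> 0 = {w 1}" "string_edge w \<mu> \<mu> = {w \<mu>}" by (simp_all add: string_edge_def)
  have "{j, Suc j} \<inter> {1..\<mu>} = {j, Suc j}" if "1 \<le> j" "j < \<mu>" for j using that by auto
  then have e': "string_edge w \<mu> j = {w j, w (Suc j)}" if "1 \<le> j" "j < \<mu>" for j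
    using that by (simp add: string_edge_def)
  have split: "{..\<mu>} = {0} \<union> {\<mu>} \<union> {j. 1 \<le> j \<and> j < \<mu>}" using assms by auto
  show ?thesis
    unfolding split image_Un open_string_def using e e' by auto
qed

lemma string_edge_mem:
  assumes "inj_on w {1..\<mu>}" "1 \<le> i" "i \<le> \<mu>"
  shows "w i \<in> string_edge w \<mu> j \<longleftrightarrow> i = j \<or> i = Suc j"
  unfolding string_edge_def using inj_on_image_mem_iff[OF assms(1), of i "{j, Suc j} \<inter> {1..\<mu>}"] assms(2,3)
  by auto

lemma inj_string_edge:
  assumes "inj_on w {1..\<mu>}" "\<mu> \<ge> 2"
  shows "inj_on (string_edge w \<mu>) {..\<mu>}"
proof (rule inj_onI)
  fix j j' assume jj: "j \<in> {..\<mu>}" "j' \<in> {..\<mu>}" "string_edge w \<mu> j = string_edge w \<mu> j'"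
  then have "(i = j \<or> i = Suc j) \<longleftrightarrow> (i = j' \<or> i = Suc j')" if "1 \<le> i" "i \<le> \<mu>" for i
    using string_edge_mem[OF assms(1) that, of j] string_edge_mem[OF assms(1) that, of j'] jj(3) by simp
  from this[of j] this[of "Suc j"] this[of j'] this[of "Suc j'"] show "j = j'"
    using jj(1,2) assms(2) by (simp, presburger)
qed

lemma Union_open_string:
  assumes "\<mu> \<ge> 2"
  shows "\<Union> (open_string w \<mu>) = w ` {1..\<mu>}"
proof -
  have "(\<Union>j\<le>\<mu>. {j, Suc j} \<inter> {1..\<mu>}) = {1..\<mu>}" by auto
  then show ?thesis unfolding open_string_eq[OF assms] string_edge_def by (auto simp: image_iff)
qed

context
  fixes w :: "nat \<Rightarrow> 'v" and \<mu> :: nat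
  assumes w: "inj_on w {1..\<mu>}" and \<mu>: "\<mu> \<ge> 2"
begin

lemma edges_at:
  assumes "j < \<mu>"
  shows "{E \<in> open_string w \<mu>. w (Suc j) \<in> E} = {string_edge w \<mu> j, string_edge w \<mu> (Suc j)}"
  using string_edge_mem[OF w, of "Suc j"] assms by (auto simp: open_string_eq[OF \<mu>])

lemma vertices: "w ` {1..\<mu>} = (\<lambda>j. w (Suc j)) ` {..<\<mu>}"
proof -
  have "{1..\<mu>} = Suc ` {..<\<mu>}" by (simp add: image_Suc_lessThan)
  then show ?thesis by (simp only: image_image)
qed

lemma edge_list:
  defines "vs \<equiv> map (string_edge w \<mu>) [0..<Suc \<mu>]"
  shows "distinct vs" "set vs = open_string w \<mu>" "length vs = Suc \<mu>"
    "\<And>j. j \<le> \<mu> \<Longrightarrow> vs ! j = string_edge w \<mu> j"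
proof -
  have "set [0..<Suc \<mu>] = {..\<mu>}" by auto
  then show "distinct vs" "set vs = open_string w \<mu>"
    using inj_string_edge[OF w \<mu>] open_string_eq[OF \<mu>, of w] unfolding vs_def
    by (simp_all only: distinct_map set_map distinct_upt simp_thms)
  show "length vs = Suc \<mu>" "\<And>j. j \<le> \<mu> \<Longrightarrow> vs ! j = string_edge w \<mu> j"
    unfolding vs_def by (simp_all del: upt_Suc)
qed

lemma pd_open_string: "pd TYPE('k::field) (open_string w \<mu>) = enat (\<mu> - \<mu> div 3)"
proof -
  define vs where "vs = map (string_edge w \<mu>) [0..<Suc \<mu>]"
  note vs = edge_list[folded vs_def]
  let ?U = "path_sub vs (replicate \<mu> True)"
  show ?thesis
  proof (rule pd_eq[where U = ?U])
    show "finite (open_string w \<mu>)" using \<mu> by (simp add: open_string_eq)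
    show "?U T \<longleftrightarrow> (\<exists>v\<in>\<Union> (open_string w \<mu>). {E \<in> open_string w \<mu>. v \<in> E} \<subseteq> T)" for T
      unfolding Union_open_string[OF \<mu>] vertices
      by (subst path_sub_nth) (auto simp: vs edges_at)
    have "ideal_res TYPE('k) (open_string w \<mu>) (kappa (replicate \<mu> True)) ?U"
      by (rule ideal_res_path_sub) (simp_all add: vs)
    then show "ideal_res TYPE('k) (open_string w \<mu>) (\<mu> - \<mu> div 3) ?U" by (simp add: kappa_replicate)
    show "pd_ge TYPE('k) (open_string w \<mu>) (\<mu> - \<mu> div 3) ?U"
      by (rule pd_ge_path_sub) (simp_all add: vs)
  qed
qed

text \<open>\<open>F\<close> itself is the variable \<open>y\<close>, new because it is not an edge
  of the string. Flag \<open>j\<close> belongs to the vertex \<open>w (Suc j)\<close>, which lies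
  exactly on the string edges \<open>j\<close> and \<open>Suc j\<close>.\<close>

lemma pd_insert_edge:
  fixes F :: "'v set"
  assumes F: "F \<subseteq> w ` {1..\<mu>}" "F \<notin> open_string w \<mu>"
  defines "bs \<equiv> map (\<lambda>j. w (Suc j) \<in> F) [0..<\<mu>]"
  shows "special_pat bs \<Longrightarrow> pd TYPE('k::field) (open_string w \<mu> \<union> {F}) = enat (Suc (\<mu> - \<mu> div 3))"
    and "two_pat bs \<or> one_pat bs \<or> zero_pat bs \<or> kap bs < \<mu> - \<mu> div 3 \<Longrightarrow>
      pd TYPE('k) (open_string w \<mu> \<union> {F}) = enat (\<mu> - \<mu> div 3)"
proof -
  define vs where "vs = map (string_edge w \<mu>) [0..<Suc \<mu>]"
  note vs = edge_list[folded vs_def]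
  let ?H = "open_string w \<mu> \<union> {F}" and ?U = "path_gen F vs bs"
  have len: "length bs = \<mu>" by (simp add: bs_def)
  have fin: "finite ?H" using \<mu> by (simp add: open_string_eq)
  have un: "\<Union> ?H = (\<lambda>j. w (Suc j)) ` {..<\<mu>}"
    using F(1) Union_open_string[OF \<mu>, of w] vertices by auto
  have at: "{E \<in> ?H. w (Suc j) \<in> E} \<subseteq> T \<longleftrightarrow>
      string_edge w \<mu> j \<in> T \<and> string_edge w \<mu> (Suc j) \<in> T \<and> (w (Suc j) \<in> F \<longrightarrow> F \<in> T)"
    if "j < \<mu>" for j T
  proof -
    have "{E \<in> ?H. w (Suc j) \<in> E} = {E \<in> open_string w \<mu>. w (Suc j) \<in> E} \<union> (if w (Suc j) \<in> F then {F} else {})"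
      by auto
    then show ?thesis unfolding edges_at[OF that] by simp
  qed
  have U: "?U T \<longleftrightarrow> (\<exists>v\<in>\<Union> ?H. {E \<in> ?H. v \<in> E} \<subseteq> T)" for T
  proof -
    have "(\<exists>v\<in>\<Union> ?H. {E \<in> ?H. v \<in> E} \<subseteq> T) \<longleftrightarrow> (\<exists>j<\<mu>. {E \<in> ?H. w (Suc j) \<in> E} \<subseteq> T)"
      unfolding un by blast
    also have "\<dots> \<longleftrightarrow> (\<exists>j<\<mu>. vs ! j \<in> T \<and> vs ! Suc j \<in> T \<and> (bs ! j \<longrightarrow> F \<in> T))"
      using at by (intro ex_cong1 conj_cong refl) (simp add: vs bs_def)
    finally show ?thesis using path_gen_nth[of vs bs F T] by (simp add: vs(3) len)
  qed
  have p: "distinct vs" "set vs \<subseteq> ?H" "length vs = Suc (length bs)" "F \<in> ?H" "F \<notin> set vs"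
    using F(2) by (auto simp: vs len)
  {
    assume s: "special_pat bs"
    \<comment> \<open>Both parts of the splitting along \<open>y\<close> have this value, so the
      crude bound gives one more, and \<open>pd_ge_special\<close> with empty \<open>zs\<close>
      attains it.\<close>
    have k: "kap bs = \<mu> - \<mu> div 3" using special_pat_kap[OF s] len by simp
    have "ideal_res TYPE('k) ?H (Suc (kap bs)) ?U"
      by (rule ideal_res_path_gen_le[OF p]) (simp_all add: k len)
    moreover have "pd_ge TYPE('k) ?H (length ([] :: 'v set list) + Suc (kap bs)) (\<lambda>T. set [] \<inter> T \<noteq> {} \<or> ?U T)"
      by (rule pd_ge_special[OF s]) (use p in auto)
    ultimately show "pd TYPE('k) ?H = enat (Suc (\<mu> - \<mu> div 3))"
      using pd_eq[OF fin U] by (simp add: k)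
  next
    assume good: "two_pat bs \<or> one_pat bs \<or> zero_pat bs \<or> kap bs < \<mu> - \<mu> div 3"
    have "ideal_res TYPE('k) ?H (\<mu> - \<mu> div 3) ?U"
    proof (cases "kap bs < \<mu> - \<mu> div 3")
      case True
      then obtain m where m: "\<mu> - \<mu> div 3 = Suc m" by (cases "\<mu> - \<mu> div 3") auto
      then show ?thesis using True ideal_res_path_gen_le[OF p, of m] by (simp add: len)
    next
      case False
      then show ?thesis
        using good ideal_res_path_gen_good[OF p] good_pat_kap[of bs] by (auto simp: len)
    qed
    moreover have "pd_ge TYPE('k) ?H (\<mu> - \<mu> div 3) ?U" using pd_ge_path_gen[OF p] by (simp add: len)
    ultimately show "pd TYPE('k) ?H = enat (\<mu> - \<mu> div 3)" using pd_eq[OF fin U] by blast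
  }
qed

end

section \<open>From the residues of the gaps to the patterns of marks\<close>

fun blocks :: "nat list \<Rightarrow> bool list" where
  "blocks [] = []"
| "blocks [n] = replicate n False"
| "blocks (n # n' # ns) = replicate n False @ True # blocks (n' # ns)"

text \<open>Follows the step of \<open>kappa\<close> and of the patterns through a run.\<close>

lemma mod3_induct [case_names 0 1 2 step]:
  assumes "P 0" "P (Suc 0)" "P (Suc (Suc 0))" "\<And>n. P n \<Longrightarrow> P (Suc (Suc (Suc n)))"
  shows "P (n::nat)"
proof (induction n rule: less_induct)
  case (less n)
  consider "n = 0" | "n = Suc 0" | "n = Suc (Suc 0)" | m where "n = Suc (Suc (Suc m))"
    by (metis nat.exhaust)
  then show ?case using assms less by cases auto
qed

lemma kappa_replicate_append: "kappa (replicate n True @ False # bs) = n - n div 3 + kappa bs"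
  by (induction n rule: mod3_induct) auto

lemma kap_blocks: "kap (blocks ns) = (\<Sum>n\<leftarrow>ns. n - n div 3)"
  by (induction ns rule: blocks.induct) (auto simp: kappa_replicate kappa_replicate_append)

lemma length_blocks: "ns \<noteq> [] \<Longrightarrow> Suc (length (blocks ns)) = sum_list ns + length ns"
  by (induction ns rule: blocks.induct) auto

lemma pat_replicate:
  "n mod 3 = 2 \<Longrightarrow> two_pat (replicate n False)"
  "n mod 3 = 1 \<Longrightarrow> one_pat (replicate n False)"
  "n mod 3 = 0 \<Longrightarrow> zero_pat (replicate n False)"
  by (induction n rule: mod3_induct) auto

lemma pat_replicate_append:
  "n mod 3 = 2 \<Longrightarrow> two_pat (replicate n False @ True # bs) = two_pat bs"
  "n mod 3 = 2 \<Longrightarrow> one_pat (replicate n False @ True # bs) = one_pat bs"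
  "n mod 3 = 2 \<Longrightarrow> zero_pat (replicate n False @ True # bs) = zero_pat bs"
  "n mod 3 = 2 \<Longrightarrow> special_pat (replicate n False @ True # bs) = special_pat bs"
  "n mod 3 = 1 \<Longrightarrow> one_pat (replicate n False @ True # bs) = two_pat bs"
  "n mod 3 = 1 \<Longrightarrow> special_pat (replicate n False @ True # bs) = one_pat bs"
  "n mod 3 = 0 \<Longrightarrow> zero_pat (replicate n False @ True # bs) = two_pat bs"
  by (induction n rule: mod3_induct) auto

lemma mod3_cases: "(n::nat) mod 3 = 0 \<or> n mod 3 = 1 \<or> n mod 3 = 2"
  by presburger

lemma sum_mod3_le: "(\<Sum>n\<leftarrow>ns. n mod 3) \<le> 2 * length (ns :: nat list)"
proof (induction ns)
  case (Cons n ns)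
  then show ?case using mod3_cases[of n] by auto
qed simp

lemma sum_mod3_zero_le:
  "n \<in> set ns \<Longrightarrow> n mod 3 = 0 \<Longrightarrow> Suc (Suc (\<Sum>n\<leftarrow>ns. n mod 3)) \<le> 2 * length (ns :: nat list)"
proof (induction ns)
  case (Cons m ns)
  then show ?case using mod3_cases[of m] sum_mod3_le[of ns] by (cases "n = m") auto
qed simp

text \<open>Residues are at most 2, so the deficit of their sum from the maximum tells the pattern:
  deficit 1 is one residue 1, and deficit 2 is one residue 0 or two residues 1.\<close>

lemma pat_blocks:
  assumes "ns \<noteq> []"
  shows "(\<Sum>n\<leftarrow>ns. n mod 3) = 2 * length ns \<Longrightarrow> two_pat (blocks ns)"
    and "Suc (\<Sum>n\<leftarrow>ns. n mod 3) = 2 * length ns \<Longrightarrow> one_pat (blocks ns)"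
    and "Suc (Suc (\<Sum>n\<leftarrow>ns. n mod 3)) = 2 * length ns \<Longrightarrow> \<exists>n\<in>set ns. n mod 3 = 0 \<Longrightarrow> zero_pat (blocks ns)"
    and "Suc (Suc (\<Sum>n\<leftarrow>ns. n mod 3)) = 2 * length ns \<Longrightarrow> \<forall>n\<in>set ns. n mod 3 \<noteq> 0 \<Longrightarrow> special_pat (blocks ns)"
  using assms
proof (induction ns rule: blocks.induct)
  case (2 n)
  {
    case 1
    then show ?case by (simp add: pat_replicate)
  next
    case 2
    then show ?case by (simp add: pat_replicate)
  next
    case 3
    then show ?case by (simp add: pat_replicate)
  next
    case 4
    then show ?case by simp
  }
next
  case (3 n n' ns)
  note le = sum_mod3_le[of "n' # ns"] and c = mod3_cases[of n]
  {
    case 1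
    then show ?case using "3.IH"(1) le c by (auto simp: pat_replicate_append)
  next
    case 2
    then show ?case using "3.IH"(1,2) le c by (auto simp: pat_replicate_append)
  next
    case 3
    let ?s = "\<Sum>m\<leftarrow>n' # ns. m mod 3"
    have s: "Suc (Suc (n mod 3 + ?s)) = 2 * length (n' # ns) + 2" using 3(1) by simp
    from c show ?case
    proof (elim disjE)
      assume n: "n mod 3 = 0"
      then have "two_pat (blocks (n' # ns))" using s by (intro "3.IH"(1)) auto
      then show ?thesis using n by (simp add: pat_replicate_append)
    next
      \<comment> \<open>Impossible: a residue 1 here and a residue 0 further on would make a deficit
        of at least 3.\<close>
      assume n: "n mod 3 = 1"
      then obtain m where "m \<in> set (n' # ns)" "m mod 3 = 0" using 3(2) by fastforce
      then show ?thesis using sum_mod3_zero_le[of m "n' # ns"] s n by linarith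
    next
      assume n: "n mod 3 = 2"
      then have "\<exists>m\<in>set (n' # ns). m mod 3 = 0" using 3(2) by fastforce
      then have "zero_pat (blocks (n' # ns))" using s n by (intro "3.IH"(3)) auto
      then show ?thesis using n by (simp add: pat_replicate_append)
    qed
  next
    case 4
    then show ?case using "3.IH"(2,4) le c by (auto simp: pat_replicate_append)
  }
qed simp_all

lemma kap_blocks_less:
  assumes "ns = n0 # n1 # ns'" "Suc (Suc (\<Sum>n\<leftarrow>ns. n mod 3)) < 2 * length ns"
  shows "kap (blocks ns) < length (blocks ns) - length (blocks ns) div 3"
proof -
  define D where "D = (\<Sum>n\<leftarrow>ns. n div 3)"
  define s where "s = (\<Sum>n\<leftarrow>ns. n mod 3)"
  define k where "k = Suc (length ns')"
  have sum: "sum_list ns = 3 * D + s" unfolding D_def s_def by (induction ns) (auto simp: algebra_simps)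
  have "(\<Sum>n\<leftarrow>ns. n - n div 3) = 2 * D + s"
    unfolding D_def s_def
  proof (induction ns)
    case (Cons n ns)
    have "n - n div 3 = 2 * (n div 3) + n mod 3" using mult_div_mod_eq[of 3 n] by linarith
    then show ?case using Cons by simp
  qed simp
  then have kap: "kap (blocks ns) = 2 * D + s" by (simp add: kap_blocks)
  have len: "length (blocks ns) = 3 * D + (s + k)"
    using length_blocks[of ns] sum assms(1) by (simp add: k_def)
  \<comment> \<open>\<open>k\<close> counts the marks, one less than the runs. The claim reduces to
    \<open>(s + k) div 3 < k\<close>.\<close>
  have "s < 2 * k" using assms by (simp add: s_def k_def)
  then have "(s + k) div 3 < k" by presburger
  then show ?thesis unfolding kap len by simp
qed

lemma blocks_of_marks:
  fixes i :: "nat \<Rightarrow> nat"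
  assumes "strict_mono_on {1..k} i" "1 \<le> i 1" "i k \<le> \<mu>" "k \<ge> 1"
    "n 1 = i 1 - 1" "\<forall>j\<in>{2..k}. n j = i j - i (j - 1) - 1" "n (k + 1) = \<mu> - i k"
  shows "map (\<lambda>p. Suc p \<in> i ` {1..k}) [0..<\<mu>] = blocks (map n [1..<k + 2])"
proof -
  have less: "i a < i b" if "1 \<le> a" "a < b" "b \<le> k" for a b
    using strict_mono_onD[OF assms(1), of a b] that by auto
  have le: "i a \<le> i b" if "1 \<le> a" "a \<le> b" "b \<le> k" for a b
    using less[of a b] that by (cases "a = b") auto
  \<comment> \<open>A fictitious mark at 0 makes the first gap like the others. Positions count from
    0 and vertices from 1, so position \<open>i' j\<close> is the one just behind the
    \<open>j\<close>-th mark; the induction goes down from the last mark.\<close>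
  define i' where "i' j = (if j = 0 then 0 else i j)" for j
  have unmarked: "Suc p \<notin> i ` {1..k}" if "i' j \<le> p" "j \<le> k" "j < k \<Longrightarrow> Suc p < i (Suc j)" for p j
  proof
    assume "Suc p \<in> i ` {1..k}"
    then obtain a where a: "1 \<le> a" "a \<le> k" "Suc p = i a" by auto
    show False
    proof (cases "a \<le> j")
      case True
      then show False using le[of a j] a that by (auto simp: i'_def)
    next
      case False
      then show False using le[of "Suc j" a] a that by auto
    qed
  qed
  have "map (\<lambda>p. Suc p \<in> i ` {1..k}) [i' j..<\<mu>] = blocks (map n [Suc j..<k + 2])" if "j \<le> k" for j
    using that
  proof (induction rule: inc_induct)
    case base
    have "map (\<lambda>p. Suc p \<in> i ` {1..k}) [i' k..<\<mu>] = map (\<lambda>p. False) [i' k..<\<mu>]"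
      using unmarked[of k] by auto
    then show ?case using assms(4,7) by (simp add: map_replicate_const i'_def)
  next
    case (step j)
    have j: "i' (Suc j) = i (Suc j)" by (simp add: i'_def)
    have nj: "n (Suc j) = i (Suc j) - 1 - i' j" "i' j < i (Suc j)" "i (Suc j) \<le> \<mu>" "1 \<le> i (Suc j)"
    proof -
      show "i (Suc j) \<le> \<mu>" "1 \<le> i (Suc j)"
        using le[of "Suc j" k] le[of 1 "Suc j"] step(2) assms(2,3) by simp_all
      then show "i' j < i (Suc j)" using less[of j "Suc j"] step(2) by (cases "j = 0") (simp_all add: i'_def)
      show "n (Suc j) = i (Suc j) - 1 - i' j"
      proof (cases "j = 0")
        case False
        then have "Suc j \<in> {2..k}" using step(2) by simp
        then have "n (Suc j) = i (Suc j) - i j - 1" using assms(6) by fastforce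
        then show ?thesis using False by (simp add: i'_def)
      qed (simp add: assms(5)[simplified] i'_def)
    qed
    have "[i' j..<\<mu>] = [i' j..<i (Suc j) - 1] @ [i (Suc j) - 1..<\<mu>]"
      using upt_add_eq_append[of "i' j" "i (Suc j) - 1" "\<mu> - (i (Suc j) - 1)"] nj by simp
    also have "[i (Suc j) - 1..<\<mu>] = (i (Suc j) - 1) # [i (Suc j)..<\<mu>]"
      using nj by (subst upt_conv_Cons) auto
    finally have split: "[i' j..<\<mu>] = [i' j..<i (Suc j) - 1] @ (i (Suc j) - 1) # [i' (Suc j)..<\<mu>]"
      by (simp add: j)
    have 1: "map (\<lambda>p. Suc p \<in> i ` {1..k}) [i' j..<i (Suc j) - 1] = map (\<lambda>p. False) [i' j..<i (Suc j) - 1]"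
    proof (rule map_cong[OF refl])
      fix p assume "p \<in> set [i' j..<i (Suc j) - 1]"
      then have "Suc p \<notin> i ` {1..k}" using step(2) by (intro unmarked[of j]) auto
      then show "(Suc p \<in> i ` {1..k}) = False" by simp
    qed
    have 2: "Suc (i (Suc j) - 1) \<in> i ` {1..k}" using nj(4) step(2) by auto
    have 3: "[Suc j..<k + 2] = Suc j # [Suc (Suc j)..<k + 2]" "[Suc (Suc j)..<k + 2] = Suc (Suc j) # [Suc (Suc (Suc j))..<k + 2]"
      using step(2) by (simp_all add: upt_conv_Cons)
    have "blocks (map n [Suc j..<k + 2]) = replicate (n (Suc j)) False @ True # blocks (map n [Suc (Suc j)..<k + 2])"
      unfolding 3(1) unfolding 3(2) by simp
    then show ?case
      unfolding split using 1 2 step(3) nj(1) by (simp add: map_replicate_const)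
  qed
  from this[of 0] show ?thesis by (simp add: i'_def del: upt_Suc)
qed

theorem theorem3p14:
  fixes w :: "nat \<Rightarrow> 'v" and \<mu> k :: nat and i n l r :: "nat \<Rightarrow> nat"
    and F :: "'v set" and H HS :: "'v set set"
  assumes "inj_on w {1..\<mu>}"
    and "HS = open_string w \<mu>"
    and "k > 1"
    and "1 \<le> i 1" and "strict_mono_on {1..k} i" and "i k \<le> \<mu>"
    and "F = {w (i j) | j. j \<in> {1..k}}"
    and "H = HS \<union> {F}"
    and "n 1 = i 1 - 1"
    and "\<forall>j\<in>{2..k}. n j = i j - i (j - 1) - 1"
    and "n (k + 1) = \<mu> - i k"
    and "\<forall>j\<in>{1..k + 1}. n j = 3 * l j + r j \<and> r j \<le> 2"
  shows "if (\<Sum>j = 1..k + 1. r j) = 2 * k \<and> (\<forall>j\<in>{1..k + 1}. r j \<noteq> 0)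
    then pd TYPE('k::field) H = pd TYPE('k) HS + 1
    else pd TYPE('k) H = pd TYPE('k) HS \<and> pd TYPE('k) HS = enat (\<mu> - \<mu> div 3)"
proof -
  have less: "i a < i b" if "1 \<le> a" "a < b" "b \<le> k" for a b
    using strict_mono_onD[OF assms(5), of a b] that by auto
  have range: "1 \<le> i a" "i a \<le> \<mu>" if "1 \<le> a" "a \<le> k" for a
    using less[of 1 a] less[of a k] that assms(3,4,6) by (cases "a = 1"; cases "a = k"; auto)+
  have \<mu>: "\<mu> \<ge> 2" using less[of 1 k] assms(3,4,6) by simp
  have HS: "pd TYPE('k) HS = enat (\<mu> - \<mu> div 3)"
    unfolding assms(2) by (rule pd_open_string[OF assms(1) \<mu>])
  have r: "r j = n j mod 3" if "j \<in> {1..k + 1}" for j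
    using assms(12) that by (metis mod_mult_self4 mod_less le_imp_less_Suc numeral_2_eq_2 numeral_3_eq_3)
  let ?special = "(\<Sum>j = 1..k + 1. r j) = 2 * k \<and> (\<forall>j\<in>{1..k + 1}. r j \<noteq> 0)"
  show ?thesis
  proof (cases "F \<in> HS")
    case True
    \<comment> \<open>An edge of the string with two distinct vertices joins neighbours, so the gap
      \<open>n 2\<close> is empty and its residue 0 excludes the special case, in accordance with
      \<open>H = HS\<close>.\<close>
    have F2: "w (i 1) \<in> F" "w (i 2) \<in> F" using assms(3) unfolding assms(7) by auto
    obtain j where "F = string_edge w \<mu> j" using True by (auto simp: assms(2) open_string_eq[OF \<mu>])
    then have "i 1 = j \<or> i 1 = Suc j" "i 2 = j \<or> i 2 = Suc j"
      using F2 string_edge_mem[OF assms(1)] range[of 1] range[of 2] assms(3) by auto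
    then have "n 2 = 0" using less[of 1 2] assms(3,10) by auto
    then have "\<not> ?special" using r[of 2] assms(3) by auto
    moreover have "H = HS" using True assms(8) by auto
    ultimately show ?thesis using HS by (simp only: if_False simp_thms)
  next
    case False
    define ns where "ns = map n [1..<k + 2]"
    define bs where "bs = map (\<lambda>j. w (Suc j) \<in> F) [0..<\<mu>]"
    have F: "F \<subseteq> w ` {1..\<mu>}" using range unfolding assms(7) by auto
    have "w (Suc p) \<in> F \<longleftrightarrow> Suc p \<in> i ` {1..k}" if "p < \<mu>" for p
    proof -
      have "w (Suc p) = w (i j) \<longleftrightarrow> Suc p = i j" if "j \<in> {1..k}" for j
        using inj_on_eq_iff[OF assms(1), of "Suc p" "i j"] range[of j] that \<open>p < \<mu>\<close> by auto
      then have "(\<exists>j\<in>{1..k}. w (Suc p) = w (i j)) \<longleftrightarrow> (\<exists>j\<in>{1..k}. Suc p = i j)" by blast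
      moreover have "w (Suc p) \<in> F \<longleftrightarrow> (\<exists>j\<in>{1..k}. w (Suc p) = w (i j))" unfolding assms(7) by blast
      ultimately show ?thesis by (simp only: image_iff)
    qed
    then have "bs = map (\<lambda>p. Suc p \<in> i ` {1..k}) [0..<\<mu>]" by (simp add: bs_def)
    also have "\<dots> = blocks ns"
      unfolding ns_def using assms(3) by (intro blocks_of_marks[OF assms(5,4,6) _ assms(9-11)]) simp
    finally have bs: "bs = blocks ns" .
    have len: "length ns = Suc k" "length (blocks ns) = \<mu>"
      by (simp add: ns_def) (simp add: bs[symmetric] bs_def)
    have "set [1..<k + 2] = {1..k + 1}" by auto
    then have set: "set ns = n ` {1..k + 1}" by (simp add: ns_def del: upt_Suc)
    have "(\<Sum>m\<leftarrow>ns. m mod 3) = (\<Sum>j\<leftarrow>[1..<k + 2]. n j mod 3)" by (simp add: ns_def comp_def del: upt_Suc)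
    also have "\<dots> = (\<Sum>j\<in>set [1..<k + 2]. n j mod 3)" by (rule sum_list_distinct_conv_sum_set) simp
    also have "\<dots> = (\<Sum>j = 1..k + 1. r j)"
      unfolding \<open>set [1..<k + 2] = {1..k + 1}\<close> by (rule sum.cong) (simp_all add: r)
    finally have sum: "(\<Sum>m\<leftarrow>ns. m mod 3) = (\<Sum>j = 1..k + 1. r j)" .
    have zero: "(\<forall>j\<in>{1..k + 1}. r j \<noteq> 0) \<longleftrightarrow> (\<forall>m\<in>set ns. m mod 3 \<noteq> 0)"
      unfolding set by (simp add: r)
    have ne: "ns \<noteq> []" using len by auto
    note pd = pd_insert_edge[OF assms(1) \<mu> F False[unfolded assms(2)], folded bs_def]
    have H: "H = open_string w \<mu> \<union> {F}" using assms(2,8) by simp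
    show ?thesis
    proof (cases ?special)
      case True
      then have "special_pat bs"
        unfolding bs using zero sum len ne by (intro pat_blocks(4)) auto
      then have "pd TYPE('k) H = enat (Suc (\<mu> - \<mu> div 3))" unfolding H by (rule pd(1))
      then show ?thesis using True HS by (simp only: if_True simp_thms) (simp add: one_enat_def)
    next
      case False
      have "two_pat bs \<or> one_pat bs \<or> zero_pat bs \<or> kap bs < \<mu> - \<mu> div 3"
      proof -
        \<comment> \<open>As \<open>length ns = k + 1\<close>, the third case is residue sum
          \<open>2 * k\<close>, where failure of the special case must come from a residue
          0.\<close>
        consider "(\<Sum>m\<leftarrow>ns. m mod 3) = 2 * length ns" | "Suc (\<Sum>m\<leftarrow>ns. m mod 3) = 2 * length ns"
          | "Suc (Suc (\<Sum>m\<leftarrow>ns. m mod 3)) = 2 * length ns" | "Suc (Suc (\<Sum>m\<leftarrow>ns. m mod 3)) < 2 * length ns"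
          using sum_mod3_le[of ns] by linarith
        then show ?thesis
        proof cases
          case 3
          then have "\<exists>m\<in>set ns. m mod 3 = 0" using False zero sum len by auto
          then have "zero_pat bs" unfolding bs by (rule pat_blocks(3)[OF ne 3])
          then show ?thesis by simp
        next
          case 4
          obtain n0 n1 ns' where "ns = n0 # n1 # ns'"
            using len(1) assms(3) by (cases ns; cases "tl ns") auto
          then show ?thesis unfolding bs using kap_blocks_less[OF _ 4] len(2) by auto
        qed (use pat_blocks(1,2)[OF ne] in \<open>auto simp: bs\<close>)
      qed
      then have "pd TYPE('k) H = enat (\<mu> - \<mu> div 3)" unfolding H by (rule pd(2))
      then show ?thesis using False HS by (simp only: if_False simp_thms)
    qed
  qed
qed

end
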